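(* Let $\mathcal M$ be a von Neumann algebra with countably decomposable center, and let $(\mu,D)$ and $(\mu',D')$ be two pairs for $\mathcal M$, each consisting of a probability measure and a dimension function, with $\mu,\mu'$ defined on the same measurable space $(\Omega,\Sigma)$ and with the same identification of $Z(\mathcal M)$ with $L_\infty(\Omega)$. Assume that $\mathcal M$ satisfies one of the following conditions: (a) $\mathcal M$ is of type II$_\infty$ or of type III; (b) $\mathcal M$ is of type II$_1$ with atomless center, or $\mathcal M$ is a II$_1$ factor. If $(\mu,D)$ and $(\mu',D')$ are equivalent, then they coincide, i.e. $\mu=\mu'$ and $D=D'$.
   Context: For a von Neumann algebra $\mathcal M$: $Z(\mathcal M)$ is its center, $P(\mathcal M)$ its projection lattice. A closed densely defined operator $x$ affiliated with $\mathcal M$ is measurable if the spectral projection $e_{(\lambda,\infty)}(|x|)$ is a finite projection for some $\lambda>0$; it is locally measurable if there are central projections $z_n\uparrow\mathbf 1$ with each $xz_n$ measurable. $LS(\mathcal M)$ is the $^*$-algebra of all locally measurable operators. Pairs. Let $(\Omega,\Sigma,\mu)$ be a probability space and $\varphi:Z(\mathcal M)\to L_\infty(\Omega,\Sigma,\mu)$ a $^*$-isomorphism. $L^+(\Omega,\Sigma,\mu)$ is the set of (a.e. classes of) measurable functions $\Omega\to[0,\infty]$. A dimension function is a map $D:P(\mathcal M)\to L^+(\Omega,\Sigma,\mu)$ such that: $D(p)\neq 0$ if $p\ne 0$; $D(p)$ is a.e. finite iff $p$ is finite; $D(p\vee q)=D(p)+D(q)$ if $pq=0$; $D(p)=D(q)$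 if $p\sim q$; $D(zp)=\varphi(z)D(p)$ for $z\in P(Z(\mathcal M))$; $D(p)=\sup_i D(p_i)$ if $p_i\uparrow p$. A pair $(\mu,D)$ consists of such a probability measure and a dimension function. Here both pairs use the same $(\Omega,\Sigma)$ and the same $\varphi$ (so $\mu$ and $\mu'$ have the same null sets and $L_\infty(\Omega,\Sigma,\mu)=L_\infty(\Omega,\Sigma,\mu')$). $F$-norm. With $[f>\lambda]=\{\omega\in\Omega:f(\omega)>\lambda\}$, for $x\in LS(\mathcal M)$, $$\|x\|_{\mu,D}=\inf_{\lambda>0}\max\{\lambda,\ \mu([D(e_{(\lambda,\infty)}(|x|))>\lambda])\}.$$ The pairs are equivalent if $\|x\|_{\mu,D}=\|x\|_{\mu',D'}$ for all $x\in LS(\mathcal M)$. *)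

theory Defs
  imports "HOL-Probability.Probability_Measure"
begin

section \<open>Complex Hilbert spaces and bounded operators\<close>

text \<open>The inner product is linear in the first argument.\<close>

class chilbert_space = banach +
  fixes scaleC :: "complex \<Rightarrow> 'a \<Rightarrow> 'a" (infixr "*\<^sub>C" 75)
    and cinner :: "'a \<Rightarrow> 'a \<Rightarrow> complex"
  assumes scaleC_add_right: "c *\<^sub>C (x + y) = c *\<^sub>C x + c *\<^sub>C y"
    and scaleC_add_left: "(c + d) *\<^sub>C x = c *\<^sub>C x + d *\<^sub>C x"
    and scaleC_scaleC: "c *\<^sub>C d *\<^sub>C x = (c * d) *\<^sub>C x"
    and scaleC_of_real: "complex_of_real r *\<^sub>C x = r *\<^sub>R x"
    and cinner_add_left: "cinner (x + y) z = cinner x z + cinner y z"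
    and cinner_scaleC_left: "cinner (c *\<^sub>C x) y = c * cinner x y"
    and cinner_commute: "cinner y x = cnj (cinner x y)"
    and cinner_self: "cinner x x = complex_of_real ((norm x)\<^sup>2)"

instantiation complex :: chilbert_space
begin

definition scaleC_complex :: "complex \<Rightarrow> complex \<Rightarrow> complex"
  where "scaleC_complex c x = c * x"

definition cinner_complex :: "complex \<Rightarrow> complex \<Rightarrow> complex"
  where "cinner_complex x y = x * cnj y"

instance
proof
  fix c d x y z :: complex and r :: real
  show "c *\<^sub>C (x + y) = c *\<^sub>C x + c *\<^sub>C y" "(c + d) *\<^sub>C x = c *\<^sub>C x + d *\<^sub>C x"
    by (simp_all only: scaleC_complex_def distrib_left distrib_right)
  show "c *\<^sub>C d *\<^sub>C x = (c * d) *\<^sub>C x"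
    by (simp only: scaleC_complex_def mult.assoc)
  show "complex_of_real r *\<^sub>C x = r *\<^sub>R x"
    by (simp only: scaleC_complex_def scaleR_conv_of_real)
  show "cinner (x + y) z = cinner x z + cinner y z"
    by (simp only: cinner_complex_def distrib_right)
  show "cinner (c *\<^sub>C x) y = c * cinner x y"
    by (simp only: cinner_complex_def scaleC_complex_def mult.assoc)
  show "cinner y x = cnj (cinner x y)"
    by (simp add: cinner_complex_def mult.commute)
  show "cinner x x = complex_of_real ((norm x)\<^sup>2)"
    by (simp only: cinner_complex_def complex_norm_square)
qed

end

definition bounded_ops :: "('h::chilbert_space \<Rightarrow> 'h) set"
  where "bounded_ops = {a. bounded_linear a \<and> (\<forall>c \<xi>. a (c *\<^sub>C \<xi>) = c *\<^sub>C a \<xi>)}"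

definition star :: "('h::chilbert_space \<Rightarrow> 'h) \<Rightarrow> 'h \<Rightarrow> 'h"
  where "star a = (THE b. \<forall>\<xi> \<eta>. cinner (a \<xi>) \<eta> = cinner \<xi> (b \<eta>))"

definition commutant :: "('h::chilbert_space \<Rightarrow> 'h) set \<Rightarrow> ('h \<Rightarrow> 'h) set"
  where "commutant S = {b \<in> bounded_ops. \<forall>a\<in>S. a \<circ> b = b \<circ> a}"

definition von_neumann_algebra :: "('h::chilbert_space \<Rightarrow> 'h) set \<Rightarrow> bool"
  where "von_neumann_algebra M \<longleftrightarrow>
    M \<subseteq> bounded_ops \<and> (\<forall>a\<in>M. star a \<in> M) \<and> commutant (commutant M) = M"

definition center :: "('h::chilbert_space \<Rightarrow> 'h) set \<Rightarrow> ('h \<Rightarrow> 'h) set"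
  where "center M = M \<inter> commutant M"

section \<open>Projections and types\<close>

definition is_projection :: "('h::chilbert_space \<Rightarrow> 'h) \<Rightarrow> bool"
  where "is_projection p \<longleftrightarrow> p \<in> bounded_ops \<and> p \<circ> p = p \<and> star p = p"

definition projections :: "('h::chilbert_space \<Rightarrow> 'h) set \<Rightarrow> ('h \<Rightarrow> 'h) set"
  where "projections M = {p \<in> M. is_projection p}"

abbreviation zero_op :: "'h::chilbert_space \<Rightarrow> 'h"
  where "zero_op \<equiv> (\<lambda>_. 0)"

definition proj_le :: "('h::chilbert_space \<Rightarrow> 'h) \<Rightarrow> ('h \<Rightarrow> 'h) \<Rightarrow> bool"
  where "proj_le p q \<longleftrightarrow> q \<circ> p = p"

text \<open>Supremum in the projection lattice of \<open>M\<close>.\<close>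

definition is_proj_sup ::
    "('h::chilbert_space \<Rightarrow> 'h) set \<Rightarrow> ('h \<Rightarrow> 'h) set \<Rightarrow> ('h \<Rightarrow> 'h) \<Rightarrow> bool"
  where "is_proj_sup M S p \<longleftrightarrow> p \<in> projections M \<and> (\<forall>q\<in>S. proj_le q p) \<and>
    (\<forall>r\<in>projections M. (\<forall>q\<in>S. proj_le q r) \<longrightarrow> proj_le p r)"

definition mvn_equiv ::
    "('h::chilbert_space \<Rightarrow> 'h) set \<Rightarrow> ('h \<Rightarrow> 'h) \<Rightarrow> ('h \<Rightarrow> 'h) \<Rightarrow> bool"
  where "mvn_equiv M p q \<longleftrightarrow> (\<exists>u\<in>M. star u \<circ> u = p \<and> u \<circ> star u = q)"

definition finite_proj :: "('h::chilbert_space \<Rightarrow> 'h) set \<Rightarrow> ('h \<Rightarrow> 'h) \<Rightarrow> bool"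
  where "finite_proj M p \<longleftrightarrow> p \<in> projections M \<and>
    (\<forall>q\<in>projections M. proj_le q p \<and> mvn_equiv M q p \<longrightarrow> q = p)"

definition abelian_proj :: "('h::chilbert_space \<Rightarrow> 'h) set \<Rightarrow> ('h \<Rightarrow> 'h) \<Rightarrow> bool"
  where "abelian_proj M p \<longleftrightarrow> p \<in> projections M \<and>
    (\<forall>a\<in>M. \<forall>b\<in>M. (p \<circ> a \<circ> p) \<circ> (p \<circ> b \<circ> p) = (p \<circ> b \<circ> p) \<circ> (p \<circ> a \<circ> p))"

definition type_II :: "('h::chilbert_space \<Rightarrow> 'h) set \<Rightarrow> bool"
  where "type_II M \<longleftrightarrow> (\<forall>p. abelian_proj M p \<longrightarrow> p = zero_op) \<and>
    (\<forall>z\<in>projections (center M). z \<noteq> zero_op \<longrightarrow>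
      (\<exists>p. finite_proj M p \<and> p \<noteq> zero_op \<and> proj_le p z))"

definition type_II_1 :: "('h::chilbert_space \<Rightarrow> 'h) set \<Rightarrow> bool"
  where "type_II_1 M \<longleftrightarrow> type_II M \<and> finite_proj M id"

definition type_II_inf :: "('h::chilbert_space \<Rightarrow> 'h) set \<Rightarrow> bool"
  where "type_II_inf M \<longleftrightarrow> type_II M \<and>
    (\<forall>z\<in>projections (center M). finite_proj M z \<longrightarrow> z = zero_op)"

definition type_III :: "('h::chilbert_space \<Rightarrow> 'h) set \<Rightarrow> bool"
  where "type_III M \<longleftrightarrow> (\<forall>p. finite_proj M p \<longrightarrow> p = zero_op)"

definition is_factor :: "('h::chilbert_space \<Rightarrow> 'h) set \<Rightarrow> bool"
  where "is_factor M \<longleftrightarrow> center M = range (\<lambda>c \<xi>. c *\<^sub>C \<xi>)"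

text \<open>No nonzero projection of \<open>N\<close> is minimal.\<close>

definition atomless :: "('h::chilbert_space \<Rightarrow> 'h) set \<Rightarrow> bool"
  where "atomless N \<longleftrightarrow> (\<forall>z\<in>projections N. z \<noteq> zero_op \<longrightarrow>
    (\<exists>w\<in>projections N. proj_le w z \<and> w \<noteq> zero_op \<and> w \<noteq> z))"

definition countably_decomposable :: "('h::chilbert_space \<Rightarrow> 'h) set \<Rightarrow> bool"
  where "countably_decomposable N \<longleftrightarrow>
    (\<forall>S \<subseteq> projections N - {zero_op}.
      (\<forall>p\<in>S. \<forall>q\<in>S. p \<noteq> q \<longrightarrow> p \<circ> q = zero_op) \<longrightarrow> countable S)"

section \<open>Unbounded operators\<close>

text \<open>A possibly unbounded operator is given by its graph. With relational composition,
  \<open>x O y\<close> is the graph of the operator product ``first \<open>x\<close>, then \<open>y\<close>'', with its maximal domain.\<close>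

type_synonym 'h op_graph = "('h \<times> 'h) set"

definition graph_of :: "('h \<Rightarrow> 'h) \<Rightarrow> 'h op_graph"
  where "graph_of a = {(\<xi>, a \<xi>) | \<xi>. True}"

definition is_operator :: "'h::chilbert_space op_graph \<Rightarrow> bool"
  where "is_operator x \<longleftrightarrow> single_valued x \<and> (0, 0) \<in> x \<and>
    (\<forall>(\<xi>, \<xi>')\<in>x. \<forall>(\<eta>, \<eta>')\<in>x. (\<xi> + \<eta>, \<xi>' + \<eta>') \<in> x) \<and>
    (\<forall>c. \<forall>(\<xi>, \<xi>')\<in>x. (c *\<^sub>C \<xi>, c *\<^sub>C \<xi>') \<in> x)"

definition densely_defined :: "'h::chilbert_space op_graph \<Rightarrow> bool"
  where "densely_defined x \<longleftrightarrow> closure (Domain x) = UNIV"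

definition adj :: "'h::chilbert_space op_graph \<Rightarrow> 'h op_graph"
  where "adj x = {(\<eta>, \<zeta>). \<forall>(\<xi>, \<xi>')\<in>x. cinner \<xi>' \<eta> = cinner \<xi> \<zeta>}"

definition positive_selfadjoint :: "'h::chilbert_space op_graph \<Rightarrow> bool"
  where "positive_selfadjoint a \<longleftrightarrow> is_operator a \<and> densely_defined a \<and> adj a = a \<and>
    (\<forall>(\<xi>, \<eta>)\<in>a. Re (cinner \<eta> \<xi>) \<ge> 0)"

text \<open>\<open>|x| = (x\<^sup>*x)\<^sup>1\<^sup>/\<^sup>2\<close>.\<close>

definition abs_op :: "'h::chilbert_space op_graph \<Rightarrow> 'h op_graph"
  where "abs_op x = (THE a. positive_selfadjoint a \<and> a O a = x O adj x)"

text \<open>The scalar measure \<open>B \<mapsto> \<langle>E(B)\<xi>, \<xi>\<rangle>\<close>.\<close>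

definition scalar_spectral_measure ::
    "(real set \<Rightarrow> 'h::chilbert_space \<Rightarrow> 'h) \<Rightarrow> 'h \<Rightarrow> real measure"
  where "scalar_spectral_measure E \<xi> =
    measure_of UNIV (sets borel) (\<lambda>B. ennreal (Re (cinner (E B \<xi>) \<xi>)))"

definition is_projection_valued_measure :: "(real set \<Rightarrow> 'h::chilbert_space \<Rightarrow> 'h) \<Rightarrow> bool"
  where "is_projection_valued_measure E \<longleftrightarrow>
    (\<forall>B\<in>sets borel. is_projection (E B)) \<and> E UNIV = id \<and>
    (\<forall>B\<in>sets borel. \<forall>C\<in>sets borel. E (B \<inter> C) = E B \<circ> E C) \<and>
    (\<forall>A. range A \<subseteq> sets borel \<and> disjoint_family A \<longrightarrow>
      (\<forall>\<xi>. (\<lambda>n. E (A n) \<xi>) sums E (\<Union>n::nat. A n) \<xi>))"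

text \<open>\<open>a = \<integral> t dE(t)\<close>. By polarization, the values of the form \<open>\<langle>a\<xi>, \<xi>\<rangle>\<close> on the dense domain
  determine the operator.\<close>

definition is_spectral_measure_of ::
    "(real set \<Rightarrow> 'h::chilbert_space \<Rightarrow> 'h) \<Rightarrow> 'h op_graph \<Rightarrow> bool"
  where "is_spectral_measure_of E a \<longleftrightarrow> is_projection_valued_measure E \<and> is_operator a \<and>
    Domain a = {\<xi>. integrable (scalar_spectral_measure E \<xi>) (\<lambda>t. t\<^sup>2)} \<and>
    (\<forall>(\<xi>, \<eta>)\<in>a. cinner \<eta> \<xi> = complex_of_real (LINT t|scalar_spectral_measure E \<xi>. t))"

definition spectral_proj :: "'h::chilbert_space op_graph \<Rightarrow> real set \<Rightarrow> 'h \<Rightarrow> 'h"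
  where "spectral_proj a B = (THE p. \<exists>E. is_spectral_measure_of E a \<and> p = E B)"

definition affiliated :: "('h::chilbert_space \<Rightarrow> 'h) set \<Rightarrow> 'h op_graph \<Rightarrow> bool"
  where "affiliated M x \<longleftrightarrow>
    (\<forall>u\<in>commutant M. star u \<circ> u = id \<and> u \<circ> star u = id \<longrightarrow> map_prod u u ` x = x)"

definition closed_affiliated :: "('h::chilbert_space \<Rightarrow> 'h) set \<Rightarrow> 'h op_graph \<Rightarrow> bool"
  where "closed_affiliated M x \<longleftrightarrow>
    is_operator x \<and> closed x \<and> densely_defined x \<and> affiliated M x"

definition measurable_op :: "('h::chilbert_space \<Rightarrow> 'h) set \<Rightarrow> 'h op_graph \<Rightarrow> bool"
  where "measurable_op M x \<longleftrightarrow> closed_affiliated M x \<and>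
    (\<exists>t>0. finite_proj M (spectral_proj (abs_op x) {t<..}))"

definition LS :: "('h::chilbert_space \<Rightarrow> 'h) set \<Rightarrow> 'h op_graph set"
  where "LS M = {x. closed_affiliated M x \<and>
    (\<exists>z :: nat \<Rightarrow> 'h \<Rightarrow> 'h. range z \<subseteq> projections (center M) \<and>
      (\<forall>n. proj_le (z n) (z (Suc n))) \<and> is_proj_sup M (range z) id \<and>
      (\<forall>n. measurable_op M (graph_of (z n) O x)))}"

section \<open>Pairs and the associated F-norm\<close>

text \<open>Elements of \<open>L\<^sub>\<infinity>\<close> and of \<open>L\<^sup>+\<close> are given by representatives, and all identities between
  them hold almost everywhere.\<close>

definition Linfty :: "'w measure \<Rightarrow> ('w \<Rightarrow> complex) set"
  where "Linfty \<mu> = {f \<in> borel_measurable \<mu>. \<exists>C. AE \<omega> in \<mu>. cmod (f \<omega>) \<le> C}"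

definition center_isomorphism ::
    "('h::chilbert_space \<Rightarrow> 'h) set \<Rightarrow> 'w measure \<Rightarrow> (('h \<Rightarrow> 'h) \<Rightarrow> 'w \<Rightarrow> complex) \<Rightarrow> bool"
  where "center_isomorphism M \<mu> \<phi> \<longleftrightarrow>
    (\<forall>a\<in>center M. \<phi> a \<in> Linfty \<mu>) \<and>
    (\<forall>a\<in>center M. \<forall>b\<in>center M. AE \<omega> in \<mu>. \<phi> (\<lambda>\<xi>. a \<xi> + b \<xi>) \<omega> = \<phi> a \<omega> + \<phi> b \<omega>) \<and>
    (\<forall>c. \<forall>a\<in>center M. AE \<omega> in \<mu>. \<phi> (\<lambda>\<xi>. c *\<^sub>C a \<xi>) \<omega> = c * \<phi> a \<omega>) \<and>
    (\<forall>a\<in>center M. \<forall>b\<in>center M. AE \<omega> in \<mu>. \<phi> (a \<circ> b) \<omega> = \<phi> a \<omega> * \<phi> b \<omega>) \<and>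
    (\<forall>a\<in>center M. AE \<omega> in \<mu>. \<phi> (star a) \<omega> = cnj (\<phi> a \<omega>)) \<and>
    (\<forall>a\<in>center M. \<forall>b\<in>center M. (AE \<omega> in \<mu>. \<phi> a \<omega> = \<phi> b \<omega>) \<longrightarrow> a = b) \<and>
    (\<forall>f\<in>Linfty \<mu>. \<exists>a\<in>center M. AE \<omega> in \<mu>. \<phi> a \<omega> = f \<omega>)"

text \<open>Supremum in the lattice \<open>L\<^sup>+\<close> of almost-everywhere classes (the essential supremum, not the
  pointwise one, since the family may be uncountable).\<close>

definition is_Lplus_sup :: "'w measure \<Rightarrow> ('w \<Rightarrow> ennreal) set \<Rightarrow> ('w \<Rightarrow> ennreal) \<Rightarrow> bool"
  where "is_Lplus_sup \<mu> F f \<longleftrightarrow> f \<in> borel_measurable \<mu> \<and>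
    (\<forall>g\<in>F. AE \<omega> in \<mu>. g \<omega> \<le> f \<omega>) \<and>
    (\<forall>h\<in>borel_measurable \<mu>. (\<forall>g\<in>F. AE \<omega> in \<mu>. g \<omega> \<le> h \<omega>) \<longrightarrow> (AE \<omega> in \<mu>. f \<omega> \<le> h \<omega>))"

text \<open>Increasing nets of projections are rendered as upward directed sets. For a central projection
  \<open>z\<close> the function \<open>\<phi> z\<close> is almost everywhere \<open>{0,1}\<close>-valued, so \<open>ennreal (Re (\<phi> z \<omega>))\<close> is just
  \<open>\<phi> z \<omega>\<close> read in \<open>[0,\<infinity>]\<close>, with \<open>0 * \<infinity> = 0\<close>.\<close>

definition dimension_function ::
    "('h::chilbert_space \<Rightarrow> 'h) set \<Rightarrow> 'w measure \<Rightarrow> (('h \<Rightarrow> 'h) \<Rightarrow> 'w \<Rightarrow> complex) \<Rightarrow>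
      (('h \<Rightarrow> 'h) \<Rightarrow> 'w \<Rightarrow> ennreal) \<Rightarrow> bool"
  where "dimension_function M \<mu> \<phi> D \<longleftrightarrow>
    (\<forall>p\<in>projections M. D p \<in> borel_measurable \<mu>) \<and>
    (\<forall>p\<in>projections M. p \<noteq> zero_op \<longrightarrow> \<not> (AE \<omega> in \<mu>. D p \<omega> = 0)) \<and>
    (\<forall>p\<in>projections M. (AE \<omega> in \<mu>. D p \<omega> < \<infinity>) \<longleftrightarrow> finite_proj M p) \<and>
    (\<forall>p\<in>projections M. \<forall>q\<in>projections M. \<forall>r. p \<circ> q = zero_op \<and> is_proj_sup M {p, q} r \<longrightarrow>
      (AE \<omega> in \<mu>. D r \<omega> = D p \<omega> + D q \<omega>)) \<and>
    (\<forall>p\<in>projections M. \<forall>q\<in>projections M. mvn_equiv M p q \<longrightarrow> (AE \<omega> in \<mu>. D p \<omega> = D q \<omega>)) \<and>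
    (\<forall>z\<in>projections (center M). \<forall>p\<in>projections M.
      AE \<omega> in \<mu>. D (z \<circ> p) \<omega> = ennreal (Re (\<phi> z \<omega>)) * D p \<omega>) \<and>
    (\<forall>S\<subseteq>projections M. \<forall>p. S \<noteq> {} \<and> (\<forall>q\<in>S. \<forall>r\<in>S. \<exists>s\<in>S. proj_le q s \<and> proj_le r s) \<and>
      is_proj_sup M S p \<longrightarrow> is_Lplus_sup \<mu> (D ` S) (D p))"

definition is_pair ::
    "('h::chilbert_space \<Rightarrow> 'h) set \<Rightarrow> (('h \<Rightarrow> 'h) \<Rightarrow> 'w \<Rightarrow> complex) \<Rightarrow>
      'w measure \<Rightarrow> (('h \<Rightarrow> 'h) \<Rightarrow> 'w \<Rightarrow> ennreal) \<Rightarrow> bool"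
  where "is_pair M \<phi> \<mu> D \<longleftrightarrow>
    prob_space \<mu> \<and> center_isomorphism M \<mu> \<phi> \<and> dimension_function M \<mu> \<phi> D"

definition F_norm ::
    "'w measure \<Rightarrow> (('h::chilbert_space \<Rightarrow> 'h) \<Rightarrow> 'w \<Rightarrow> ennreal) \<Rightarrow> 'h op_graph \<Rightarrow> real"
  where "F_norm \<mu> D x = (INF t\<in>{0<..}.
    max t (measure \<mu> {\<omega> \<in> space \<mu>. D (spectral_proj (abs_op x) {t<..}) \<omega> > ennreal t}))"

definition equivalent_pairs ::
    "('h::chilbert_space \<Rightarrow> 'h) set \<Rightarrow> 'w measure \<Rightarrow> (('h \<Rightarrow> 'h) \<Rightarrow> 'w \<Rightarrow> ennreal) \<Rightarrow>
      'w measure \<Rightarrow> (('h \<Rightarrow> 'h) \<Rightarrow> 'w \<Rightarrow> ennreal) \<Rightarrow> bool"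
  where "equivalent_pairs M \<mu> D \<mu>' D' \<longleftrightarrow> (\<forall>x\<in>LS M. F_norm \<mu> D x = F_norm \<mu>' D' x)"

end

theory Submission
  imports Defs
begin

text \<open>Only projections \<open>x = p\<close> are needed as test operators: \<open>e\<^bsub>(t,\<infinity>)\<^esub>(p)\<close> is \<open>p\<close> for \<open>t < 1\<close> and \<open>0\<close>
  otherwise, so \<open>\<parallel>p\<parallel> = inf\<^bsub>t<1\<^esub> max {t, \<mu>[D(p) > t]}\<close>. For the central projection \<open>z\<close> of a set \<open>A\<close> with
  \<open>D(1) \<ge> \<mu>(A)\<close> on \<open>A\<close> this norm is \<open>\<mu>(A)\<close>. If \<open>D(1) = \<infinity>\<close>, this gives \<open>\<mu> = \<mu>'\<close> at once; in the atomless
  II\<open>\<^sub>1\<close> case it gives \<open>\<mu>(A) = \<mu>'(A)\<close> for all sufficiently small pieces of \<open>{D(1) \<ge> \<delta>, D'(1) \<ge> \<delta>}\<close>, which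
  is enough by Radon--Nikodym.

  In all cases \<open>M\<close> has no nonzero abelian projection, so every projection splits into two orthogonal
  parts that have equal \<open>D\<close> and equal \<open>D'\<close>. If \<open>D(p) > b > a > D'(p)\<close> on a set \<open>A\<close> of positive measure,
  take a \<open>2\<^sup>n\<close>-th part of \<open>p\<close>, cut by \<open>A\<close>, with \<open>b / 2\<^sup>n \<le> \<mu>(A)\<close>: its norm is at least \<open>b / 2\<^sup>n\<close> for
  \<open>(\<mu>, D)\<close> and at most \<open>a / 2\<^sup>n\<close> for \<open>(\<mu>, D')\<close>.\<close>

section \<open>Hilbert spaces\<close>

text \<open>The F-norm weighs a threshold against the value of the dimension and against the measure
  of a set at once, so it sees at most the smaller of the two. Hence large values of D must be
  divided down before they can be compared, and in the finite case the measures can be compared only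
  on sets that are small against D(1). An atom of the center could not be cut down; in a factor the
  whole space is a single atom, and there equality of the null sets already gives equality of the
  measures. The division must use one projection for D and D' alike. Zorn's lemma is applied to
  orthogonal pairs of equal dimension rather than to equivalent pairs: suprema of chains are then
  covered by normality of the dimension functions, and no infinite sums of partial isometries are
  formed. Genuinely equivalent projections are needed only once, to enlarge a pair. They come from
  the polar decomposition of a nonzero off-diagonal block of an operator, and the block is found
  with substitutes for spectral projections, built from a square root that is a norm limit of
  polynomials.\<close>

lemma scaleC_zero_left [simp]: "0 *\<^sub>C x = (0::'h::chilbert_space)"
  using scaleC_of_real[of 0 x] by simp

lemma scaleC_one [simp]: "1 *\<^sub>C x = (x::'h::chilbert_space)"
  using scaleC_of_real[of 1 x] by simp

lemma scaleC_zero_right [simp]: "c *\<^sub>C (0::'h::chilbert_space) = 0"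
  using scaleC_add_right[of c 0 "0::'h"] by simp

lemma scaleC_minus_one: "(-1) *\<^sub>C x = - (x::'h::chilbert_space)"
  using scaleC_of_real[of "-1" x] by simp

lemma scaleC_minus_right: "c *\<^sub>C (- x) = - (c *\<^sub>C (x::'h::chilbert_space))"
  using scaleC_add_right[of c x "-x"] by (simp add: add_eq_0_iff)

lemma scaleC_diff_right: "c *\<^sub>C (x - y) = c *\<^sub>C x - c *\<^sub>C (y::'h::chilbert_space)"
  using scaleC_add_right[of c x "-y"] by (simp add: scaleC_minus_right)

lemma cinner_add_right: "cinner x (y + z) = cinner x y + cinner x (z::'h::chilbert_space)"
  by (metis cinner_add_left cinner_commute complex_cnj_add)

lemma cinner_scaleC_right: "cinner x (c *\<^sub>C y) = cnj c * cinner x (y::'h::chilbert_space)"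
  by (metis cinner_scaleC_left cinner_commute complex_cnj_mult)

lemma cinner_zero_left [simp]: "cinner 0 (x::'h::chilbert_space) = 0"
  using cinner_add_left[of 0 0 x] by simp

lemma cinner_zero_right [simp]: "cinner (x::'h::chilbert_space) 0 = 0"
  using cinner_add_right[of x 0 0] by simp

lemma cinner_minus_left: "cinner (- x) y = - cinner x (y::'h::chilbert_space)"
  using cinner_add_left[of x "-x" y] by (simp add: add_eq_0_iff)

lemma cinner_minus_right: "cinner x (- y) = - cinner x (y::'h::chilbert_space)"
  using cinner_add_right[of x y "-y"] by (simp add: add_eq_0_iff)

lemma cinner_diff_left: "cinner (x - y) z = cinner x z - cinner y (z::'h::chilbert_space)"
  using cinner_add_left[of x "-y" z] by (simp add: cinner_minus_left)

lemma cinner_diff_right: "cinner x (y - z) = cinner x y - cinner x (z::'h::chilbert_space)"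
  using cinner_add_right[of x y "-z"] by (simp add: cinner_minus_right)

lemma cinner_scaleR_left: "cinner (r *\<^sub>R x) y = of_real r * cinner x (y::'h::chilbert_space)"
  by (metis cinner_scaleC_left scaleC_of_real)

lemma cinner_scaleR_right: "cinner x (r *\<^sub>R y) = of_real r * cinner x (y::'h::chilbert_space)"
  by (metis cinner_scaleC_right scaleC_of_real complex_cnj_complex_of_real)

lemmas cinner_simps = cinner_add_left cinner_add_right cinner_diff_left cinner_diff_right
  cinner_minus_left cinner_minus_right cinner_scaleC_left cinner_scaleC_right
  cinner_scaleR_left cinner_scaleR_right

lemma Re_cinner_self [simp]: "Re (cinner x x) = (norm (x::'h::chilbert_space))\<^sup>2"
  by (simp only: cinner_self Re_complex_of_real)

lemma cinner_eq_zero_iff [simp]: "cinner x x = 0 \<longleftrightarrow> x = (0::'h::chilbert_space)"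
  by (simp add: cinner_self)

lemma Re_cinner_commute: "Re (cinner y x) = Re (cinner x (y::'h::chilbert_space))"
  by (subst cinner_commute) simp

lemma norm_scaleC: "norm (c *\<^sub>C x) = cmod c * norm (x::'h::chilbert_space)"
proof -
  have "complex_of_real ((norm (c *\<^sub>C x))\<^sup>2) = c * cnj c * complex_of_real ((norm x)\<^sup>2)"
    by (simp only: cinner_self[symmetric] cinner_scaleC_left cinner_scaleC_right mult.assoc
        mult.left_commute)
  also have "\<dots> = complex_of_real ((cmod c * norm x)\<^sup>2)"
    by (simp only: complex_norm_square[symmetric] of_real_mult[symmetric] power_mult_distrib)
  finally have "(norm (c *\<^sub>C x))\<^sup>2 = (cmod c * norm x)\<^sup>2"
    by (simp only: of_real_eq_iff)
  then show ?thesis by (simp add: power2_eq_iff_nonneg)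
qed

lemma norm_add_sq:
  "(norm (x + y))\<^sup>2 = (norm x)\<^sup>2 + 2 * Re (cinner x y) + (norm (y::'h::chilbert_space))\<^sup>2"
  using Re_cinner_commute[of x y]
  by (simp add: Re_cinner_self[symmetric] cinner_simps del: Re_cinner_self)

lemma norm_diff_sq:
  "(norm (x - y))\<^sup>2 = (norm x)\<^sup>2 - 2 * Re (cinner x y) + (norm (y::'h::chilbert_space))\<^sup>2"
  using Re_cinner_commute[of x y]
  by (simp add: Re_cinner_self[symmetric] cinner_simps del: Re_cinner_self)

text \<open>The triangle inequality comes with the norm of the class; squared and expanded, it is
  already the real half of Cauchy--Schwarz.\<close>

lemma Re_cinner_le: "Re (cinner x y) \<le> norm x * norm (y::'h::chilbert_space)"
proof -
  have "(norm (x + y))\<^sup>2 \<le> (norm x + norm y)\<^sup>2"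
    by (intro power_mono norm_triangle_ineq norm_ge_zero)
  then show ?thesis by (simp add: norm_add_sq power2_sum)
qed

lemma cinner_Cauchy_Schwarz: "cmod (cinner x y) \<le> norm x * norm (y::'h::chilbert_space)"
proof (cases "cinner x y = 0")
  case False
  \<comment> \<open>A unimodular factor that turns the inner product into its modulus, so that the
    real inequality applies.\<close>
  define c where "c = cnj (cinner x y) / of_real (cmod (cinner x y))"
  have c1: "cmod c = 1" using False by (simp add: c_def norm_divide)
  have "cinner (c *\<^sub>C x) y = of_real (cmod (cinner x y))"
    using False
    by (simp add: cinner_scaleC_left c_def complex_norm_square[symmetric] power2_eq_square mult.commute)
  then have "cmod (cinner x y) = Re (cinner (c *\<^sub>C x) y)" by simp
  also have "\<dots> \<le> norm (c *\<^sub>C x) * norm y" by (rule Re_cinner_le)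
  finally show ?thesis by (simp add: norm_scaleC c1)
qed simp

lemma bounded_linear_cinner_left: "bounded_linear (\<lambda>x. cinner x (y::'h::chilbert_space))"
  by (rule bounded_linear_intro[where K="norm y"])
    (simp_all add: cinner_simps scaleR_conv_of_real cinner_Cauchy_Schwarz)

lemma bounded_linear_cinner_right: "bounded_linear (\<lambda>y. cinner (x::'h::chilbert_space) y)"
  using cinner_Cauchy_Schwarz[of x]
  by (intro bounded_linear_intro[where K="norm x"])
    (simp_all add: cinner_simps scaleR_conv_of_real mult.commute)

lemma tendsto_cinner:
  fixes x y :: "'h::chilbert_space"
  assumes "(f \<longlongrightarrow> x) F"
  shows "((\<lambda>n. cinner (f n) y) \<longlongrightarrow> cinner x y) F" "((\<lambda>n. cinner y (f n)) \<longlongrightarrow> cinner y x) F"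
  using assms bounded_linear.tendsto[OF bounded_linear_cinner_left]
    bounded_linear.tendsto[OF bounded_linear_cinner_right] by auto

lemma cinner_ext_left:
  assumes "\<And>z. cinner x z = cinner y (z::'h::chilbert_space)" shows "x = y"
proof -
  have "cinner (x - y) (x - y) = 0" using assms[of "x - y"] by (simp add: cinner_diff_left)
  then show ?thesis by simp
qed

lemma cinner_ext_right:
  assumes "\<And>z. cinner z x = cinner z (y::'h::chilbert_space)" shows "x = y"
  by (rule cinner_ext_left) (metis assms cinner_commute)

section \<open>Orthogonal projection onto a closed subspace\<close>

definition closed_csubspace :: "'h::chilbert_space set \<Rightarrow> bool"
  where "closed_csubspace K \<longleftrightarrow> closed K \<and> 0 \<in> K \<and> (\<forall>x\<in>K. \<forall>y\<in>K. x + y \<in> K) \<and>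
    (\<forall>c. \<forall>x\<in>K. c *\<^sub>C x \<in> K)"

lemma closed_csubspace_scaleR: "closed_csubspace K \<Longrightarrow> x \<in> K \<Longrightarrow> r *\<^sub>R x \<in> K"
  unfolding closed_csubspace_def by (metis scaleC_of_real)

lemma closed_csubspace_diff: "closed_csubspace K \<Longrightarrow> x \<in> K \<Longrightarrow> y \<in> K \<Longrightarrow> x - y \<in> K"
  using closed_csubspace_scaleR[of K y "-1"] unfolding closed_csubspace_def
  by (metis diff_conv_add_uminus scaleR_minus1_left)

text \<open>A minimizing sequence for the distance to \<open>K\<close> is Cauchy by the
  parallelogram law, and at the nearest point every first variation within \<open>K\<close>
  vanishes.\<close>

lemma orthogonal_projection_exists:
  fixes x :: "'h::chilbert_space"
  assumes K: "closed_csubspace K"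
  shows "\<exists>y\<in>K. \<forall>z\<in>K. cinner (x - y) z = 0"
proof -
  define d where "d = (INF y\<in>K. (norm (x - y))\<^sup>2)"
  have K0: "0 \<in> K" and Kadd: "\<And>u v. u \<in> K \<Longrightarrow> v \<in> K \<Longrightarrow> u + v \<in> K"
    and Kcl: "closed K" and Ksc: "\<And>c u. u \<in> K \<Longrightarrow> c *\<^sub>C u \<in> K"
    using K by (auto simp: closed_csubspace_def)
  have bdd: "bdd_below ((\<lambda>y. (norm (x - y))\<^sup>2) ` K)" by (rule bdd_belowI2[of _ 0]) simp
  have dle: "d \<le> (norm (x - y))\<^sup>2" if "y \<in> K" for y
    unfolding d_def using bdd that by (rule cINF_lower)
  have "\<exists>y\<in>K. (norm (x - y))\<^sup>2 < d + 1 / real (Suc n)" for n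
    using cINF_less_iff[of K "\<lambda>y. (norm (x - y))\<^sup>2" "d + 1 / real (Suc n)"] bdd K0
    unfolding d_def by auto
  then obtain Y where Y: "\<And>n. Y n \<in> K" "\<And>n. (norm (x - Y n))\<^sup>2 < d + 1 / real (Suc n)"
    by metis
  \<comment> \<open>Parallelogram law for x - u and x - v: the midpoint of u and v lies in
    \<open>K\<close>, hence has squared distance at least \<open>d\<close> from x.\<close>
  have par: "(norm (u - v))\<^sup>2 \<le> 2 * ((norm (x - u))\<^sup>2 - d) + 2 * ((norm (x - v))\<^sup>2 - d)"
    if uv: "u \<in> K" "v \<in> K" for u v
  proof -
    have "(1/2) *\<^sub>R (u + v) \<in> K" using uv K Kadd closed_csubspace_scaleR by blast
    then have "d \<le> (norm (x - (1/2) *\<^sub>R (u + v)))\<^sup>2" by (rule dle)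
    also have "x - (1/2) *\<^sub>R (u + v) = (1/2) *\<^sub>R ((x - u) + (x - v))"
      by (simp add: algebra_simps flip: scaleR_add_left)
    also have "(norm \<dots>)\<^sup>2 = (1/4) * (norm ((x - u) + (x - v)))\<^sup>2"
      by (simp add: power_divide)
    finally have "4 * d \<le> (norm ((x - u) + (x - v)))\<^sup>2" by simp
    moreover have "(norm (u - v))\<^sup>2 = (norm ((x - v) - (x - u)))\<^sup>2" by (simp add: algebra_simps)
    ultimately show ?thesis
      using norm_add_sq[of "x - u" "x - v"] norm_diff_sq[of "x - v" "x - u"]
        Re_cinner_commute[of "x - u" "x - v"] by argo
  qed
  have "Cauchy Y"
  proof (rule CauchyI)
    fix e :: real assume e: "e > 0"
    \<comment> \<open>By \<open>par\<close> the squared distance of two terms is below 2/(m+1) +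
      2/(n+1), which is at most 4/(N+1).\<close>
    obtain N where N: "4 / e\<^sup>2 < real N" using reals_Archimedean2 by blast
    have "norm (Y m - Y n) < e" if mn: "m \<ge> N" "n \<ge> N" for m n
    proof -
      have "1 / real (Suc m) \<le> 1 / real (Suc N)" "1 / real (Suc n) \<le> 1 / real (Suc N)"
        using mn by (auto intro!: divide_left_mono)
      then have "(norm (Y m - Y n))\<^sup>2 < 4 / real (Suc N)"
        using par[OF Y(1) Y(1), of m n] Y(2)[of m] Y(2)[of n] by simp
      also have "\<dots> \<le> e\<^sup>2"
        using N e by (simp add: field_simps) (smt (verit) zero_le_power2)
      finally show ?thesis using e by (simp add: power2_less_imp_less)
    qed
    then show "\<exists>M. \<forall>m\<ge>M. \<forall>n\<ge>M. norm (Y m - Y n) < e" by blast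
  qed
  then obtain y where y: "Y \<longlonglongrightarrow> y" using Cauchy_convergent convergent_def by blast
  have yK: "y \<in> K" using Kcl Y(1) y closed_sequentially by blast
  have "(\<lambda>n. d + 1 / real (Suc n)) \<longlonglongrightarrow> d + 0"
    using LIMSEQ_inverse_real_of_nat by (intro tendsto_add) (simp_all add: inverse_eq_divide)
  moreover have "(\<lambda>n. (norm (x - Y n))\<^sup>2) \<longlonglongrightarrow> (norm (x - y))\<^sup>2"
    by (intro tendsto_intros y)
  ultimately have ny: "(norm (x - y))\<^sup>2 \<le> d"
    using LIMSEQ_le Y(2) by (metis (no_types, lifting) add.right_neutral less_imp_le)
  have "cinner (x - y) z = 0" if z: "z \<in> K" for z
  proof -
    define c where "c = cinner (x - y) z"
    \<comment> \<open>Step size for moving y in the direction \<open>c *\<^sub>C z\<close>: the gain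
      is 2 r |c|^2 and the loss is at most r |c|^2, because r |z|^2 \<le> 1. The added 1 covers z =
      0.\<close>
    define r where "r = 1 / ((norm z)\<^sup>2 + 1)"
    have r: "r > 0" "r * (norm z)\<^sup>2 \<le> 1" 
      by (auto simp: r_def field_simps add_pos_nonneg)
    have "y + (of_real r * c) *\<^sub>C z \<in> K" using yK z Kadd Ksc by blast
    then have "d \<le> (norm (x - y - (of_real r * c) *\<^sub>C z))\<^sup>2"
      using dle by (metis diff_diff_eq)
    also have "\<dots> = (norm (x - y))\<^sup>2 - 2 * (r * (cmod c)\<^sup>2) + (r * cmod c * norm z)\<^sup>2"
    proof -
      have "cnj c * cinner (x - y) z = of_real ((cmod c)\<^sup>2)"
        unfolding c_def[symmetric] by (metis complex_norm_square mult.commute)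
      then have "cinner (x - y) ((of_real r * c) *\<^sub>C z) = of_real (r * (cmod c)\<^sup>2)"
        by (simp add: cinner_scaleC_right mult.assoc)
      then show ?thesis using r by (simp add: norm_diff_sq norm_scaleC norm_mult)
    qed
    finally have "2 * (r * (cmod c)\<^sup>2) \<le> r * (cmod c)\<^sup>2 * (r * (norm z)\<^sup>2)"
      using ny by (simp add: power2_eq_square algebra_simps)
    also have "\<dots> \<le> r * (cmod c)\<^sup>2"
      using r by (simp add: mult_left_le)
    finally have "r * (cmod c)\<^sup>2 \<le> 0" by simp
    then show ?thesis using r by (simp add: c_def mult_le_0_iff)
  qed
  then show ?thesis using yK by blast
qed

definition proj_on :: "'h::chilbert_space set \<Rightarrow> 'h \<Rightarrow> 'h"
  where "proj_on K x = (SOME y. y \<in> K \<and> (\<forall>z\<in>K. cinner (x - y) z = 0))"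

lemma proj_on:
  assumes "closed_csubspace K"
  shows "proj_on K x \<in> K" "z \<in> K \<Longrightarrow> cinner (x - proj_on K x) z = 0"
proof -
  have "\<exists>y. y \<in> K \<and> (\<forall>z\<in>K. cinner (x - y) z = 0)"
    using orthogonal_projection_exists[OF assms] by blast
  from someI_ex[OF this] show "proj_on K x \<in> K" "z \<in> K \<Longrightarrow> cinner (x - proj_on K x) z = 0"
    unfolding proj_on_def by blast+
qed

lemma proj_on_unique:
  assumes K: "closed_csubspace K" and y: "y \<in> K" "\<And>z. z \<in> K \<Longrightarrow> cinner (x - y) z = 0"
  shows "proj_on K x = y"
proof -
  let ?d = "proj_on K x - y"
  have d: "?d \<in> K" using proj_on(1)[OF K] y closed_csubspace_diff[OF K] by blast
  have "cinner ?d ?d = cinner (x - y) ?d - cinner (x - proj_on K x) ?d"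
    by (simp add: cinner_diff_left)
  also have "\<dots> = 0" using d y proj_on(2)[OF K] by simp
  finally show ?thesis by simp
qed

section \<open>Bounded operators and adjoints\<close>

lemma bounded_opsI:
  assumes "\<And>x y. a (x + y) = a x + a y" "\<And>c x. a (c *\<^sub>C x) = c *\<^sub>C a x" "\<And>x. norm (a x) \<le> B * norm x"
  shows "a \<in> bounded_ops"
proof -
  have "bounded_linear a"
    by (rule bounded_linear_intro[where K=B]) (use assms in \<open>metis scaleC_of_real mult.commute\<close>)+
  then show ?thesis using assms by (simp add: bounded_ops_def)
qed

lemma bounded_ops_bounded_linear: "a \<in> bounded_ops \<Longrightarrow> bounded_linear a"
  by (simp add: bounded_ops_def)

lemma bounded_ops_add: "a \<in> bounded_ops \<Longrightarrow> a (x + y) = a x + a y"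
  by (simp add: bounded_ops_def bounded_linear.linear linear_add)

lemma bounded_ops_diff: "a \<in> bounded_ops \<Longrightarrow> a (x - y) = a x - a y"
  by (simp add: bounded_ops_def bounded_linear.linear linear_diff)

lemma bounded_ops_scaleC: "a \<in> bounded_ops \<Longrightarrow> a (c *\<^sub>C x) = c *\<^sub>C a x"
  by (simp add: bounded_ops_def)

lemma bounded_ops_scaleR: "a \<in> bounded_ops \<Longrightarrow> a (r *\<^sub>R x) = r *\<^sub>R a x"
  by (simp add: bounded_ops_def bounded_linear.linear linear_scale)

lemma bounded_ops_zero: "a \<in> bounded_ops \<Longrightarrow> a 0 = 0"
  by (simp add: bounded_ops_def bounded_linear.linear linear_0)

lemmas bounded_ops_simps = bounded_ops_add bounded_ops_diff bounded_ops_scaleC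
  bounded_ops_scaleR bounded_ops_zero

lemma bounded_ops_bound:
  assumes "a \<in> bounded_ops" obtains B where "B > 0" "\<And>x. norm (a x) \<le> B * norm x"
  using bounded_linear.pos_bounded[OF bounded_ops_bounded_linear[OF assms]]
  by (metis mult.commute)

lemma bounded_ops_id: "id \<in> bounded_ops"
  by (rule bounded_opsI[where B=1]) auto

lemma bounded_ops_zero_op: "zero_op \<in> bounded_ops"
  by (rule bounded_opsI[where B=0]) auto

lemma bounded_ops_comp:
  assumes "a \<in> bounded_ops" "b \<in> bounded_ops" shows "a \<circ> b \<in> bounded_ops"
  using assms bounded_linear_compose[of a b] by (auto simp: bounded_ops_def o_def)

lemma bounded_ops_plus:
  assumes "a \<in> bounded_ops" "b \<in> bounded_ops" shows "(\<lambda>x. a x + b x) \<in> bounded_ops"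
  using assms bounded_linear_add[of a b] by (auto simp: bounded_ops_def scaleC_add_right)

lemma bounded_ops_minus:
  assumes "a \<in> bounded_ops" "b \<in> bounded_ops" shows "(\<lambda>x. a x - b x) \<in> bounded_ops"
  using assms bounded_linear_sub[of a b] by (auto simp: bounded_ops_def scaleC_diff_right)

lemma bounded_ops_scale:
  assumes "a \<in> bounded_ops" shows "(\<lambda>x. c *\<^sub>C a x) \<in> bounded_ops"
proof -
  obtain B where "B > 0" "\<And>x. norm (a x) \<le> B * norm x" using bounded_ops_bound assms by blast
  then have "norm (c *\<^sub>C a x) \<le> (cmod c * B) * norm x" for x
    by (simp add: norm_scaleC mult_left_mono mult.assoc)
  then show ?thesis using assms
    by (intro bounded_opsI[where B="cmod c * B"])
      (auto simp: bounded_ops_simps scaleC_add_right scaleC_scaleC mult.commute)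
qed

text \<open>For nonzero f, the part w of some v that is orthogonal to the kernel spans the
  complement of the kernel: x - (f x / f w) w lies in the kernel, hence is orthogonal to w.\<close>

lemma Riesz_representation:
  fixes f :: "'h::chilbert_space \<Rightarrow> complex"
  assumes add: "\<And>x y. f (x + y) = f x + f y" and sc: "\<And>c x. f (c *\<^sub>C x) = c * f x"
    and bd: "\<And>x. cmod (f x) \<le> B * norm x"
  shows "\<exists>w. \<forall>x. f x = cinner x w"
proof (cases "\<forall>x. f x = 0")
  case True then show ?thesis by (intro exI[of _ 0]) simp
next
  case False
  then obtain v where v: "f v \<noteq> 0" by blast
  have "bounded_linear f"
    by (rule bounded_linear_intro[where K=B])
      (use add sc bd in \<open>simp_all add: mult.commute scaleR_conv_of_real flip: scaleC_of_real\<close>)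
  then have cont: "continuous_on UNIV f" by (rule linear_continuous_on)
  define K where "K = {x. f x = 0}"
  have "closed K" unfolding K_def using cont by (intro closed_Collect_eq) auto
  then have K: "closed_csubspace K"
    using add sc[of 0] sc by (auto simp: closed_csubspace_def K_def)
  define w where "w = v - proj_on K v"
  have fpv: "f (proj_on K v) = 0" using proj_on(1)[OF K] by (auto simp: K_def)
  have fw: "f w = f v" using add[of w "proj_on K v"] by (simp add: w_def fpv)
  have wo: "cinner w z = 0" if "f z = 0" for z
    unfolding w_def by (rule proj_on(2)[OF K]) (simp add: K_def that)
  have w0: "w \<noteq> 0" using fw v sc[of 0 0] by auto
  \<comment> \<open>The factor that makes k (w, w) equal to f w. It enters the representing vector
    conjugated, since \<open>cinner\<close> is conjugate linear in its second argument.\<close>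
  define k where "k = f w / cinner w w"
  have kk: "k * cinner w w = f w" using w0 by (simp add: k_def)
  have "f x = cinner x (cnj k *\<^sub>C w)" for x
  proof -
    define u where "u = x - (f x / f w) *\<^sub>C w"
    have ux: "x = u + (f x / f w) *\<^sub>C w" by (simp add: u_def)
    have "f x = f u + f x" using add[of u "(f x / f w) *\<^sub>C w"] sc fw v by (simp add: u_def)
    then have "cinner w u = 0" by (intro wo) simp
    then have "cinner u w = 0" by (metis cinner_commute complex_cnj_zero)
    then have "cinner x w = (f x / f w) * cinner w w"
      by (subst ux) (simp add: cinner_simps)
    then have "cinner x (cnj k *\<^sub>C w) = (f x / f w) * (k * cinner w w)"
      by (simp add: cinner_scaleC_right)
    then show ?thesis using kk fw v by simp
  qed
  then show ?thesis by blast
qed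

text \<open>\<open>star\<close> is a definite description, so nothing is known of it before an
  adjoint has been exhibited. Riesz gives its value at each y, and choice collects the
  values.\<close>

lemma star_cinner:
  assumes a: "a \<in> bounded_ops"
  shows "cinner (a x) y = cinner x (star a y)"
proof -
  obtain B where B: "B > 0" "\<And>x. norm (a x) \<le> B * norm x" using bounded_ops_bound a by blast
  have "\<exists>w. \<forall>x. cinner (a x) y = cinner x w" for y
  proof (rule Riesz_representation[where B="B * norm y"])
    show "cmod (cinner (a x) y) \<le> B * norm y * norm x" for x
      using cinner_Cauchy_Schwarz[of "a x" y] mult_right_mono[OF B(2)[of x], of "norm y"]
      by (simp add: algebra_simps)
  qed (simp_all add: bounded_ops_simps[OF a] cinner_simps)
  then have "\<forall>y. \<exists>w. \<forall>x. cinner (a x) y = cinner x w" by blast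
  from choice[OF this] obtain b where b: "\<And>x y. cinner (a x) y = cinner x (b y)" by blast
  have "star a = b" unfolding star_def
  proof (rule the_equality)
    show "c = b" if "\<forall>x y. cinner (a x) y = cinner x (c y)" for c
    proof
      fix z show "c z = b z" by (rule cinner_ext_right) (metis that b)
    qed
  qed (simp add: b)
  then show ?thesis using b by simp
qed

lemma star_unique:
  assumes "a \<in> bounded_ops" "\<And>x y. cinner (a x) y = cinner x (b y)"
  shows "star a = b"
proof
  fix y show "star a y = b y" by (rule cinner_ext_right) (metis assms(2) star_cinner[OF assms(1)])
qed

lemma star_cinner_left: "a \<in> bounded_ops \<Longrightarrow> cinner (star a x) y = cinner x (a y)"
  by (metis cinner_commute star_cinner)

lemma star_bounded:
  assumes a: "a \<in> bounded_ops" shows "star a \<in> bounded_ops"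
proof -
  obtain B where B: "B > 0" "\<And>x. norm (a x) \<le> B * norm x" using bounded_ops_bound a by blast
  show ?thesis
  proof (rule bounded_opsI)
    fix x
    have "(norm (star a x))\<^sup>2 = Re (cinner (a (star a x)) x)"
      by (simp add: star_cinner[OF a] cinner_self)
    also have "\<dots> \<le> norm (a (star a x)) * norm x" by (rule Re_cinner_le)
    also have "\<dots> \<le> B * norm (star a x) * norm x" by (intro mult_right_mono B) simp
    finally have "norm (star a x) * norm (star a x) \<le> norm (star a x) * (B * norm x)"
      by (simp add: power2_eq_square algebra_simps)
    then show "norm (star a x) \<le> B * norm x"
      using B(1) by (cases "star a x = 0") simp_all
  qed (rule cinner_ext_left, simp add: star_cinner_left[OF a] cinner_simps)+
qed

lemma star_star: "a \<in> bounded_ops \<Longrightarrow> star (star a) = a"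
  by (rule star_unique) (simp_all add: star_bounded star_cinner_left)

lemma star_comp: "a \<in> bounded_ops \<Longrightarrow> b \<in> bounded_ops \<Longrightarrow> star (a \<circ> b) = star b \<circ> star a"
  by (rule star_unique) (simp_all add: bounded_ops_comp star_cinner)

section \<open>Projections as symmetric idempotents\<close>

lemma is_projection_iff:
  "is_projection p \<longleftrightarrow> p \<in> bounded_ops \<and> (\<forall>x. p (p x) = p x) \<and>
    (\<forall>x y. cinner (p x) y = cinner x (p y))"
proof -
  have "(p \<circ> p = p) = (\<forall>x. p (p x) = p x)" by (auto simp: fun_eq_iff)
  moreover have "star p = p \<longleftrightarrow> (\<forall>x y. cinner (p x) y = cinner x (p y))" if "p \<in> bounded_ops"
    using that star_cinner star_unique by metis
  ultimately show ?thesis by (auto simp: is_projection_def)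
qed

lemma projection_bounded: "is_projection p \<Longrightarrow> p \<in> bounded_ops"
  and projection_idem: "is_projection p \<Longrightarrow> p (p x) = p x"
  and projection_sym: "is_projection p \<Longrightarrow> cinner (p x) y = cinner x (p y)"
  by (auto simp: is_projection_iff)

lemma projection_cinner_self: "is_projection p \<Longrightarrow> cinner (p x) x = of_real ((norm (p x))\<^sup>2)"
  by (metis cinner_self projection_idem projection_sym)

lemma projection_pythagoras:
  assumes "is_projection p" shows "(norm x)\<^sup>2 = (norm (p x))\<^sup>2 + (norm (x - p x))\<^sup>2"
proof -
  have "cinner (p x) x = cinner (p x) (p x)"
    by (metis assms cinner_self projection_cinner_self)
  then have "cinner (p x) (x - p x) = 0" by (simp add: cinner_diff_right)
  then show ?thesis using norm_add_sq[of "p x" "x - p x"] by simp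
qed

lemma projection_norm_le: "is_projection p \<Longrightarrow> norm (p x) \<le> norm x"
  using projection_pythagoras[of p x]
  by (metis le_add_same_cancel1 norm_ge_zero power2_le_imp_le zero_le_power2)

lemma is_projection_proj_on:
  assumes K: "closed_csubspace K" shows "is_projection (proj_on K)"
  unfolding is_projection_iff
proof (intro conjI allI)
  have Kadd: "\<And>u v. u \<in> K \<Longrightarrow> v \<in> K \<Longrightarrow> u + v \<in> K" and Ksc: "\<And>c u. u \<in> K \<Longrightarrow> c *\<^sub>C u \<in> K"
    using K by (auto simp: closed_csubspace_def)
  have o: "cinner (proj_on K x) z = cinner x z" if "z \<in> K" for x z
    using proj_on(2)[OF K that, of x] by (simp add: cinner_diff_left)
  have o': "cinner z (proj_on K x) = cinner z x" if "z \<in> K" for x z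
    by (metis cinner_commute o that)
  show "proj_on K \<in> bounded_ops"
  proof (rule bounded_opsI[where B=1])
    fix x y show "proj_on K (x + y) = proj_on K x + proj_on K y"
      by (rule proj_on_unique[OF K]) (simp_all add: Kadd proj_on(1)[OF K] cinner_simps o)
  next
    fix c x show "proj_on K (c *\<^sub>C x) = c *\<^sub>C proj_on K x"
      by (rule proj_on_unique[OF K]) (simp_all add: Ksc proj_on(1)[OF K] cinner_simps o)
  next
    fix x
    have "(norm x)\<^sup>2 = (norm (proj_on K x + (x - proj_on K x)))\<^sup>2" by simp
    also have "\<dots> = (norm (proj_on K x))\<^sup>2 + (norm (x - proj_on K x))\<^sup>2"
      unfolding norm_add_sq by (simp add: cinner_diff_right o' proj_on(1)[OF K])
    finally have "(norm (proj_on K x))\<^sup>2 \<le> (norm x)\<^sup>2" by simp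
    then show "norm (proj_on K x) \<le> 1 * norm x" by simp
  qed
  show "proj_on K (proj_on K x) = proj_on K x" for x
    by (rule proj_on_unique[OF K]) (simp_all add: proj_on(1)[OF K])
  show "cinner (proj_on K x) y = cinner x (proj_on K y)" for x y
    by (metis o o' proj_on(1)[OF K])
qed

lemma proj_on_fixed_iff: "closed_csubspace K \<Longrightarrow> proj_on K x = x \<longleftrightarrow> x \<in> K"
  by (metis cinner_zero_left diff_self proj_on(1) proj_on_unique)

lemma closed_csubspace_Inter_kernels:
  assumes "S \<subseteq> bounded_ops" shows "closed_csubspace {x. \<forall>a\<in>S. a x = 0}"
proof -
  have "closed {x. a x = 0}" if "a \<in> S" for a
    using that assms by (intro closed_Collect_eq linear_continuous_on)
      (auto simp: bounded_ops_bounded_linear subset_iff)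
  then have "closed (\<Inter>a\<in>S. {x. a x = 0})" by blast
  moreover have "(\<Inter>a\<in>S. {x. a x = 0}) = {x. \<forall>a\<in>S. a x = 0}" by blast
  ultimately show ?thesis using assms unfolding closed_csubspace_def
    by (auto simp: subset_iff bounded_ops_simps)
qed

text \<open>The hypothesis \<open>inv\<close> says pdp = dp. Its left side is symmetric, so taking
  adjoints gives pdp = pd.\<close>

lemma symmetric_commutes_projection:
  assumes p: "is_projection p" and d: "\<And>x y. cinner (d x) y = cinner x (d y)"
    and inv: "\<And>x. p (d (p x)) = d (p x)"
  shows "d (p x) = p (d x)"
proof (rule cinner_ext_left)
  fix z
  show "cinner (d (p x)) z = cinner (p (d x)) z"
    by (metis d inv p projection_sym)
qed

section \<open>Projections and absolute values in a von Neumann algebra\<close>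

lemma commutant_bounded: "b \<in> commutant S \<Longrightarrow> b \<in> bounded_ops"
  by (simp add: commutant_def)

lemma commutant_commute: "b \<in> commutant S \<Longrightarrow> a \<in> S \<Longrightarrow> a (b x) = b (a x)"
  by (auto simp: commutant_def fun_eq_iff)

lemma commutantI: "b \<in> bounded_ops \<Longrightarrow> (\<And>a x. a \<in> S \<Longrightarrow> a (b x) = b (a x)) \<Longrightarrow> b \<in> commutant S"
  by (auto simp: commutant_def)

lemma star_commute:
  assumes "a \<in> bounded_ops" "b \<in> bounded_ops" "\<And>x. a (b x) = b (a x)"
  shows "star a (star b x) = star b (star a x)"
proof -
  have "a \<circ> b = b \<circ> a" using assms(3) by auto
  then have "star b \<circ> star a = star a \<circ> star b" using star_comp assms(1,2) by metis
  then show ?thesis by (metis comp_apply)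
qed

lemma proj_le_iff: "proj_le p q \<longleftrightarrow> (\<forall>x. q (p x) = p x)"
  by (auto simp: proj_le_def fun_eq_iff)

lemma proj_leD: "proj_le p q \<Longrightarrow> q (p x) = p x"
  by (simp add: proj_le_iff)

text \<open>This is the adjoint of the identity qp = p that defines the order.\<close>

lemma proj_leD':
  assumes "is_projection p" "is_projection q" "proj_le p q"
  shows "p (q x) = p x"
  by (rule cinner_ext_left) (metis assms proj_leD projection_sym)

lemma proj_le_trans: "proj_le p q \<Longrightarrow> proj_le q r \<Longrightarrow> proj_le p r"
  unfolding proj_le_iff by metis

lemma proj_le_antisym:
  assumes "is_projection p" "is_projection q" "proj_le p q" "proj_le q p" shows "p = q"
  using proj_leD'[OF assms(1-3)] proj_leD[OF assms(4)] by (metis ext)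

lemma orthogonal_projections_sym:
  assumes "is_projection p" "is_projection q" "\<And>x. p (q x) = 0" shows "q (p x) = 0"
  by (rule cinner_ext_left) (metis assms projection_sym cinner_zero_right cinner_zero_left)

lemma is_projection_complement: "is_projection p \<Longrightarrow> is_projection (\<lambda>x. x - p x)"
  using bounded_ops_minus[OF bounded_ops_id, of p]
  by (auto simp: is_projection_iff bounded_ops_simps cinner_simps)

lemma is_projection_diff:
  assumes "is_projection p" "is_projection q" "proj_le p q"
  shows "is_projection (\<lambda>x. q x - p x)"
  using assms bounded_ops_minus[of q p] proj_leD'[OF assms] proj_leD[OF assms(3)]
  by (auto simp: is_projection_iff bounded_ops_simps cinner_simps)

lemma is_projection_add:
  assumes "is_projection p" "is_projection q" "\<And>x. p (q x) = 0"
  shows "is_projection (\<lambda>x. p x + q x)"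
  using assms bounded_ops_plus[of p q] orthogonal_projections_sym[OF assms]
  by (auto simp: is_projection_iff bounded_ops_simps cinner_simps)

lemma is_projection_comp:
  assumes "is_projection p" "is_projection q" "\<And>x. p (q x) = q (p x)"
  shows "is_projection (p \<circ> q)"
  unfolding is_projection_iff
proof (intro conjI allI)
  show "p \<circ> q \<in> bounded_ops" using assms by (simp add: bounded_ops_comp projection_bounded)
  show "(p \<circ> q) ((p \<circ> q) x) = (p \<circ> q) x" for x
    using assms(3) projection_idem[OF assms(1)] projection_idem[OF assms(2)] by simp
  show "cinner ((p \<circ> q) x) y = cinner x ((p \<circ> q) y)" for x y
    using assms(3) projection_sym[OF assms(1)] projection_sym[OF assms(2)] by simp
qed

lemma is_projection_id: "is_projection id"
  by (simp add: is_projection_iff bounded_ops_id)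

lemma is_projection_zero_op: "is_projection zero_op"
  by (simp add: is_projection_iff bounded_ops_zero_op)

section \<open>Closure properties and the projection lattice\<close>

locale vn_algebra =
  fixes M :: "('h::chilbert_space \<Rightarrow> 'h) set"
  assumes vn: "von_neumann_algebra M"
begin

lemma M_bounded: "a \<in> M \<Longrightarrow> a \<in> bounded_ops"
  and M_star: "a \<in> M \<Longrightarrow> star a \<in> M"
  using vn by (auto simp: von_neumann_algebra_def)

text \<open>The bicommutant condition turns membership in \<open>M\<close> into commutation with the
  commutant, so closure under the algebraic operations and, later, membership of limits need no
  topology on \<open>M\<close>.\<close>

lemma MI:
  assumes "a \<in> bounded_ops" "\<And>b x. b \<in> commutant M \<Longrightarrow> a (b x) = b (a x)"
  shows "a \<in> M"
proof -
  have "a \<in> commutant (commutant M)" by (rule commutantI) (simp_all add: assms)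
  then show ?thesis using vn by (simp add: von_neumann_algebra_def)
qed

lemma M_commute: "a \<in> M \<Longrightarrow> b \<in> commutant M \<Longrightarrow> a (b x) = b (a x)"
  by (rule commutant_commute)

lemma id_in_M: "id \<in> M" and zero_in_M: "zero_op \<in> M"
  by (rule MI; auto simp: bounded_ops_id bounded_ops_zero_op commutant_bounded bounded_ops_zero)+

lemma M_comp: "a \<in> M \<Longrightarrow> b \<in> M \<Longrightarrow> a \<circ> b \<in> M"
  by (rule MI) (simp_all add: bounded_ops_comp M_bounded M_commute)

lemma M_add: "a \<in> M \<Longrightarrow> b \<in> M \<Longrightarrow> (\<lambda>x. a x + b x) \<in> M"
  by (rule MI) (simp_all add: bounded_ops_plus M_bounded M_commute commutant_bounded bounded_ops_add)

lemma M_diff: "a \<in> M \<Longrightarrow> b \<in> M \<Longrightarrow> (\<lambda>x. a x - b x) \<in> M"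
  by (rule MI) (simp_all add: bounded_ops_minus M_bounded M_commute commutant_bounded bounded_ops_diff)

lemma M_scale: "a \<in> M \<Longrightarrow> (\<lambda>x. c *\<^sub>C a x) \<in> M"
  by (rule MI) (simp_all add: bounded_ops_scale M_bounded M_commute commutant_bounded bounded_ops_scaleC)

lemma M_complement: "a \<in> M \<Longrightarrow> (\<lambda>x. x - a x) \<in> M"
  using M_diff[OF id_in_M] by simp

lemma star_commutant:
  assumes "b \<in> commutant M" shows "star b \<in> commutant M"
proof (rule commutantI)
  show "star b \<in> bounded_ops" using assms by (simp add: star_bounded commutant_bounded)
  fix a x assume a: "a \<in> M"
  have "star (star a) (star b x) = star b (star (star a) x)"
    by (rule star_commute[OF M_bounded[OF M_star[OF a]] commutant_bounded[OF assms]])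
      (rule M_commute[OF M_star[OF a] assms])
  then show "a (star b x) = star b (a x)" by (simp add: star_star M_bounded a)
qed

lemma projections_iff: "p \<in> projections M \<longleftrightarrow> p \<in> M \<and> is_projection p"
  by (simp add: projections_def)

lemma id_projection: "id \<in> projections M" and zero_projection: "zero_op \<in> projections M"
  by (simp_all add: projections_iff id_in_M zero_in_M is_projection_id is_projection_zero_op)

lemma projections_complement: "p \<in> projections M \<Longrightarrow> (\<lambda>x. x - p x) \<in> projections M"
  by (simp add: projections_iff M_complement is_projection_complement)

lemma projections_diff:
  "p \<in> projections M \<Longrightarrow> q \<in> projections M \<Longrightarrow> proj_le p q \<Longrightarrow> (\<lambda>x. q x - p x) \<in> projections M"
  by (simp add: projections_iff M_diff is_projection_diff)

lemma is_proj_sup_add: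
  assumes p: "p \<in> projections M" and q: "q \<in> projections M" and o: "\<And>x. p (q x) = 0"
  shows "is_proj_sup M {p, q} (\<lambda>x. p x + q x)"
  unfolding is_proj_sup_def
proof (intro conjI ballI impI)
  have pp: "is_projection p" "is_projection q" and pq: "p \<in> M" "q \<in> M"
    using p q by (simp_all add: projections_iff)
  show "(\<lambda>x. p x + q x) \<in> projections M"
    using pp pq o by (simp add: projections_iff M_add is_projection_add)
  have o': "q (p x) = 0" for x using orthogonal_projections_sym[OF pp o] .
  show "proj_le r (\<lambda>x. p x + q x)" if "r \<in> {p, q}" for r
    using that pp o o' by (auto simp: proj_le_iff projection_idem)
  show "proj_le (\<lambda>x. p x + q x) r" if "r \<in> projections M" "\<forall>q\<in>{p, q}. proj_le q r" for r
    using that by (auto simp: proj_le_iff bounded_ops_add projections_iff M_bounded)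
qed

text \<open>The commutant is closed under \<open>star\<close>, so a closed subspace invariant under
  it is even reducing, and its projection commutes with the commutant.\<close>

lemma proj_on_in_projections:
  assumes K: "closed_csubspace K" and inv: "\<And>b x. b \<in> commutant M \<Longrightarrow> x \<in> K \<Longrightarrow> b x \<in> K"
  shows "proj_on K \<in> projections M"
proof -
  have P: "is_projection (proj_on K)" by (rule is_projection_proj_on[OF K])
  have "proj_on K (b x) = b (proj_on K x)" if b: "b \<in> commutant M" for b x
  proof (rule proj_on_unique[OF K])
    show "b (proj_on K x) \<in> K" using inv b proj_on(1)[OF K] by blast
    fix z assume z: "z \<in> K"
    have "cinner (b x - b (proj_on K x)) z = cinner (x - proj_on K x) (star b z)"
      using b by (simp add: star_cinner commutant_bounded flip: bounded_ops_diff)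
    also have "\<dots> = 0" using inv[OF star_commutant[OF b] z] by (rule proj_on(2)[OF K])
    finally show "cinner (b x - b (proj_on K x)) z = 0" .
  qed
  then show ?thesis using P by (simp add: projections_iff MI projection_bounded)
qed

lemma proj_on_kernels_in_projections:
  assumes S: "S \<subseteq> M" shows "proj_on {x. \<forall>a\<in>S. a x = 0} \<in> projections M"
proof (rule proj_on_in_projections)
  show "closed_csubspace {x. \<forall>a\<in>S. a x = 0}"
    using S M_bounded by (intro closed_csubspace_Inter_kernels) blast
  show "b x \<in> {x. \<forall>a\<in>S. a x = 0}" if "b \<in> commutant M" "x \<in> {x. \<forall>a\<in>S. a x = 0}" for b x
    using that S M_commute bounded_ops_zero[OF commutant_bounded] by fastforce
qed

text \<open>The closed span of the ranges is the orthogonal complement of the common kernel. Working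
  with the kernel makes closedness and invariance under the commutant immediate.\<close>

lemma proj_sup_exists:
  assumes S: "S \<subseteq> projections M" shows "\<exists>p. is_proj_sup M S p"
proof -
  define K where "K = {x. \<forall>a\<in>S. a x = 0}"
  have SM: "S \<subseteq> M" "\<And>a. a \<in> S \<Longrightarrow> is_projection a" using S by (auto simp: projections_iff)
  have K: "closed_csubspace K"
    unfolding K_def using SM M_bounded by (intro closed_csubspace_Inter_kernels) blast
  have k: "proj_on K \<in> projections M"
    unfolding K_def by (rule proj_on_kernels_in_projections[OF SM(1)])
  then have kp: "is_projection (proj_on K)" by (simp add: projections_iff)
  have "is_proj_sup M S (\<lambda>x. x - proj_on K x)"
    unfolding is_proj_sup_def
  proof (intro conjI ballI impI)
    show "(\<lambda>x. x - proj_on K x) \<in> projections M" by (rule projections_complement[OF k])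
    fix q assume q: "q \<in> S"
    have "q (proj_on K x) = 0" for x using proj_on(1)[OF K, of x] q by (simp add: K_def)
    then have "proj_on K (q x) = 0" for x
      using orthogonal_projections_sym[OF SM(2)[OF q] kp] by blast
    then show "proj_le q (\<lambda>x. x - proj_on K x)" by (simp add: proj_le_iff)
  next
    fix r assume r: "r \<in> projections M" "\<forall>q\<in>S. proj_le q r"
    then have rp: "is_projection r" by (simp add: projections_iff)
    have "q (x - r x) = 0" if "q \<in> S" for q x
      using proj_leD'[OF SM(2)[OF that] rp] r(2) that
      by (simp add: bounded_ops_diff[OF projection_bounded[OF SM(2)[OF that]]])
    \<comment> \<open>Complements reverse the order: for an upper bound r the range of 1 - r lies in
      the common kernel.\<close>
    then have *: "proj_on K (x - r x) = x - r x" for x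
      unfolding proj_on_fixed_iff[OF K] by (simp add: K_def)
    have "r (x - proj_on K x) = x - proj_on K x" for x
    proof -
      have "proj_le (\<lambda>x. x - r x) (proj_on K)" using * by (simp add: proj_le_iff)
      then have "proj_on K x - r (proj_on K x) = x - r x"
        using proj_leD'[OF is_projection_complement[OF rp] kp] by blast
      then show ?thesis by (simp add: bounded_ops_diff[OF projection_bounded[OF rp]] algebra_simps)
    qed
    then show "proj_le (\<lambda>x. x - proj_on K x) r" by (simp add: proj_le_iff)
  qed
  then show ?thesis by blast
qed

text \<open>The square root of \<open>a = star y \<circ> y\<close> is found as \<open>1 - X\<close>, where \<open>X\<close> is the norm limit of
  \<open>X\<^sub>0 = 0\<close>, \<open>X\<^sub>n\<^sub>+\<^sub>1 = ((1 - a) + X\<^sub>n\<^sup>2) / 2\<close>. The increments are dominated by those of the scalar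
  iteration \<open>s\<^sub>n\<^sub>+\<^sub>1 = (1 + s\<^sub>n\<^sup>2) / 2\<close>, which increases to 1.\<close>

lemma absolute_value_contraction:
  assumes y: "y \<in> M" and y1: "\<And>x. norm (y x) \<le> norm x"
  shows "\<exists>h\<in>bounded_ops. (\<forall>x z. cinner (h x) z = cinner x (h z)) \<and> (\<forall>x. 0 \<le> Re (cinner (h x) x)) \<and>
    (\<forall>x. h (h x) = star y (y x)) \<and>
    (\<forall>d\<in>bounded_ops. (\<forall>x. d (star y (y x)) = star y (y (d x))) \<longrightarrow> (\<forall>x. d (h x) = h (d x)))"
proof -
  define b where "b = (\<lambda>x. x - star y (y x))"
  define X where "X = rec_nat zero_op (\<lambda>_ F x. (1/2) *\<^sub>R (b x + F (F x)))"
  define s :: "nat \<Rightarrow> real" where "s = rec_nat 0 (\<lambda>_ t. (1 + t\<^sup>2) / 2)"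
  have X0: "X 0 x = 0" and XS: "X (Suc n) x = (1/2) *\<^sub>R (b x + X n (X n x))" for n x
    by (simp_all add: X_def)
  have s0: "s 0 = 0" and sS: "s (Suc n) = (1 + (s n)\<^sup>2) / 2" for n by (simp_all add: s_def)
  have yb: "y \<in> bounded_ops" using y by (rule M_bounded)
  have ysb: "star y \<in> bounded_ops" by (rule star_bounded[OF yb])
  have bb: "b \<in> bounded_ops"
    using bounded_ops_minus[OF bounded_ops_id bounded_ops_comp[OF ysb yb]] by (simp add: b_def)
  have ys1: "norm (star y x) \<le> norm x" for x
  proof -
    have "norm (star y x) * norm (star y x) = Re (cinner (y (star y x)) x)"
      by (simp add: star_cinner[OF yb] cinner_self power2_eq_square)
    also have "\<dots> \<le> norm (y (star y x)) * norm x" by (rule Re_cinner_le)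
    also have "\<dots> \<le> norm (star y x) * norm x" by (intro mult_right_mono y1) simp
    finally show ?thesis by (cases "star y x = 0") simp_all
  qed
  have b1: "norm (b x) \<le> norm x" for x
  proof -
    have "Re (cinner x (star y (y x))) = (norm (y x))\<^sup>2" by (simp flip: star_cinner[OF yb])
    then have "(norm (b x))\<^sup>2 = (norm x)\<^sup>2 - 2 * (norm (y x))\<^sup>2 + (norm (star y (y x)))\<^sup>2"
      by (simp add: b_def norm_diff_sq)
    moreover have "(norm (star y (y x)))\<^sup>2 \<le> (norm (y x))\<^sup>2" by (intro power_mono ys1) simp
    ultimately have "(norm (b x))\<^sup>2 \<le> (norm x)\<^sup>2" using zero_le_power2[of "norm (y x)"] by linarith
    then show ?thesis by simp
  qed
  have bs: "cinner (b x) z = cinner x (b z)" for x z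
    by (simp add: b_def cinner_simps star_cinner_left[OF yb] star_cinner[OF yb])
  have s01: "0 \<le> s n \<and> s n \<le> 1" for n
  proof (induction n)
    case (Suc n)
    then have "(s n)\<^sup>2 \<le> 1" by (simp add: power_le_one)
    then show ?case by (simp add: sS)
  qed (simp add: s0)
  have smono: "s n \<le> s (Suc n)" for n
    using zero_le_power2[of "1 - s n"] by (simp add: sS power2_eq_square algebra_simps)
  have Xb: "X n \<in> bounded_ops" for n
  proof (induction n)
    case 0 then show ?case using bounded_ops_zero_op by (simp add: X_def)
  next
    case (Suc n)
    have "(\<lambda>x. complex_of_real (1/2) *\<^sub>C (b x + (X n \<circ> X n) x)) \<in> bounded_ops"
      by (rule bounded_ops_scale[OF bounded_ops_plus[OF bb bounded_ops_comp[OF Suc Suc]]])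
    then show ?case unfolding scaleC_of_real by (simp add: X_def)
  qed
  have Xn: "norm (X n x) \<le> s n * norm x" for n x
  proof (induction n arbitrary: x)
    case (Suc n)
    have "norm (X n (X n x)) \<le> s n * norm (X n x)" by (rule Suc)
    also have "\<dots> \<le> s n * (s n * norm x)" by (intro mult_left_mono Suc) (simp add: s01)
    finally have "norm (b x + X n (X n x)) \<le> norm x + s n * (s n * norm x)"
      using norm_triangle_ineq[of "b x" "X n (X n x)"] b1[of x] by linarith
    then show ?case by (simp add: XS sS power2_eq_square distrib_right mult.assoc)
  qed (simp add: X0 s0)
  have Xc: "d (X n x) = X n (d x)" if d: "d \<in> bounded_ops" "\<And>x. d (b x) = b (d x)" for d n x
  proof (induction n arbitrary: x)
    case 0 then show ?case using d by (simp add: X0 bounded_ops_zero)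
  next
    case (Suc n) then show ?case using d by (simp add: XS bounded_ops_simps[OF d(1)])
  qed
  have Xs: "cinner (X n x) z = cinner x (X n z)" for n x z
  proof (induction n arbitrary: x z)
    case (Suc n) then show ?case by (simp add: XS cinner_simps bs)
  qed (simp add: X0)
  have XX: "X n (X m x) = X m (X n x)" for n m x
    using Xc[OF Xb, of m n x] Xc[OF bb, of m] by (simp add: Xc[OF bb])
  \<comment> \<open>All \<open>X n\<close> commute, so X_{n+1}^2 - X_n^2 = (X_{n+1} - X_n)(X_{n+1} +
    X_n). The same factorization of the scalars s_n makes the bound reproduce itself.\<close>
  have Xd: "norm (X (Suc n) x - X n x) \<le> (s (Suc n) - s n) * norm x" for n x
  proof (induction n arbitrary: x)
    case 0 then show ?case using b1[of x] by (simp add: XS X0 sS s0)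
  next
    case (Suc n)
    let ?u = "X (Suc n) x + X n x"
    have "X (Suc n) (X (Suc n) x) - X n (X n x) = X (Suc n) ?u - X n ?u"
      by (simp add: bounded_ops_add[OF Xb] XX[of n "Suc n"])
    then have "X (Suc (Suc n)) x - X (Suc n) x = (1/2) *\<^sub>R (X (Suc n) ?u - X n ?u)"
      by (simp only: XS[of "Suc n" x]) (simp add: XS[of n x] scaleR_diff_right[symmetric])
    then have "norm (X (Suc (Suc n)) x - X (Suc n) x) = (1/2) * norm (X (Suc n) ?u - X n ?u)"
      by simp
    also have "\<dots> \<le> (1/2) * ((s (Suc n) - s n) * norm ?u)" using Suc[of ?u] by simp
    also have "\<dots> \<le> (1/2) * ((s (Suc n) - s n) * (s (Suc n) * norm x + s n * norm x))"
      using smono[of n] norm_triangle_ineq[of "X (Suc n) x" "X n x"] Xn[of n x] Xn[of "Suc n" x]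
      by (intro mult_left_mono) auto
    also have "\<dots> = (s (Suc (Suc n)) - s (Suc n)) * norm x"
      by (simp only: sS[of "Suc n"]) (simp add: sS[of n] power2_eq_square field_simps)
    finally show ?case .
  qed
  have Xd': "norm (X (n + k) x - X n x) \<le> (s (n + k) - s n) * norm x" for n k x
  proof (induction k)
    case (Suc k)
    have "norm (X (n + Suc k) x - X n x) \<le> norm (X (Suc (n + k)) x - X (n + k) x) + norm (X (n + k) x - X n x)"
      using norm_triangle_ineq[of "X (Suc (n + k)) x - X (n + k) x" "X (n + k) x - X n x"] by simp
    then show ?case using Xd[of "n + k" x] Suc by (simp add: algebra_simps)
  qed simp
  have "incseq s" using smono by (rule incseq_SucI)
  moreover have "s n \<le> 1" for n using s01 by blast
  ultimately have "convergent s" by (metis incseq_convergent convergentI)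
  then have sC: "Cauchy s" by (simp add: Cauchy_convergent_iff)
  have "Cauchy (\<lambda>n. X n x)" for x
  proof (rule CauchyI)
    fix e :: real assume e: "e > 0"
    have p: "norm x + 1 > 0" by (simp add: add_nonneg_pos)
    then have "e / (norm x + 1) > 0" using e by simp
    from CauchyD[OF sC this] obtain N
      where N: "\<And>m n. m \<ge> N \<Longrightarrow> n \<ge> N \<Longrightarrow> norm (s m - s n) < e / (norm x + 1)" by blast
    have *: "norm (X m x - X n x) < e" if mn: "n \<ge> N" "m \<ge> n" for m n
    proof -
      obtain k where k: "m = n + k" using mn le_Suc_ex by blast
      have d: "s m - s n < e / (norm x + 1)" using N[of m n] mn by simp
      have "norm (X m x - X n x) \<le> (s m - s n) * norm x" unfolding k by (rule Xd')
      also have "\<dots> \<le> e / (norm x + 1) * norm x" using d by (intro mult_right_mono) simp_all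
      also have "\<dots> < e" using p e by (simp add: field_simps)
      finally show ?thesis .
    qed
    have "norm (X m x - X n x) < e" if "m \<ge> N" "n \<ge> N" for m n
      using *[of n m] *[of m n] that norm_minus_commute[of "X m x" "X n x"] by (cases "m \<ge> n") auto
    then show "\<exists>N. \<forall>m\<ge>N. \<forall>n\<ge>N. norm (X m x - X n x) < e" by blast
  qed
  then have "\<forall>x. \<exists>l. (\<lambda>n. X n x) \<longlonglongrightarrow> l" using Cauchy_convergent convergent_def by blast
  from choice[OF this] obtain Y where Y: "\<And>x. (\<lambda>n. X n x) \<longlonglongrightarrow> Y x" by blast
  have Xn1: "norm (X n x) \<le> norm x" for n x
    using Xn[of n x] s01[of n] mult_right_mono[of "s n" 1 "norm x"] by simp
  have Y1: "norm (Y x) \<le> norm x" for x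
    by (rule LIMSEQ_le_const2[OF tendsto_norm[OF Y]]) (use Xn1 in blast)
  have Yb: "Y \<in> bounded_ops"
  proof (rule bounded_opsI[where B=1])
    fix x z c
    show "Y (x + z) = Y x + Y z"
      using tendsto_add[OF Y[of x] Y[of z]] Y[of "x + z"]
      by (simp add: bounded_ops_add[OF Xb] LIMSEQ_unique)
    have "bounded_linear (\<lambda>x::'h. c *\<^sub>C x)"
      using bounded_ops_bounded_linear[OF bounded_ops_scale[OF bounded_ops_id, of c]] by simp
    from bounded_linear.tendsto[OF this Y[of x]]
    show "Y (c *\<^sub>C x) = c *\<^sub>C Y x"
      using Y[of "c *\<^sub>C x"] by (simp add: bounded_ops_scaleC[OF Xb] LIMSEQ_unique)
  qed (simp add: Y1)
  have Ys: "cinner (Y x) z = cinner x (Y z)" for x z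
    using tendsto_cinner(1)[OF Y[of x], of z] tendsto_cinner(2)[OF Y[of z], of x]
    by (simp add: Xs LIMSEQ_unique)
  have Yc: "d (Y x) = Y (d x)" if d: "d \<in> bounded_ops" "\<And>x. d (b x) = b (d x)" for d x
    using bounded_linear.tendsto[OF bounded_ops_bounded_linear[OF d(1)] Y[of x]] Y[of "d x"]
    by (simp add: Xc[OF d] LIMSEQ_unique)
  \<comment> \<open>The fixed point equation. X_n (X_n x - Y x) tends to 0 because the X_n are
    contractions, and X_n (Y x) tends to Y (Y x); so the squares converge pointwise.\<close>
  have YY: "2 *\<^sub>R Y x = b x + Y (Y x)" for x
  proof -
    have "(\<lambda>n. X n (X n x - Y x)) \<longlonglongrightarrow> 0"
    proof (rule Lim_null_comparison)
      show "\<forall>\<^sub>F n in sequentially. norm (X n (X n x - Y x)) \<le> norm (X n x - Y x)"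
        using Xn1 by simp
      show "(\<lambda>n. norm (X n x - Y x)) \<longlonglongrightarrow> 0"
        using Y[of x] by (simp add: LIM_zero tendsto_norm_zero)
    qed
    from tendsto_add[OF this Y[of "Y x"]] have "(\<lambda>n. X n (X n x)) \<longlonglongrightarrow> Y (Y x)"
      by (simp add: bounded_ops_diff[OF Xb])
    then have "(\<lambda>n. b x + X n (X n x)) \<longlonglongrightarrow> b x + Y (Y x)" by (intro tendsto_intros)
    moreover have "(\<lambda>n. 2 *\<^sub>R X (Suc n) x) \<longlonglongrightarrow> 2 *\<^sub>R Y x"
      using LIMSEQ_Suc[OF Y[of x]] by (intro tendsto_intros)
    ultimately show ?thesis by (simp add: XS LIMSEQ_unique)
  qed
  show ?thesis
  proof (intro bexI[of _ "\<lambda>x. x - Y x"] conjI allI ballI impI)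
    fix x z :: 'h
    show "(\<lambda>x. x - Y x) \<in> bounded_ops" using bounded_ops_minus[OF bounded_ops_id Yb] by simp
    show "cinner (x - Y x) z = cinner x (z - Y z)" by (simp add: cinner_simps Ys)
    have "Re (cinner (Y x) x) \<le> norm (Y x) * norm x" by (rule Re_cinner_le)
    also have "\<dots> \<le> norm x * norm x" by (intro mult_right_mono Y1) simp
    finally show "0 \<le> Re (cinner (x - Y x) x)" by (simp add: cinner_simps power2_eq_square)
    \<comment> \<open>(1 - Y)^2 = 1 - 2Y + Y^2 = 1 - b by \<open>YY\<close>.\<close>
    show "x - Y x - Y (x - Y x) = star y (y x)"
      using YY[of x] by (simp add: bounded_ops_diff[OF Yb] b_def scaleR_2 algebra_simps)
  next
    fix d x assume d: "d \<in> bounded_ops" "\<forall>x. d (star y (y x)) = star y (y (d x))"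
    have "d (b x) = b (d x)" for x using d by (simp add: b_def bounded_ops_diff)
    then show "d (x - Y x) = d x - Y (d x)" using Yc[OF d(1)] by (simp add: bounded_ops_diff[OF d(1)])
  qed
qed

text \<open>Dividing \<open>y\<close> by a norm bound reduces to a contraction. The last clause
  makes h a function of \<open>star y \<circ> y\<close>: applied to the commutant it puts h into
  \<open>M\<close>, and in \<open>spectral_split\<close> it makes the projection found there a
  function of the given operator.\<close>

lemma absolute_value:
  assumes y: "y \<in> M"
  shows "\<exists>h\<in>M. (\<forall>x z. cinner (h x) z = cinner x (h z)) \<and> (\<forall>x. 0 \<le> Re (cinner (h x) x)) \<and>
    (\<forall>x. h (h x) = star y (y x)) \<and>
    (\<forall>d\<in>bounded_ops. (\<forall>x. d (star y (y x)) = star y (y (d x))) \<longrightarrow> (\<forall>x. d (h x) = h (d x)))"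
proof -
  have yb: "y \<in> bounded_ops" using y by (rule M_bounded)
  obtain B where B: "B > 0" "\<And>x. norm (y x) \<le> B * norm x" using bounded_ops_bound[OF yb] by blast
  define v where "v = (\<lambda>x. complex_of_real (1/B) *\<^sub>C y x)"
  have vM: "v \<in> M" unfolding v_def by (rule M_scale[OF y])
  have vx: "v x = (1/B) *\<^sub>R y x" for x by (simp only: v_def scaleC_of_real)
  have "norm (v x) \<le> norm x" for x using B(1) B(2)[of x] by (simp add: vx field_simps)
  from absolute_value_contraction[OF vM this] obtain k where k: "k \<in> bounded_ops"
    "\<And>x z. cinner (k x) z = cinner x (k z)" "\<And>x. 0 \<le> Re (cinner (k x) x)"
    "\<And>x. k (k x) = star v (v x)"
    "\<And>d. d \<in> bounded_ops \<Longrightarrow> \<forall>x. d (star v (v x)) = star v (v (d x)) \<Longrightarrow> \<forall>x. d (k x) = k (d x)"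
    by metis
  have sv: "star v = (\<lambda>x. (1/B) *\<^sub>R star y x)"
    by (rule star_unique) (simp_all add: M_bounded vM vx cinner_simps star_cinner[OF yb])
  have vv: "star v (v x) = (1 / B\<^sup>2) *\<^sub>R star y (y x)" for x
    by (simp add: sv vx bounded_ops_scaleR[OF star_bounded[OF yb]] power2_eq_square)
  define h where "h = (\<lambda>x. complex_of_real B *\<^sub>C k x)"
  have hx: "h x = B *\<^sub>R k x" for x by (simp only: h_def scaleC_of_real)
  have hb: "h \<in> bounded_ops" unfolding h_def by (rule bounded_ops_scale[OF k(1)])
  have comm: "d (h x) = h (d x)"
    if d: "d \<in> bounded_ops" "\<And>x. d (star y (y x)) = star y (y (d x))" for d x
    using k(5)[OF d(1)] d by (simp add: vv hx bounded_ops_scaleR)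
  show ?thesis
  proof (intro bexI[of _ h] conjI allI ballI impI)
    show "h \<in> M"
      by (rule MI[OF hb], rule comm[symmetric])
        (simp_all add: commutant_bounded M_commute[OF y, symmetric] M_commute[OF M_star[OF y], symmetric])
    show "cinner (h x) z = cinner x (h z)" for x z by (simp add: hx cinner_simps k(2))
    show "0 \<le> Re (cinner (h x) x)" for x using k(3)[of x] B(1) by (simp add: hx cinner_simps)
    show "h (h x) = star y (y x)" for x
      using B(1) by (simp add: hx bounded_ops_scaleR[OF k(1)] k(4) vv power2_eq_square)
  qed (rule comm, simp_all)
qed

end

section \<open>Equivalent orthogonal subprojections\<close>

text \<open>Polarization: the tests with x + z and x + iz give the sum and the difference of (T x,
  z) and (T z, x). The second test needs complex scalars.\<close>

lemma quadratic_form_zero: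
  assumes T: "T \<in> bounded_ops" and q: "\<And>x. cinner (T x) x = 0"
  shows "T x = (0::'h::chilbert_space)"
proof (rule cinner_ext_left)
  fix z
  have "cinner (T (x + z)) (x + z) = 0" "cinner (T (x + \<i> *\<^sub>C z)) (x + \<i> *\<^sub>C z) = 0" by (rule q)+
  then have 1: "cinner (T x) z + cinner (T z) x = 0"
    and "- \<i> * cinner (T x) z + \<i> * cinner (T z) x = 0"
    using q[of x] q[of z] by (simp_all add: bounded_ops_simps[OF T] cinner_simps)
  then have "\<i> * (cinner (T z) x - cinner (T x) z) = 0" by (simp add: algebra_simps)
  then have "cinner (T z) x = cinner (T x) z" by simp
  then show "cinner (T x) z = cinner 0 z" using 1 by simp
qed

context vn_algebra
begin

text \<open>With h = |y|, the map h x -> y x is isometric and extends to a partial isometry u from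
  the closed range of h onto that of y. \<open>P\<close> and \<open>Q\<close> are its initial and
  final projections; \<open>s\<close> and \<open>q\<close> bound the support and the range of
  \<open>y\<close>, hence those of u.\<close>

lemma polar_decomposition:
  assumes y: "y \<in> M" and y0: "y \<noteq> zero_op" and q: "q \<in> projections M" and s: "s \<in> projections M"
    and qy: "\<And>x. q (y x) = y x" and ys: "\<And>x. y (s x) = y x"
  shows "\<exists>P\<in>projections M. \<exists>Q\<in>projections M. mvn_equiv M P Q \<and> P \<noteq> zero_op \<and>
    proj_le P s \<and> proj_le Q q"
proof -
  have yb: "y \<in> bounded_ops" and qb: "q \<in> bounded_ops" and sp: "is_projection s"
    using y q s by (simp_all add: M_bounded projections_iff)
  have sb: "s \<in> bounded_ops" using sp by (rule projection_bounded)
  obtain h where hM: "h \<in> M" and hs: "\<And>x z. cinner (h x) z = cinner x (h z)"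
    and hh: "\<And>x. h (h x) = star y (y x)" using absolute_value[OF y] by blast
  have hb: "h \<in> bounded_ops" using hM by (rule M_bounded)
  have "(norm (h x))\<^sup>2 = (norm (y x))\<^sup>2" for x
  proof -
    have "cinner (h x) (h x) = cinner x (h (h x))" by (rule hs)
    also have "\<dots> = cinner (y x) (y x)" by (simp add: hh star_cinner[OF yb])
    finally show ?thesis by (metis Re_cinner_self)
  qed
  then have hy: "norm (h x) = norm (y x)" for x using power2_eq_imp_eq norm_ge_zero by blast
  define K where "K = {x. \<exists>\<xi>. (\<lambda>n::nat. h (\<xi> n)) \<longlonglongrightarrow> x}"
  \<comment> \<open>The closure of the relation h x -> y x. By \<open>hy\<close> it is isometric,
    hence single-valued, so u will not depend on the approximating sequence.\<close>
  define G where "G x l \<longleftrightarrow> (\<exists>\<xi>. (\<lambda>n::nat. h (\<xi> n)) \<longlonglongrightarrow> x \<and> (\<lambda>n. y (\<xi> n)) \<longlonglongrightarrow> l)" for x l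
  have Krange: "K = closure (range h)"
  proof (intro set_eqI iffI)
    fix x assume "x \<in> K"
    then obtain \<xi> where "(\<lambda>n. h (\<xi> n)) \<longlonglongrightarrow> x" unfolding K_def by blast
    then show "x \<in> closure (range h)"
      unfolding closure_sequential by (intro exI[of _ "\<lambda>n. h (\<xi> n)"]) simp
  next
    fix x assume "x \<in> closure (range h)"
    then obtain f where f: "\<And>n::nat. f n \<in> range h" "f \<longlonglongrightarrow> x"
      unfolding closure_sequential by blast
    then have "\<forall>n. \<exists>\<xi>. h \<xi> = f n" by (metis rangeE)
    from choice[OF this] obtain \<xi> where "\<And>n. h (\<xi> n) = f n" by blast
    then have "(\<lambda>n. h (\<xi> n)) \<longlonglongrightarrow> x" using f(2) by simp
    then show "x \<in> K" unfolding K_def by blast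
  qed
  have scaleC_tendsto: "(\<lambda>n::nat. c *\<^sub>C f n) \<longlonglongrightarrow> c *\<^sub>C (l::'h)" if "f \<longlonglongrightarrow> l" for f l c
    using bounded_linear.tendsto[OF bounded_ops_bounded_linear[OF bounded_ops_scale[OF bounded_ops_id, of c]] that]
    by simp
  have Gadd: "G (x + x') (l + l')" if GG: "G x l" "G x' l'" for x x' l l'
  proof -
    obtain \<xi> \<xi>' where "(\<lambda>n::nat. h (\<xi> n)) \<longlonglongrightarrow> x" "(\<lambda>n. y (\<xi> n)) \<longlonglongrightarrow> l"
      "(\<lambda>n::nat. h (\<xi>' n)) \<longlonglongrightarrow> x'" "(\<lambda>n. y (\<xi>' n)) \<longlonglongrightarrow> l'"
      using GG unfolding G_def by blast
    then have "(\<lambda>n. h (\<xi> n + \<xi>' n)) \<longlonglongrightarrow> x + x'" "(\<lambda>n. y (\<xi> n + \<xi>' n)) \<longlonglongrightarrow> l + l'"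
      unfolding bounded_ops_add[OF hb] bounded_ops_add[OF yb] by (auto intro: tendsto_intros)
    then show ?thesis unfolding G_def by (intro exI[of _ "\<lambda>n. \<xi> n + \<xi>' n"]) blast
  qed
  have Gscale: "G (c *\<^sub>C x) (c *\<^sub>C l)" if GG: "G x l" for c x l
  proof -
    obtain \<xi> where "(\<lambda>n::nat. h (\<xi> n)) \<longlonglongrightarrow> x" "(\<lambda>n. y (\<xi> n)) \<longlonglongrightarrow> l"
      using GG unfolding G_def by blast
    then have "(\<lambda>n. h (c *\<^sub>C \<xi> n)) \<longlonglongrightarrow> c *\<^sub>C x" "(\<lambda>n. y (c *\<^sub>C \<xi> n)) \<longlonglongrightarrow> c *\<^sub>C l"
      unfolding bounded_ops_scaleC[OF hb] bounded_ops_scaleC[OF yb] by (auto intro: scaleC_tendsto)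
    then show ?thesis unfolding G_def by (intro exI[of _ "\<lambda>n. c *\<^sub>C \<xi> n"]) blast
  qed
  have Gnorm: "norm l = norm x" if g: "G x l" for x l
  proof -
    obtain \<xi> where "(\<lambda>n::nat. h (\<xi> n)) \<longlonglongrightarrow> x" "(\<lambda>n. y (\<xi> n)) \<longlonglongrightarrow> l"
      using g unfolding G_def by blast
    then have "(\<lambda>n. norm (h (\<xi> n))) \<longlonglongrightarrow> norm x" "(\<lambda>n. norm (y (\<xi> n))) \<longlonglongrightarrow> norm l"
      by (auto intro: tendsto_norm)
    then show ?thesis unfolding hy using LIMSEQ_unique by blast
  qed
  have Gunique: "l = l'" if "G x l" "G x l'" for x l l'
    using Gnorm[OF Gadd[OF that(1) Gscale[OF that(2), of "-1"]]] by (simp add: scaleC_minus_one)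
  have Gex: "\<exists>l. G x l" if "x \<in> K" for x
  proof -
    obtain \<xi> where \<xi>: "(\<lambda>n::nat. h (\<xi> n)) \<longlonglongrightarrow> x" using \<open>x \<in> K\<close> unfolding K_def by blast
    then have "Cauchy (\<lambda>n. h (\<xi> n))" by (rule LIMSEQ_imp_Cauchy)
    moreover have "dist (y (\<xi> m)) (y (\<xi> n)) = dist (h (\<xi> m)) (h (\<xi> n))" for m n
      using hy[of "\<xi> m - \<xi> n"] by (simp add: dist_norm bounded_ops_diff[OF hb] bounded_ops_diff[OF yb])
    ultimately have "Cauchy (\<lambda>n. y (\<xi> n))" unfolding Cauchy_def by simp
    then obtain l where "(\<lambda>n. y (\<xi> n)) \<longlonglongrightarrow> l" using Cauchy_convergent convergent_def by blast
    then show ?thesis using \<xi> unfolding G_def by blast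
  qed
  have Ghy: "G (h x) (y x)" for x unfolding G_def by (rule exI[of _ "\<lambda>n. x"]) simp
  have K: "closed_csubspace K"
    unfolding closed_csubspace_def
  proof (intro conjI ballI allI)
    show "closed K" unfolding Krange by simp
    show "0 \<in> K" unfolding K_def by (rule CollectI, rule exI[of _ "\<lambda>n. 0"]) (simp add: bounded_ops_zero[OF hb])
    show "x + z \<in> K" if "x \<in> K" "z \<in> K" for x z
      using Gex[OF that(1)] Gex[OF that(2)] Gadd unfolding K_def G_def by blast
    show "c *\<^sub>C x \<in> K" if "x \<in> K" for c x
      using Gex[OF that] Gscale unfolding K_def G_def by blast
  qed
  define P where "P = proj_on K"
  have Pp: "is_projection P" unfolding P_def by (rule is_projection_proj_on[OF K])
  have Pb: "P \<in> bounded_ops" by (rule projection_bounded[OF Pp])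
  have PK: "P x \<in> K" for x unfolding P_def by (rule proj_on(1)[OF K])
  have hK: "h x \<in> K" for x unfolding Krange by (rule subsetD[OF closure_subset]) simp
  have Ph: "P (h x) = h x" for x unfolding P_def proj_on_fixed_iff[OF K] by (rule hK)
  have hP: "h (P x) = h x" for x
    by (rule cinner_ext_left) (simp add: hs Ph projection_sym[OF Pp])
  have P0: "P x = 0" if "h x = 0" for x
  proof -
    obtain \<xi> where \<xi>: "(\<lambda>n::nat. h (\<xi> n)) \<longlonglongrightarrow> P x" using PK[of x] unfolding K_def by blast
    have "(\<lambda>n. cinner x (h (\<xi> n))) \<longlonglongrightarrow> cinner x (P x)" by (rule tendsto_cinner(2)[OF \<xi>])
    moreover have "cinner x (h (\<xi> n)) = 0" for n using hs[of x "\<xi> n"] that by simp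
    ultimately have "cinner x (P x) = 0" by (simp add: LIMSEQ_const_iff)
    then show ?thesis using projection_cinner_self[OF Pp, of x] projection_sym[OF Pp, of x x] by simp
  qed
  \<comment> \<open>The kernel of h is the complement of \<open>K\<close>, so a bounded operator is
    determined by its values on the range and on the kernel of h. Membership of u in
    \<open>M\<close> and the bounds by \<open>q\<close> and \<open>s\<close> are tested this
    way.\<close>
  have zero_if: "w x = 0" if w: "w \<in> bounded_ops" "\<And>x. w (h x) = 0" "\<And>x. h x = 0 \<Longrightarrow> w x = 0" for w x
  proof -
    obtain \<xi> where \<xi>: "(\<lambda>n::nat. h (\<xi> n)) \<longlonglongrightarrow> P x" using PK[of x] unfolding K_def by blast
    have "(\<lambda>n. w (h (\<xi> n))) \<longlonglongrightarrow> w (P x)"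
      by (rule bounded_linear.tendsto[OF bounded_ops_bounded_linear[OF w(1)] \<xi>])
    then have "w (P x) = 0" by (simp add: w(2) LIMSEQ_const_iff)
    moreover have "w (x - P x) = 0" by (rule w(3)) (simp add: bounded_ops_diff[OF hb] hP)
    ultimately show ?thesis by (simp add: bounded_ops_diff[OF w(1)])
  qed
  define u where "u x = (SOME l. G (P x) l)" for x
  have Gu: "G (P x) (u x)" for x unfolding u_def using Gex[OF PK] by (rule someI_ex)
  have nu: "norm (u x) = norm (P x)" for x by (rule Gnorm[OF Gu])
  have ub: "u \<in> bounded_ops"
  proof (rule bounded_opsI[where B=1])
    show "u (x + z) = u x + u z" for x z
      using Gunique[OF Gu[of "x + z"]] Gadd[OF Gu[of x] Gu[of z]] by (simp add: bounded_ops_add[OF Pb])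
    show "u (c *\<^sub>C x) = c *\<^sub>C u x" for c x
      using Gunique[OF Gu[of "c *\<^sub>C x"]] Gscale[OF Gu[of x], of c] by (simp add: bounded_ops_scaleC[OF Pb])
    show "norm (u x) \<le> 1 * norm x" for x using nu projection_norm_le[OF Pp] by simp
  qed
  have uh: "u (h x) = y x" for x using Gunique[OF Gu[of "h x"]] Ghy[of x] by (simp add: Ph)
  have u0: "u x = 0" if "h x = 0" for x using nu[of x] P0[OF that] by simp
  have uM: "u \<in> M"
  proof (rule MI[OF ub])
    fix b x assume b: "b \<in> commutant M"
    then have bb: "b \<in> bounded_ops" by (rule commutant_bounded)
    have hb': "h (b x) = b (h x)" for x by (rule M_commute[OF hM b])
    have "(u \<circ> b) x - (b \<circ> u) x = 0"
    proof (rule zero_if[where w="\<lambda>x. (u \<circ> b) x - (b \<circ> u) x"])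
      show "(\<lambda>x. (u \<circ> b) x - (b \<circ> u) x) \<in> bounded_ops"
        by (intro bounded_ops_minus bounded_ops_comp ub bb)
      show "(u \<circ> b) (h x) - (b \<circ> u) (h x) = 0" for x
        using M_commute[OF y b, of x] by (simp add: uh flip: hb')
      show "(u \<circ> b) x - (b \<circ> u) x = 0" if "h x = 0" for x
        using that by (simp add: u0 hb' bounded_ops_zero[OF bb])
    qed
    then show "u (b x) = b (u x)" by simp
  qed
  have usb: "star u \<in> bounded_ops" by (rule star_bounded[OF ub])
  \<comment> \<open>Only |u x| = |P x| is known, an equality of quadratic forms; polarization makes
    it an operator identity.\<close>
  have uu: "star u (u x) = P x" for x
  proof -
    have "(star u \<circ> u) x - P x = 0"
    proof (rule quadratic_form_zero[where T="\<lambda>x. (star u \<circ> u) x - P x"])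
      show "(\<lambda>x. (star u \<circ> u) x - P x) \<in> bounded_ops"
        by (intro bounded_ops_minus bounded_ops_comp ub usb Pb)
      show "cinner ((star u \<circ> u) x - P x) x = 0" for x
        by (simp add: cinner_diff_left star_cinner_left[OF ub] projection_cinner_self[OF Pp] cinner_self nu)
    qed
    then show ?thesis by simp
  qed
  have uP: "u (P x) = u x" for x
    using Gunique[OF Gu[of "P x"]] Gu[of x] by (simp add: projection_idem[OF Pp])
  define Q where "Q = u \<circ> star u"
  have PM: "P \<in> projections M"
  proof -
    have "P = star u \<circ> u" using uu by auto
    then show ?thesis using Pp M_comp[OF M_star[OF uM] uM] by (simp add: projections_iff)
  qed
  have QM: "Q \<in> projections M"
    unfolding projections_iff is_projection_iff
  proof (intro conjI allI)
    show "Q \<in> M" unfolding Q_def by (rule M_comp[OF uM M_star[OF uM]])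
    then show "Q \<in> bounded_ops" by (rule M_bounded)
    show "Q (Q x) = Q x" for x by (simp add: Q_def uu uP)
    show "cinner (Q x) z = cinner x (Q z)" for x z
      by (simp add: Q_def star_cinner[OF ub] star_cinner_left[OF ub])
  qed
  have qu: "q (u x) = u x" for x
  proof -
    have "(q \<circ> u) x - u x = 0"
    proof (rule zero_if[where w="\<lambda>x. (q \<circ> u) x - u x"])
      show "(\<lambda>x. (q \<circ> u) x - u x) \<in> bounded_ops" by (intro bounded_ops_minus bounded_ops_comp ub qb)
    qed (simp_all add: uh qy u0 bounded_ops_zero[OF qb])
    then show ?thesis by simp
  qed
  have hsx: "h (s x) = h x" for x
  proof -
    have "norm (h (x - s x)) = 0" by (simp add: hy bounded_ops_diff[OF yb] ys)
    then show ?thesis by (simp add: bounded_ops_diff[OF hb])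
  qed
  have sh: "s (h x) = h x" for x
    by (rule cinner_ext_left) (simp add: hs hsx projection_sym[OF sp])
  have sP: "s (P x) = P x" for x
  proof -
    have "(s \<circ> P) x - P x = 0"
    proof (rule zero_if[where w="\<lambda>x. (s \<circ> P) x - P x"])
      show "(\<lambda>x. (s \<circ> P) x - P x) \<in> bounded_ops" by (intro bounded_ops_minus bounded_ops_comp Pb sb)
    qed (simp_all add: Ph sh P0 bounded_ops_zero[OF sb])
    then show ?thesis by simp
  qed
  have "mvn_equiv M P Q"
    unfolding mvn_equiv_def using uM uu by (intro bexI[of _ u]) (auto simp: Q_def)
  moreover have "P \<noteq> zero_op"
  proof
    assume "P = zero_op"
    then have "h x = 0" for x using Ph[of x] by simp
    then have "y x = 0" for x using hy[of x] by simp
    then show False using y0 by auto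
  qed
  moreover have "proj_le P s" "proj_le Q q" by (simp_all add: proj_le_iff sP Q_def qu)
  ultimately show ?thesis using PM QM by blast
qed

text \<open>For self-adjoint c in \<open>M\<close> these are the projections of the von Neumann
  algebra generated by c, a substitute for its spectral projections. Only symmetric d occur, because
  for these invariance of the range of e already gives commutation with e.\<close>

definition functional_projections :: "('h \<Rightarrow> 'h) \<Rightarrow> ('h \<Rightarrow> 'h) set"
  where "functional_projections c = {e \<in> projections M. \<forall>d\<in>bounded_ops.
    (\<forall>x z. cinner (d x) z = cinner x (d z)) \<longrightarrow> (\<forall>x. d (c x) = c (d x)) \<longrightarrow> (\<forall>x. d (e x) = e (d x))}"

text \<open>The kernel of |c - l| - (c - l) is the spectral subspace of c for the values at least l.
  There c - l = |c - l| is positive, and on its orthogonal complement c - l = -|c - l|.\<close>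

lemma spectral_split:
  assumes c: "c \<in> M" and cs: "\<And>x z. cinner (c x) z = cinner x (c z)"
  shows "\<exists>e\<in>functional_projections c.
    (\<forall>x. e x = x \<longrightarrow> l * (norm x)\<^sup>2 \<le> Re (cinner (c x) x)) \<and>
    (\<forall>x. e x = 0 \<longrightarrow> Re (cinner (c x) x) \<le> l * (norm x)\<^sup>2)"
proof -
  define c' where "c' = (\<lambda>x. c x - complex_of_real l *\<^sub>C x)"
  have c'M: "c' \<in> M" unfolding c'_def using M_diff[OF c M_scale[OF id_in_M, of "complex_of_real l"]] by simp
  have c'b: "c' \<in> bounded_ops" by (rule M_bounded[OF c'M])
  have c'x: "c' x = c x - l *\<^sub>R x" for x by (simp only: c'_def scaleC_of_real)
  have c's: "cinner (c' x) z = cinner x (c' z)" for x z by (simp add: c'x cinner_simps cs)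
  have sc: "star c' = c'" by (rule star_unique[OF c'b c's])
  obtain h where hM: "h \<in> M" and hs: "\<And>x z. cinner (h x) z = cinner x (h z)"
    and hpos: "\<And>x. 0 \<le> Re (cinner (h x) x)" and hh: "\<And>x. h (h x) = c' (c' x)"
    and hc: "\<And>d x. d \<in> bounded_ops \<Longrightarrow> (\<And>x. d (c' (c' x)) = c' (c' (d x))) \<Longrightarrow> d (h x) = h (d x)"
    using absolute_value[OF c'M, unfolded sc] by blast
  have hb: "h \<in> bounded_ops" by (rule M_bounded[OF hM])
  define d where "d = (\<lambda>x. h x - c' x)"
  have dM: "d \<in> M" unfolding d_def by (rule M_diff[OF hM c'M])
  define N where "N = {x. d x = 0}"
  have N: "closed_csubspace N"
    using closed_csubspace_Inter_kernels[of "{d}"] M_bounded[OF dM] by (simp add: N_def)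
  define e where "e = proj_on N"
  have eM: "e \<in> projections M"
    using proj_on_kernels_in_projections[of "{d}"] dM by (simp add: N_def e_def)
  then have ep: "is_projection e" by (simp add: projections_iff)
  have hc': "h (c' x) = c' (h x)" for x using hc[OF c'b, of x] by simp
  have comm: "\<delta> (e x) = e (\<delta> x)"
    if \<delta>: "\<delta> \<in> bounded_ops" "\<And>x z. cinner (\<delta> x) z = cinner x (\<delta> z)" "\<And>x. \<delta> (c x) = c (\<delta> x)"
    for \<delta> x
  proof -
    have \<delta>c: "\<delta> (c' x) = c' (\<delta> x)" for x
      by (simp add: c'x bounded_ops_diff[OF \<delta>(1)] bounded_ops_scaleR[OF \<delta>(1)] \<delta>(3))
    have "\<delta> (h x) = h (\<delta> x)" for x by (rule hc[OF \<delta>(1)]) (simp add: \<delta>c)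
    then have "\<delta> (d x) = d (\<delta> x)" for x by (simp add: d_def bounded_ops_diff[OF \<delta>(1)] \<delta>c)
    then have "\<delta> x \<in> N" if "x \<in> N" for x
      using that by (simp add: N_def flip: \<open>\<And>x. \<delta> (d x) = d (\<delta> x)\<close>) (simp add: bounded_ops_zero[OF \<delta>(1)])
    then have "e (\<delta> (e x)) = \<delta> (e x)" for x
      unfolding e_def proj_on_fixed_iff[OF N] by (simp add: proj_on(1)[OF N])
    then show "\<delta> (e x) = e (\<delta> x)" by (rule symmetric_commutes_projection[OF ep \<delta>(2)])
  qed
  show ?thesis
  proof (intro bexI[of _ e] conjI allI impI)
    show "e \<in> functional_projections c" using eM comm by (simp add: functional_projections_def)
  next
    fix x assume "e x = x"
    then have "d x = 0" unfolding e_def proj_on_fixed_iff[OF N] by (simp add: N_def)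
    then have "c' x = h x" by (simp add: d_def)
    then show "l * (norm x)\<^sup>2 \<le> Re (cinner (c x) x)" using hpos[of x] by (simp add: c'x cinner_simps flip: \<open>c' x = h x\<close>)
  next
    fix x assume ex: "e x = 0"
    \<comment> \<open>(h - c')(h + c') = h^2 - c'^2 = 0, since h commutes with c'. So h + c' maps
      into the range of e, and being symmetric it vanishes on the kernel of e.\<close>
    have sN: "h v + c' v \<in> N" for v
      by (simp add: N_def d_def bounded_ops_add[OF hb] bounded_ops_add[OF c'b] hh hc')
    define v where "v = h x + c' x"
    have "cinner v v = cinner x (h v + c' v)"
      by (subst v_def) (simp only: cinner_add_left cinner_add_right hs c's)
    also have "h v + c' v = e (h v + c' v)"
      using sN[of v] proj_on_fixed_iff[OF N, of "h v + c' v"] by (simp add: e_def)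
    also have "cinner x (e (h v + c' v)) = 0"
      by (simp add: ex flip: projection_sym[OF ep])
    finally have "h x = - c' x" by (simp add: v_def eq_neg_iff_add_eq_0)
    then show "Re (cinner (c x) x) \<le> l * (norm x)\<^sup>2"
      using hpos[of x] by (simp add: c'x cinner_simps)
  qed
qed

text \<open>Bisecting the spectrum of \<open>c\<close> with \<open>functional_projections c\<close>: on a piece where \<open>c\<close> is
  within \<open>\<epsilon>\<close> of a scalar, the commutator with \<open>b\<close> has norm at most \<open>2 \<epsilon> B\<close>, and pieces are
  orthogonal and reduce both \<open>b\<close> and \<open>c\<close>.\<close>

lemma commute_if_commutes_functional_projections:
  assumes c: "c \<in> M" and cs: "\<And>x z. cinner (c x) z = cinner x (c z)" and b: "b \<in> bounded_ops"
    and H: "\<And>e x. e \<in> functional_projections c \<Longrightarrow> e (b x) = b (e x)"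
  shows "c (b x) = b (c x)"
proof -
  obtain B where B: "B > 0" "\<And>x. norm (b x) \<le> B * norm x" using bounded_ops_bound[OF b] by blast
  have cb: "c \<in> bounded_ops" by (rule M_bounded[OF c])
  obtain C where C: "C > 0" "\<And>x. norm (c x) \<le> C * norm x" using bounded_ops_bound[OF cb] by blast
  define k where "k x = c (b x) - b (c x)" for x
  have fp: "is_projection e" "e \<in> bounded_ops" "e \<in> projections M" "\<And>x. e (c x) = c (e x)"
    if "e \<in> functional_projections c" for e
  proof -
    show "e \<in> projections M" using that by (simp add: functional_projections_def)
    then show "is_projection e" by (simp add: projections_iff)
    then show "e \<in> bounded_ops" by (rule projection_bounded)
    show "e (c x) = c (e x)" for x using that cs cb by (auto simp: functional_projections_def)
  qed
  have fcomm: "d (e x) = e (d x)" if "e \<in> functional_projections c" "d \<in> functional_projections c" for d e x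
    using that fp[OF that(2)] projection_sym[OF fp(1)[OF that(2)]] by (auto simp: functional_projections_def)
  have main: "\<forall>e\<in>functional_projections c. \<forall>l m. l < m \<longrightarrow>
    (\<forall>x. e x = x \<longrightarrow> l * (norm x)\<^sup>2 \<le> Re (cinner (c x) x) \<and> Re (cinner (c x) x) \<le> m * (norm x)\<^sup>2) \<longrightarrow>
    (\<forall>x. e x = x \<longrightarrow> norm (k x) \<le> 2 * (m - l) * B / 2 ^ n * norm x)" for n
  proof (induction n)
    case 0
    show ?case
    proof (intro ballI allI impI)
      fix e l m x
      assume e: "e \<in> functional_projections c" and lm: "l < m"
        and bd: "\<forall>x. e x = x \<longrightarrow> l * (norm x)\<^sup>2 \<le> Re (cinner (c x) x) \<and> Re (cinner (c x) x) \<le> m * (norm x)\<^sup>2"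
        and ex: "e x = (x::'h)"
      define T where "T x = c x - l *\<^sub>R x" for x
      have Ts: "cinner (T x) z = cinner x (T z)" for x z by (simp add: T_def cinner_simps cs)
      have Tadd: "T (x + z) = T x + T z" and Tdiff: "T (x - z) = T x - T z" for x z
        by (simp_all add: T_def bounded_ops_simps[OF cb] algebra_simps)
      have Te: "e (T x) = T x" if "e x = x" for x
        using that fp(4)[OF e, of x] by (simp add: T_def bounded_ops_diff[OF fp(2)[OF e]] bounded_ops_scaleR[OF fp(2)[OF e]])
      have T0: "0 \<le> Re (cinner (T x) x)" "Re (cinner (T x) x) \<le> (m - l) * (norm x)\<^sup>2" if "e x = x" for x
        using bd that by (simp_all add: T_def cinner_simps left_diff_distrib)
      \<comment> \<open>On the range of e the form of T lies between 0 and m - l times the squared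
        norm, and such a symmetric operator has norm at most m - l: polarize the form at x and a
        multiple z of T x.\<close>
      have Tn: "norm (T x) \<le> (m - l) * norm x" if ex: "e x = x" for x
      proof -
        define z where "z = (1 / (m - l)) *\<^sub>R T x"
        have ez: "e z = z" using Te[OF ex] by (simp add: z_def bounded_ops_scaleR[OF fp(2)[OF e]])
        have exz: "e (x + z) = x + z" "e (x - z) = x - z"
          using ex ez by (simp_all add: bounded_ops_simps[OF fp(2)[OF e]])
        have "Re (cinner (T z) x) = Re (cinner (T x) z)"
          using Ts Re_cinner_commute by metis
        then have "4 * Re (cinner (T x) z) = Re (cinner (T (x + z)) (x + z)) - Re (cinner (T (x - z)) (x - z))"
          by (simp add: Tadd Tdiff cinner_simps)
        also have "\<dots> \<le> (m - l) * (norm (x + z))\<^sup>2" using T0[OF exz(1)] T0[OF exz(2)] by linarith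
        finally have 1: "4 * Re (cinner (T x) z) \<le> (m - l) * (norm (x + z))\<^sup>2" .
        have "T x = (m - l) *\<^sub>R z" using lm by (simp add: z_def)
        then have 2: "Re (cinner (T x) z) = (m - l) * (norm z)\<^sup>2" by (simp add: cinner_simps)
        have "(m - l) * (4 * (norm z)\<^sup>2) \<le> (m - l) * (norm (x + z))\<^sup>2" using 1 2 by simp
        then have "(2 * norm z)\<^sup>2 \<le> (norm (x + z))\<^sup>2" using lm by (simp add: power_mult_distrib)
        then have "2 * norm z \<le> norm (x + z)" by (rule power2_le_imp_le) simp
        then have "norm z \<le> norm x" using norm_triangle_ineq[of x z] by linarith
        moreover have "norm (T x) = (m - l) * norm z" using lm by (simp add: z_def)
        ultimately show ?thesis using lm by simp
      qed
      have eb: "e (b x) = b x" using H[OF e, of x] ex by simp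
      have "k x = T (b x) - b (T x)"
        by (simp add: k_def T_def bounded_ops_simps[OF b])
      then have "norm (k x) \<le> norm (T (b x)) + norm (b (T x))" by (simp add: norm_triangle_ineq4)
      also have "\<dots> \<le> (m - l) * (B * norm x) + B * ((m - l) * norm x)"
      proof (rule add_mono)
        have "norm (T (b x)) \<le> (m - l) * norm (b x)" by (rule Tn[OF eb])
        also have "\<dots> \<le> (m - l) * (B * norm x)" using lm B(2)[of x] by simp
        finally show "norm (T (b x)) \<le> (m - l) * (B * norm x)" .
        have "norm (b (T x)) \<le> B * norm (T x)" by (rule B(2))
        also have "\<dots> \<le> B * ((m - l) * norm x)" using Tn[OF ex] B(1) by simp
        finally show "norm (b (T x)) \<le> B * ((m - l) * norm x)" .
      qed
      finally show "norm (k x) \<le> 2 * (m - l) * B / 2 ^ 0 * norm x" by (simp add: algebra_simps)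
    qed
  next
    case (Suc n)
    show ?case
    proof (intro ballI allI impI)
      fix e l m x
      assume e: "e \<in> functional_projections c" and lm: "l < m"
        and bd: "\<forall>x. e x = x \<longrightarrow> l * (norm x)\<^sup>2 \<le> Re (cinner (c x) x) \<and> Re (cinner (c x) x) \<le> m * (norm x)\<^sup>2"
        and ex: "e x = (x::'h)"
      define t where "t = (l + m) / 2"
      obtain f where fF: "f \<in> functional_projections c"
        and f2: "\<And>x. f x = x \<Longrightarrow> t * (norm x)\<^sup>2 \<le> Re (cinner (c x) x)"
        and f3: "\<And>x. f x = 0 \<Longrightarrow> Re (cinner (c x) x) \<le> t * (norm x)\<^sup>2"
        using spectral_split[OF c cs, of t] by blast
      have fe: "f (e x) = e (f x)" for x by (rule fcomm[OF e fF])
      have eb: "e \<in> bounded_ops" and fb: "f \<in> bounded_ops" and f_p: "is_projection f" and e_p: "is_projection e"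
        using fp e fF by blast+
      define e1 where "e1 = e \<circ> f"
      define e2 where "e2 = (\<lambda>x. e x - e (f x))"
      have e1p: "e1 \<in> projections M"
        unfolding e1_def projections_iff using is_projection_comp[OF e_p f_p] fe
        by (simp add: M_comp fp(3)[OF fF, unfolded projections_iff] fp(3)[OF e, unfolded projections_iff])
      have "proj_le e1 e" by (simp add: proj_le_iff e1_def projection_idem[OF e_p])
      from projections_diff[OF e1p fp(3)[OF e] this] have e2p: "e2 \<in> projections M"
        by (simp add: e1_def e2_def)
      have e1F: "e1 \<in> functional_projections c" and e2F: "e2 \<in> functional_projections c"
        using e1p e2p e fF by (auto simp: functional_projections_def e1_def e2_def bounded_ops_diff)
      define K where "K = 2 * (t - l) * B / 2 ^ n"
      have "t - l = m - t" by (simp add: t_def field_simps)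
      then have K1: "K = 2 * (m - t) * B / 2 ^ n" by (simp only: K_def)
      have K0: "K \<ge> 0" using lm B(1) by (simp add: K_def t_def)
      let ?x1 = "f x" and ?x2 = "x - f x"
      have x1: "e1 ?x1 = ?x1" "f ?x1 = ?x1" and x2: "e2 ?x2 = ?x2" "f ?x2 = 0"
        by (simp_all add: e1_def e2_def projection_idem[OF f_p] bounded_ops_diff[OF eb] bounded_ops_diff[OF fb] ex flip: fe)
      have in1: "e x = x \<and> f x = x" if "e1 x = x" for x
        using that fe projection_idem[OF e_p] projection_idem[OF f_p] unfolding e1_def by (metis comp_apply)
      have in2: "e x = x \<and> f x = 0" if "e2 x = x" for x
      proof -
        have "f x = f (e2 x)" using that by simp
        also have "\<dots> = 0" by (simp add: e2_def bounded_ops_diff[OF fb] fe projection_idem[OF f_p] flip: fe)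
        finally have "f x = 0" .
        then show ?thesis using that by (simp add: e2_def bounded_ops_zero[OF eb])
      qed
      have k1: "norm (k ?x1) \<le> K * norm ?x1"
      proof -
        have "l < t" using lm by (simp add: t_def)
        moreover have "\<forall>x. e1 x = x \<longrightarrow> t * (norm x)\<^sup>2 \<le> Re (cinner (c x) x) \<and> Re (cinner (c x) x) \<le> m * (norm x)\<^sup>2"
          using in1 f2 bd by blast
        ultimately show ?thesis using Suc[rule_format, OF e1F, of t m ?x1] x1 lm unfolding K1 by (simp add: t_def)
      qed
      have k2: "norm (k ?x2) \<le> K * norm ?x2"
      proof -
        have "l < t" using lm by (simp add: t_def)
        moreover have "\<forall>x. e2 x = x \<longrightarrow> l * (norm x)\<^sup>2 \<le> Re (cinner (c x) x) \<and> Re (cinner (c x) x) \<le> t * (norm x)\<^sup>2"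
          using in2 f3 bd by blast
        ultimately show ?thesis using Suc[rule_format, OF e2F, of l t ?x2] x2 unfolding K_def by simp
      qed
      \<comment> \<open>k commutes with f, so the estimates on the two pieces combine by Pythagoras
        and the constant does not double.\<close>
      have fk: "f (k x) = k (f x)" for x
        by (simp add: k_def bounded_ops_diff[OF fb] fp(4)[OF fF] H[OF fF])
      have "(norm (k x))\<^sup>2 = (norm (k ?x1))\<^sup>2 + (norm (k ?x2))\<^sup>2"
        using projection_pythagoras[OF f_p, of "k x"]
        by (simp add: fk) (simp add: k_def bounded_ops_diff[OF b] bounded_ops_diff[OF cb] algebra_simps)
      also have "\<dots> \<le> (K * norm ?x1)\<^sup>2 + (K * norm ?x2)\<^sup>2"
        by (intro add_mono power_mono k1 k2) simp_all
      also have "\<dots> = (K * norm x)\<^sup>2"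
        using projection_pythagoras[OF f_p, of x] by (simp add: power_mult_distrib flip: distrib_left)
      finally have "norm (k x) \<le> K * norm x" by (rule power2_le_imp_le) (simp add: K0)
      then show "norm (k x) \<le> 2 * (m - l) * B / 2 ^ Suc n * norm x" by (simp add: K_def t_def field_simps)
    qed
  qed
  have idF: "id \<in> functional_projections c" by (simp add: functional_projections_def id_projection)
  have bd: "- C * (norm x)\<^sup>2 \<le> Re (cinner (c x) x) \<and> Re (cinner (c x) x) \<le> C * (norm x)\<^sup>2" for x
  proof -
    have "\<bar>Re (cinner (c x) x)\<bar> \<le> cmod (cinner (c x) x)" by (rule abs_Re_le_cmod)
    also have "\<dots> \<le> norm (c x) * norm x" by (rule cinner_Cauchy_Schwarz)
    also have "\<dots> \<le> C * norm x * norm x" by (intro mult_right_mono C(2)) simp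
    finally show ?thesis by (simp add: power2_eq_square abs_le_iff)
  qed
  have "norm (k x) \<le> 2 * (C - - C) * B / 2 ^ n * norm x" for n
    by (rule main[THEN bspec, THEN spec, THEN spec, THEN mp, THEN mp, THEN spec, THEN mp])
      (rule idF, use C(1) bd in auto)
  then have "norm (k x) \<le> 4 * C * B * norm x * (1/2) ^ n" for n
    by (simp add: power_one_over field_simps)
  moreover have "(\<lambda>n. 4 * C * B * norm x * (1/2) ^ n) \<longlonglongrightarrow> 4 * C * B * norm x * 0"
    by (intro tendsto_mult tendsto_const LIMSEQ_power_zero) simp
  ultimately have "norm (k x) \<le> 4 * C * B * norm x * 0" by (intro LIMSEQ_le_const[of _ _ "norm (k x)"]) auto
  then show ?thesis by (simp add: k_def)
qed

text \<open>Some projection e, a function of the real or imaginary part of an element of the corner,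
  fails to commute with an operator b of the corner. Then b has a nonzero off-diagonal block between
  er and r - er, whose polar decomposition gives equivalent projections below two orthogonal
  ones.\<close>

lemma nonabelian_equivalent_pair:
  assumes r: "r \<in> projections M" and nab: "\<not> abelian_proj M r"
  shows "\<exists>P\<in>projections M. \<exists>Q\<in>projections M. P \<noteq> zero_op \<and> mvn_equiv M P Q \<and> proj_le P r \<and> proj_le Q r \<and>
    (\<forall>x. P (Q x) = 0)"
proof -
  have rp: "is_projection r" and rM: "r \<in> M" using r by (simp_all add: projections_iff)
  have rb: "r \<in> bounded_ops" by (rule projection_bounded[OF rp])
  note rr = projection_idem[OF rp]
  obtain a0 b0 where ab0: "a0 \<in> M" "b0 \<in> M"
    "(r \<circ> a0 \<circ> r) \<circ> (r \<circ> b0 \<circ> r) \<noteq> (r \<circ> b0 \<circ> r) \<circ> (r \<circ> a0 \<circ> r)"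
    using nab r unfolding abelian_proj_def by blast
  define a where "a = r \<circ> a0 \<circ> r"
  define b where "b = r \<circ> b0 \<circ> r"
  have aM: "a \<in> M" and bM: "b \<in> M" using ab0 rM by (simp_all add: a_def b_def M_comp)
  have ab: "a \<in> bounded_ops" and bb: "b \<in> bounded_ops" using aM bM by (simp_all add: M_bounded)
  have asM: "star a \<in> M" by (rule M_star[OF aM])
  have ra: "r (a x) = a x" "a (r x) = a x" and rb': "r (b x) = b x" "b (r x) = b x" for x
    by (simp_all add: a_def b_def rr)
  have ras: "r (star a x) = star a x" "star a (r x) = star a x" for x
    by (rule cinner_ext_left, simp add: projection_sym[OF rp] star_cinner_left[OF ab] ra)+
  obtain x0 where x0: "a (b x0) \<noteq> b (a x0)" using ab0(3) unfolding a_def b_def by (auto simp: fun_eq_iff)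
  \<comment> \<open>Up to sign, twice the real and twice the imaginary part: 2a = c1 - i c2, so b
    cannot commute with both.\<close>
  define c1 where "c1 = (\<lambda>x. a x + star a x)"
  define c2 where "c2 = (\<lambda>x. \<i> *\<^sub>C (a x - star a x))"
  have c1: "c1 \<in> M" "\<And>x z. cinner (c1 x) z = cinner x (c1 z)" "\<And>x. r (c1 x) = c1 x" "\<And>x. c1 (r x) = c1 x"
    using M_add[OF aM asM]
    by (simp_all add: c1_def cinner_simps star_cinner_left[OF ab] star_cinner[OF ab] bounded_ops_simps[OF rb] ra ras)
  have c2: "c2 \<in> M" "\<And>x z. cinner (c2 x) z = cinner x (c2 z)" "\<And>x. r (c2 x) = c2 x" "\<And>x. c2 (r x) = c2 x"
    using M_scale[OF M_diff[OF aM asM]]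
    by (simp_all add: c2_def cinner_simps star_cinner_left[OF ab] star_cinner[OF ab] bounded_ops_simps[OF rb] ra ras algebra_simps)
  have "c1 (b x0) \<noteq> b (c1 x0) \<or> c2 (b x0) \<noteq> b (c2 x0)"
  proof (rule ccontr)
    assume "\<not> ?thesis"
    then have 1: "a (b x0) + star a (b x0) = b (a x0) + b (star a x0)"
      and "\<i> *\<^sub>C (a (b x0) - star a (b x0)) = \<i> *\<^sub>C (b (a x0) - b (star a x0))"
      by (simp_all add: c1_def c2_def bounded_ops_simps[OF bb])
    then have "\<i> *\<^sub>C (a (b x0) - star a (b x0) - (b (a x0) - b (star a x0))) = 0"
      by (simp add: scaleC_diff_right)
    then have "norm (a (b x0) - star a (b x0) - (b (a x0) - b (star a x0))) = 0"
      by (metis norm_scaleC norm_ii mult_1 norm_zero)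
    then have 2: "a (b x0) - star a (b x0) = b (a x0) - b (star a x0)" by simp
    have "2 *\<^sub>R a (b x0) = (a (b x0) + star a (b x0)) + (a (b x0) - star a (b x0))" by (simp add: scaleR_2)
    also have "\<dots> = 2 *\<^sub>R b (a x0)" unfolding 1 2 by (simp add: scaleR_2)
    finally show False using x0 by simp
  qed
  then obtain c where cM: "c \<in> M" and cs: "\<And>x z. cinner (c x) z = cinner x (c z)"
    and rc: "\<And>x. r (c x) = c x" "\<And>x. c (r x) = c x" and cb: "c (b x0) \<noteq> b (c x0)"
    using c1 c2 by metis
  obtain e x1 where eF: "e \<in> functional_projections c" and ebx: "e (b x1) \<noteq> b (e x1)"
    using commute_if_commutes_functional_projections[OF cM cs bb, of x0] cb by blast
  have eM: "e \<in> projections M" using eF by (simp add: functional_projections_def)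
  then have ep: "is_projection e" and eM': "e \<in> M" by (simp_all add: projections_iff)
  have re: "r (e x) = e (r x)" for x
    using eF rb projection_sym[OF rp] rc by (auto simp: functional_projections_def)
  define q where "q = e \<circ> r"
  define q' where "q' = (\<lambda>x. r x - q x)"
  have qM: "q \<in> projections M"
    unfolding q_def projections_iff using is_projection_comp[OF ep rp] re by (simp add: M_comp eM' rM)
  then have qp: "is_projection q" by (simp add: projections_iff)
  note qq = projection_idem[OF qp]
  have qr: "proj_le q r" by (simp add: proj_le_iff q_def re rr)
  have q'M: "q' \<in> projections M" unfolding q'_def by (rule projections_diff[OF qM r qr])
  then have q'p: "is_projection q'" by (simp add: projections_iff)
  have q'r: "proj_le q' r" using proj_leD[OF qr] by (simp add: proj_le_iff q'_def bounded_ops_diff[OF rb] rr)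
  have o: "q (q' x) = 0" for x
    using proj_leD'[OF qp rp qr] by (simp add: q'_def bounded_ops_diff[OF projection_bounded[OF qp]] qq)
  have o': "q' (q x) = 0" for x by (rule orthogonal_projections_sym[OF qp q'p o])
  have pair: ?thesis if s: "s \<in> projections M" "t \<in> projections M" "proj_le s r" "proj_le t r" "\<And>x. s (t x) = 0"
    and y0: "t \<circ> b \<circ> s \<noteq> zero_op" for s t
  proof -
    have sp: "is_projection s" and tp: "is_projection t" and stM: "s \<in> M" "t \<in> M"
      using s by (simp_all add: projections_iff)
    have "t \<circ> b \<circ> s \<in> M" using stM bM by (intro M_comp)
    from polar_decomposition[OF this y0 s(2,1)] obtain P Q
      where PQ: "P \<in> projections M" "Q \<in> projections M" "mvn_equiv M P Q" "P \<noteq> zero_op" "proj_le P s" "proj_le Q t"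
      by (auto simp: projection_idem[OF sp] projection_idem[OF tp])
    have Pp: "is_projection P" using PQ(1) by (simp add: projections_iff)
    have "P (Q x) = 0" for x
    proof -
      have "P (Q x) = P (s (t (Q x)))" using proj_leD'[OF Pp sp PQ(5)] proj_leD[OF PQ(6)] by simp
      then show ?thesis by (simp add: s(5) bounded_ops_zero[OF projection_bounded[OF Pp]])
    qed
    then show ?thesis using PQ proj_le_trans[OF PQ(5) s(3)] proj_le_trans[OF PQ(6) s(4)] by blast
  qed
  \<comment> \<open>If both off-diagonal blocks vanish, b commutes with q, against the choice of
    e.\<close>
  have "q \<circ> b \<circ> q' \<noteq> zero_op \<or> q' \<circ> b \<circ> q \<noteq> zero_op"
  proof (rule ccontr)
    assume "\<not> ?thesis"
    then have z: "q (b (q' x)) = 0" "q' (b (q x)) = 0" for x by (metis comp_apply)+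
    have "q (b x1) = q (b (q x1))"
      using z(1)[of x1] by (simp add: q'_def bounded_ops_diff[OF bb] bounded_ops_diff[OF projection_bounded[OF qp]] rb')
    moreover have "b (q x1) = q (b (q x1))" using z(2)[of x1] by (simp add: q'_def rb')
    ultimately have "q (b x1) = b (q x1)" by simp
    then show False using ebx by (simp add: q_def rb' flip: re)
  qed
  then show ?thesis using pair[OF q'M qM q'r qr o'] pair[OF qM q'M qr q'r o] by blast
qed

end

section \<open>The spectral measure of a projection\<close>

lemma in_graph_of: "(x, y) \<in> graph_of a \<longleftrightarrow> y = a x"
  by (auto simp: graph_of_def)

lemma graph_of_O: "graph_of a O graph_of b = graph_of (b \<circ> a)"
  by (auto simp: graph_of_def)

lemma Domain_graph_of: "Domain (graph_of a) = UNIV"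
  by (auto simp: graph_of_def)

lemma is_operator_graph_of: "a \<in> bounded_ops \<Longrightarrow> is_operator (graph_of a)"
  by (auto simp: is_operator_def single_valued_def in_graph_of bounded_ops_simps)

lemma adj_graph_of_projection:
  assumes "is_projection p" shows "adj (graph_of p) = graph_of p"
proof -
  have "(\<forall>(\<xi>, \<xi>')\<in>graph_of p. cinner \<xi>' \<eta> = cinner \<xi> \<zeta>) \<longleftrightarrow> \<zeta> = p \<eta>" for \<eta> \<zeta>
    using projection_sym[OF assms] cinner_ext_right[of \<zeta> "p \<eta>"]
    by (auto simp: graph_of_def)
  then show ?thesis by (auto simp: adj_def in_graph_of)
qed

text \<open>\<open>abs_op\<close> is a definite description over unbounded operators, so p must be
  shown to be its own only positive self-adjoint root. A root A is everywhere defined because its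
  square is. It vanishes on the kernel of p since |A x|^2 = (x, p x), and it is the identity on the
  range by positivity.\<close>

lemma abs_op_projection:
  assumes p: "is_projection p" shows "abs_op (graph_of p) = graph_of p"
  unfolding abs_op_def
proof (rule the_equality)
  have pb: "p \<in> bounded_ops" by (rule projection_bounded[OF p])
  have pp: "p \<circ> p = p" using projection_idem[OF p] by auto
  have sq: "graph_of p O adj (graph_of p) = graph_of p"
    by (simp add: adj_graph_of_projection[OF p] graph_of_O pp)
  show "positive_selfadjoint (graph_of p) \<and> graph_of p O graph_of p = graph_of p O adj (graph_of p)"
    unfolding sq graph_of_O pp
    by (auto simp: positive_selfadjoint_def is_operator_graph_of[OF pb] densely_defined_def Domain_graph_of
        adj_graph_of_projection[OF p] in_graph_of projection_cinner_self[OF p])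
  fix a assume "positive_selfadjoint a \<and> a O a = graph_of p O adj (graph_of p)"
  then have a: "is_operator a" "adj a = a" "\<And>x y. (x, y) \<in> a \<Longrightarrow> 0 \<le> Re (cinner y x)"
    and aa: "a O a = graph_of p"
    by (auto simp: sq positive_selfadjoint_def)
  have "\<forall>x. \<exists>y. (x, y) \<in> a"
  proof
    fix x have "(x, p x) \<in> a O a" by (simp add: aa in_graph_of)
    then show "\<exists>y. (x, y) \<in> a" by blast
  qed
  from choice[OF this] obtain A where A: "\<And>x. (x, A x) \<in> a" by blast
  have sv: "y = A x" if "(x, y) \<in> a" for x y
    using a(1) A that by (auto simp: is_operator_def single_valued_def)
  have Aadd: "A (x + y) = A x + A y" for x y
  proof -
    have "\<forall>(\<xi>, \<xi>')\<in>a. \<forall>(\<eta>, \<eta>')\<in>a. (\<xi> + \<eta>, \<xi>' + \<eta>') \<in> a"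
      using a(1) by (simp add: is_operator_def)
    from bspec[OF this A[of x]] have "\<forall>(\<eta>, \<eta>')\<in>a. (x + \<eta>, A x + \<eta>') \<in> a" by simp
    from bspec[OF this A[of y]] have "(x + y, A x + A y) \<in> a" by simp
    from sv[OF this] show ?thesis by simp
  qed
  have As: "cinner (A x) y = cinner x (A y)" for x y
  proof -
    have "(y, A y) \<in> adj a" by (simp add: a(2) A)
    then have "\<forall>(\<xi>, \<xi>')\<in>a. cinner \<xi>' y = cinner \<xi> (A y)" by (simp add: adj_def)
    from bspec[OF this A[of x]] show ?thesis by simp
  qed
  have AA: "A (A x) = p x" for x
  proof -
    have "(x, A (A x)) \<in> a O a" using A by blast
    then show ?thesis by (simp add: aa in_graph_of)
  qed
  have Apos: "0 \<le> Re (cinner (A x) x)" for x by (rule a(3)[OF A])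
  have A0: "A x = 0" if "p x = 0" for x
  proof -
    have "cinner (A x) (A x) = cinner x (A (A x))" by (rule As)
    then show ?thesis by (simp add: AA that)
  qed
  have Ap: "A (p x) = p x" for x
  proof -
    \<comment> \<open>(A + 1) w = (A^2 - 1) p x = 0, and A is positive, so w = 0.\<close>
    define w where "w = A (p x) - p x"
    have "p x = A w + A (p x)" using Aadd[of w "p x"] by (simp add: w_def AA projection_idem[OF p])
    then have "A w = p x - A (p x)" by (metis add_diff_cancel_right')
    then have "A w = - w" by (metis minus_diff_eq w_def)
    then have "cinner (A w) w = - cinner w w" by (simp add: cinner_minus_left)
    then have "w = 0" using Apos[of w] by simp
    then show ?thesis by (simp add: w_def)
  qed
  have "A x = p x" for x
    using Aadd[of "p x" "x - p x"] A0[of "x - p x"]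
    by (simp add: Ap bounded_ops_diff[OF pb] projection_idem[OF p])
  then have "a = graph_of p" using A sv by (auto simp: in_graph_of set_eq_iff)
  then show "a = graph_of p" .
qed

section \<open>Projection-valued measures and their scalar measures\<close>

lemma pvm_projection:
  "is_projection_valued_measure E \<Longrightarrow> B \<in> sets borel \<Longrightarrow> is_projection (E B)"
  by (simp add: is_projection_valued_measure_def)

lemma pvm_Int:
  "is_projection_valued_measure E \<Longrightarrow> B \<in> sets borel \<Longrightarrow> C \<in> sets borel \<Longrightarrow> E (B \<inter> C) x = E B (E C x)"
  by (simp add: is_projection_valued_measure_def)

lemma pvm_sums:
  "is_projection_valued_measure E \<Longrightarrow> range A \<subseteq> sets borel \<Longrightarrow> disjoint_family A \<Longrightarrow>
    (\<lambda>n. E (A n) x) sums E (\<Union>n::nat. A n) x"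
  by (simp add: is_projection_valued_measure_def)

text \<open>Copies of the empty set form a disjoint sequence, and a constant series converges only
  if its term is 0.\<close>

lemma pvm_empty:
  assumes E: "is_projection_valued_measure E" shows "E {} x = 0"
proof -
  have "(\<lambda>n::nat. E {} x) sums E (\<Union>n::nat. {}) x"
    using pvm_sums[OF E, of "\<lambda>n. {}" x] by (simp add: disjoint_family_on_def)
  then have "(\<lambda>n::nat. E {} x) \<longlonglongrightarrow> 0" by (intro summable_LIMSEQ_zero sums_summable)
  then show ?thesis by (simp add: LIMSEQ_const_iff)
qed

lemma pvm_Compl:
  assumes E: "is_projection_valued_measure E" and B: "B \<in> sets borel"
  shows "E (- B) x = x - E B x"
proof -
  define A where "A n = (if n = 0 then B else if n = 1 then - B else {})" for n :: nat
  have "range A \<subseteq> sets borel" "disjoint_family A"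
    using B by (auto simp: A_def disjoint_family_on_def)
  from pvm_sums[OF E this] have "(\<lambda>n. E (A n) x) sums E (\<Union>n. A n) x" .
  moreover have "(\<Union>n. A n) = UNIV"
    by (auto simp: A_def)
  moreover have "E UNIV x = x" using E by (simp add: is_projection_valued_measure_def)
  ultimately have "(\<lambda>n. E (A n) x) sums x" by simp
  moreover have "(\<lambda>n. E (A n) x) sums (\<Sum>n\<in>{0,1}. E (A n) x)"
    by (rule sums_finite) (auto simp: A_def pvm_empty[OF E])
  ultimately have "x = (\<Sum>n\<in>{0,1}. E (A n) x)" by (rule sums_unique2)
  also have "\<dots> = E B x + E (- B) x" by (simp add: A_def)
  finally show ?thesis by (simp add: algebra_simps)
qed

lemma sets_scalar_spectral_measure [measurable_cong]: "sets (scalar_spectral_measure E x) = sets borel"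
  unfolding scalar_spectral_measure_def
  by (rule sets.sets_measure_of_eq[where M="borel :: real measure", unfolded space_borel])

lemma space_scalar_spectral_measure: "space (scalar_spectral_measure E x) = UNIV"
  by (simp add: scalar_spectral_measure_def space_measure_of_conv)

lemma emeasure_scalar_spectral_measure:
  assumes E: "is_projection_valued_measure E" and B: "B \<in> sets borel"
  shows "emeasure (scalar_spectral_measure E x) B = ennreal ((norm (E B x))\<^sup>2)"
proof -
  have c: "Re (cinner (E C x) x) = (norm (E C x))\<^sup>2" if "C \<in> sets borel" for C
    using projection_cinner_self[OF pvm_projection[OF E that]] by simp
  have "emeasure (scalar_spectral_measure E x) B = ennreal (Re (cinner (E B x) x))"
  proof (rule emeasure_measure_of[OF scalar_spectral_measure_def])
    show "B \<in> sets (scalar_spectral_measure E x)" using B by (simp add: sets_scalar_spectral_measure)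
    show "positive (sets (scalar_spectral_measure E x)) (\<lambda>B. ennreal (Re (cinner (E B x) x)))"
      by (simp add: positive_def pvm_empty[OF E])
    show "countably_additive (sets (scalar_spectral_measure E x)) (\<lambda>B. ennreal (Re (cinner (E B x) x)))"
    proof (rule countably_additiveI, unfold sets_scalar_spectral_measure)
      fix A :: "nat \<Rightarrow> real set" assume A: "range A \<subseteq> sets borel" "disjoint_family A" "(\<Union>n. A n) \<in> sets borel"
      have "(\<lambda>n. Re (cinner (E (A n) x) x)) sums Re (cinner (E (\<Union>n. A n) x) x)"
        by (intro sums_Re bounded_linear.sums[OF bounded_linear_cinner_left] pvm_sums[OF E A(1,2)])
      moreover have "0 \<le> Re (cinner (E (A n) x) x)" for n using c A(1) by (simp add: range_subsetD)
      ultimately show "(\<Sum>n. ennreal (Re (cinner (E (A n) x) x))) = ennreal (Re (cinner (E (\<Union>n. A n) x) x))"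
        by (simp add: sums_iff suminf_ennreal2)
    qed
  qed simp
  then show ?thesis by (simp add: c[OF B])
qed

lemma finite_measure_scalar_spectral_measure:
  "is_projection_valued_measure E \<Longrightarrow> finite_measure (scalar_spectral_measure E x)"
  by (rule finite_measureI) (simp add: emeasure_scalar_spectral_measure space_scalar_spectral_measure)

lemma measure_scalar_spectral_measure:
  "is_projection_valued_measure E \<Longrightarrow> B \<in> sets borel \<Longrightarrow>
    measure (scalar_spectral_measure E x) B = (norm (E B x))\<^sup>2"
  by (simp add: measure_def emeasure_scalar_spectral_measure)

text \<open>This turns the quadratic form on a spectral subspace into an integral over the
  corresponding set. The density is a real indicator under \<open>ennreal\<close>, the shape that
  \<open>integral_density\<close> expects.\<close>

lemma scalar_spectral_measure_restrict:
  assumes E: "is_projection_valued_measure E" and C: "C \<in> sets borel"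
  shows "scalar_spectral_measure E (E C x) = density (scalar_spectral_measure E x) (\<lambda>t. ennreal (indicator C t))"
proof (rule measure_eqI)
  fix B assume "B \<in> sets (scalar_spectral_measure E (E C x))"
  then have B: "B \<in> sets borel" by (simp add: sets_scalar_spectral_measure)
  have CB: "C \<in> sets (scalar_spectral_measure E x)" "B \<in> sets (scalar_spectral_measure E x)"
    using B C by (simp_all add: sets_scalar_spectral_measure)
  have "emeasure (density (scalar_spectral_measure E x) (\<lambda>t. ennreal (indicator C t))) B
      = (\<integral>\<^sup>+ t. ennreal (indicator C t) * indicator B t \<partial>scalar_spectral_measure E x)"
    using CB by (intro emeasure_density) auto
  also have "\<dots> = (\<integral>\<^sup>+ t. indicator (B \<inter> C) t \<partial>scalar_spectral_measure E x)"
    by (rule nn_integral_cong) (auto simp: indicator_def)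
  also have "\<dots> = emeasure (scalar_spectral_measure E x) (B \<inter> C)" using CB by simp
  also have "\<dots> = emeasure (scalar_spectral_measure E (E C x)) B"
    using B C by (simp add: emeasure_scalar_spectral_measure[OF E] pvm_Int[OF E])
  finally show "emeasure (scalar_spectral_measure E (E C x)) B =
    emeasure (density (scalar_spectral_measure E x) (\<lambda>t. ennreal (indicator C t))) B" by simp
qed (simp add: sets_scalar_spectral_measure)

text \<open>\<open>spectral_proj\<close> is a definite description over all spectral measures, so
  they must agree on this half-line. Only quadratic forms are available: by \<open>split\<close>, p
  maps e x and x - e x to vectors with no real cross term, which forces p and e to commute. The
  bounds of the form on the two sides of s then decide e, since p has only the values 0 and
  1.\<close>

lemma spectral_measure_of_projection_unique:
  assumes p: "is_projection p" and sm: "is_spectral_measure_of E (graph_of p)" and s: "0 \<le> s"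
  shows "E {s<..} = (if s < 1 then p else zero_op)"
proof -
  let ?\<mu> = "scalar_spectral_measure E"
  have pb: "p \<in> bounded_ops" by (rule projection_bounded[OF p])
  have E: "is_projection_valued_measure E" using sm by (simp add: is_spectral_measure_of_def)
  have sq: "integrable (?\<mu> x) (\<lambda>t. t\<^sup>2)" for x
    using sm by (auto simp: is_spectral_measure_of_def Domain_graph_of)
  have form: "(norm (p x))\<^sup>2 = (LINT t|?\<mu> x. t)" for x
  proof -
    have "cinner (p x) x = complex_of_real (LINT t|?\<mu> x. t)"
      using sm by (auto simp: is_spectral_measure_of_def in_graph_of)
    then show ?thesis by (simp only: projection_cinner_self[OF p] of_real_eq_iff)
  qed
  interpret fm: finite_measure "?\<mu> x" for x by (rule finite_measure_scalar_spectral_measure[OF E])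
  have meas[measurable]: "(\<lambda>t. t) \<in> borel_measurable (?\<mu> x)" for x
    by (rule measurable_ident_sets[OF sets_scalar_spectral_measure])
  have int: "integrable (?\<mu> x) (\<lambda>t. t)" for x
    by (rule fm.square_integrable_imp_integrable[OF meas sq])
  define C where "C = {s<..}"
  have C: "C \<in> sets borel" "- C \<in> sets borel" by (auto simp: C_def)
  define e where "e = E C"
  have ep: "is_projection e" unfolding e_def by (rule pvm_projection[OF E C(1)])
  have eb: "e \<in> bounded_ops" by (rule projection_bounded[OF ep])
  have ec: "E (- C) x = x - e x" for x unfolding e_def by (rule pvm_Compl[OF E C(1)])
  note ee = projection_idem[OF ep]
  have part: "(norm (p (E B x)))\<^sup>2 = (LINT t|?\<mu> x. indicator B t * t)" if B: "B \<in> sets borel" for B x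
  proof -
    have "B \<in> sets (?\<mu> x)" using B by (simp add: sets_scalar_spectral_measure)
    then show ?thesis unfolding form scalar_spectral_measure_restrict[OF E B]
      by (subst integral_density) auto
  qed
  have split: "(norm (p x))\<^sup>2 = (norm (p (e x)))\<^sup>2 + (norm (p (x - e x)))\<^sup>2" for x
  proof -
    have i: "integrable (?\<mu> x) (\<lambda>t. indicator B t * t)" if "B \<in> sets borel" for B
      using int[of x] that
      by (intro integrable_real_mult_indicator[of B "?\<mu> x" "\<lambda>t. t", unfolded mult.commute[of _ "indicator B _"]])
        (auto simp: sets_scalar_spectral_measure)
    have "(norm (p (e x)))\<^sup>2 + (norm (p (x - e x)))\<^sup>2
        = (LINT t|?\<mu> x. indicator C t * t) + (LINT t|?\<mu> x. indicator (- C) t * t)"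
      using part[OF C(1)] part[OF C(2)] by (simp add: e_def ec[unfolded e_def])
    also have "\<dots> = (LINT t|?\<mu> x. indicator C t * t + indicator (- C) t * t)"
      by (rule Bochner_Integration.integral_add[symmetric]; rule i; rule C)
    also have "\<dots> = (LINT t|?\<mu> x. t)"
      by (intro Bochner_Integration.integral_cong) (auto simp: indicator_def)
    finally show ?thesis by (simp add: form)
  qed
  have "e (p (e x)) = p (e x)" for x
  proof -
    define y where "y = p (e x)"
    \<comment> \<open>A test vector with e v = e x and v - e v = y - e y; the cross term that
      \<open>split\<close> annihilates is then |y - e y|^2.\<close>
    define v where "v = e x + (y - e y)"
    have ev: "e v = e x" by (simp add: v_def bounded_ops_simps[OF eb] ee)
    have "(norm (p v))\<^sup>2 = (norm (p (e x)))\<^sup>2 + (norm (p (y - e y)))\<^sup>2"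
      using split[of v] by (simp add: ev) (simp add: v_def)
    moreover have "p v = p (e x) + p (y - e y)" by (simp only: v_def bounded_ops_add[OF pb])
    ultimately have "Re (cinner (p (e x)) (p (y - e y))) = 0" by (simp only: norm_add_sq)
    then have "Re (cinner y (y - e y)) = 0"
      using projection_sym[OF p, of "p (e x)" "y - e y"] by (simp add: y_def projection_idem[OF p])
    then have "(norm (y - e y))\<^sup>2 = 0"
      using projection_pythagoras[OF ep, of y] projection_cinner_self[OF ep, of y] projection_sym[OF ep, of y y]
      by (simp add: cinner_diff_right)
    then show ?thesis by (simp add: y_def)
  qed
  then have comm: "p (e x) = e (p x)" for x
    by (rule symmetric_commutes_projection[OF ep projection_sym[OF p]])
  \<comment> \<open>The scalar measure of v lives on t > s, so the integral of t - s is strictly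
    positive unless v = 0.\<close>
  have upper: "v = 0" if v: "e v = v" "(norm (p v))\<^sup>2 \<le> s * (norm v)\<^sup>2" for v
  proof (rule ccontr)
    assume "v \<noteq> 0"
    have "E (- C) v = 0" using v(1) by (simp add: ec)
    then have "emeasure (?\<mu> v) (- C) = 0" by (simp add: emeasure_scalar_spectral_measure[OF E C(2)])
    then have AE: "AE t in ?\<mu> v. s < t"
      using C(2) by (intro AE_I[where N="- C"]) (auto simp: C_def sets_scalar_spectral_measure)
    have mv: "measure (?\<mu> v) UNIV = (norm v)\<^sup>2"
      using E by (simp add: measure_scalar_spectral_measure is_projection_valued_measure_def)
    have "(LINT t|?\<mu> v. t - s) = (norm (p v))\<^sup>2 - s * (norm v)\<^sup>2"
      using int[of v] by (simp add: form mv space_scalar_spectral_measure)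
    moreover have "0 \<le> (LINT t|?\<mu> v. t - s)" using AE by (intro integral_nonneg_AE) auto
    ultimately have "(LINT t|?\<mu> v. t - s) = 0" using v(2) by simp
    then have "AE t in ?\<mu> v. t - s = 0"
      using AE int[of v] by (subst (asm) integral_nonneg_eq_0_iff_AE) auto
    then have "AE t in ?\<mu> v. False" using AE by eventually_elim simp
    then have "emeasure (?\<mu> v) UNIV = 0"
      by (subst (asm) AE_iff_measurable[where N=UNIV])
        (auto simp: space_scalar_spectral_measure sets_scalar_spectral_measure)
    then have "(norm v)\<^sup>2 = 0" using mv by (simp add: measure_def)
    then show False using \<open>v \<noteq> 0\<close> by simp
  qed
  have lower: "(norm (p v))\<^sup>2 \<le> s * (norm v)\<^sup>2" if v: "e v = 0" for v
  proof -
    have "emeasure (?\<mu> v) C = 0" using v by (simp add: emeasure_scalar_spectral_measure[OF E C(1)] e_def)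
    then have AE: "AE t in ?\<mu> v. t \<le> s"
      using C(1) by (intro AE_I[where N=C]) (auto simp: C_def sets_scalar_spectral_measure)
    have mv: "measure (?\<mu> v) UNIV = (norm v)\<^sup>2"
      using E by (simp add: measure_scalar_spectral_measure is_projection_valued_measure_def)
    have "(norm (p v))\<^sup>2 \<le> (LINT t|?\<mu> v. s)"
      unfolding form using AE int[of v] by (intro integral_mono_AE) auto
    then show ?thesis by (simp add: mv space_scalar_spectral_measure mult.commute)
  qed
  have "e x = (if s < 1 then p x else 0)" for x
  proof (cases "s < 1")
    case False
    have "(norm (p (e x)))\<^sup>2 \<le> 1 * (norm (e x))\<^sup>2"
      using projection_norm_le[OF p, of "e x"] by (simp add: power_mono)
    also have "\<dots> \<le> s * (norm (e x))\<^sup>2" using False by (intro mult_right_mono) auto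
    finally have "e x = 0" by (intro upper) (simp_all add: ee)
    then show ?thesis using False by simp
  next
    case True
    \<comment> \<open>This vector lies in the range of e and is killed by p, so \<open>upper\<close>
      applies.\<close>
    have "e x - p (e x) = 0"
      using s by (intro upper) (simp_all add: bounded_ops_diff[OF eb] bounded_ops_diff[OF pb] ee projection_idem[OF p] flip: comm)
    moreover have "p x - e (p x) = 0"
    proof -
      let ?v = "p x - e (p x)"
      have "(norm (p ?v))\<^sup>2 \<le> s * (norm ?v)\<^sup>2" by (rule lower) (simp add: bounded_ops_diff[OF eb] ee)
      moreover have "p ?v = ?v" by (simp add: bounded_ops_diff[OF pb] comm projection_idem[OF p])
      ultimately have "(1 - s) * (norm ?v)\<^sup>2 \<le> 0" by (simp add: left_diff_distrib)
      then show ?thesis using True by (simp add: mult_le_0_iff)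
    qed
    ultimately show ?thesis using True by (simp add: comm)
  qed
  then show ?thesis by (auto simp: e_def C_def fun_eq_iff)
qed

lemma sums_indicator_disjoint:
  assumes "disjoint_family A"
  shows "(\<lambda>n::nat. if a \<in> A n then v else 0) sums (if a \<in> (\<Union>n. A n) then v else (0::'h::real_normed_vector))"
proof (cases "\<exists>k. a \<in> A k")
  case True
  then obtain k where k: "a \<in> A k" by blast
  then have "a \<in> A n \<longleftrightarrow> n = k" for n using assms by (auto simp: disjoint_family_on_def)
  then show ?thesis using sums_single[of k "\<lambda>_. v"] by auto
qed auto

text \<open>The spectrum lies in {0, 1}: the witness has mass p at 1 and mass 1 - p at 0.\<close>

lemma spectral_measure_of_projection_exists:
  assumes p: "is_projection p"
  shows "\<exists>E. is_spectral_measure_of E (graph_of p)"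
proof -
  define E :: "real set \<Rightarrow> 'a \<Rightarrow> 'a"
    where "E B = (\<lambda>x. (if 1 \<in> B then p x else 0) + (if 0 \<in> B then x - p x else 0))" for B
  have pb: "p \<in> bounded_ops" by (rule projection_bounded[OF p])
  have E: "is_projection_valued_measure E"
    unfolding is_projection_valued_measure_def
  proof (intro conjI ballI allI impI)
    show "is_projection (E B)" for B
      using p is_projection_complement[OF p] is_projection_zero_op is_projection_id
      by (cases "1 \<in> B"; cases "0 \<in> B") (auto simp: E_def id_def)
    show "E UNIV = id" by (auto simp: E_def)
    show "E (B \<inter> C) = E B \<circ> E C" for B C
      by (auto simp: E_def fun_eq_iff bounded_ops_simps[OF pb] projection_idem[OF p])
    show "(\<lambda>n. E (A n) x) sums E (\<Union>n. A n) x"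
      if "range A \<subseteq> sets borel \<and> disjoint_family A" for A and x
      unfolding E_def using that by (intro sums_add sums_indicator_disjoint) auto
  qed
  let ?\<mu> = "scalar_spectral_measure E"
  interpret fm: finite_measure "?\<mu> x" for x by (rule finite_measure_scalar_spectral_measure[OF E])
  have meas[measurable]: "(\<lambda>t. t) \<in> borel_measurable (?\<mu> x)" for x
    by (rule measurable_ident_sets[OF sets_scalar_spectral_measure])
  have one: "{1} \<in> sets (?\<mu> x)" for x by (simp add: sets_scalar_spectral_measure)
  have AE: "AE t in ?\<mu> x. t = 0 \<or> t = 1" for x
  proof (rule AE_I[where N="- {0, 1}"])
    show "emeasure (?\<mu> x) (- {0, 1}) = 0"
      by (subst emeasure_scalar_spectral_measure[OF E]) (auto simp: E_def)
  qed (auto simp: sets_scalar_spectral_measure)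
  have "integrable (?\<mu> x) (\<lambda>t. t\<^sup>2)" for x
  proof -
    have "integrable (?\<mu> x) (\<lambda>t. indicator {1} t :: real)" using one by (intro fm.integrable_const_bound[where B=1]) auto
    moreover have "AE t in ?\<mu> x. t\<^sup>2 = indicator {1} t" using AE[of x] by eventually_elim auto
    ultimately show ?thesis using one
      by (subst integrable_cong_AE[where g="indicator {1}"]) auto
  qed
  moreover have "cinner (p x) x = complex_of_real (LINT t|?\<mu> x. t)" for x
  proof -
    have "AE t in ?\<mu> x. t = indicator {1} t" using AE[of x] by eventually_elim auto
    then have "(LINT t|?\<mu> x. t) = (LINT t|?\<mu> x. indicator {1} t)"
      using one by (intro integral_cong_AE) auto
    also have "\<dots> = measure (?\<mu> x) {1}" using one by simp
    also have "\<dots> = (norm (p x))\<^sup>2" by (subst measure_scalar_spectral_measure[OF E]) (auto simp: E_def)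
    finally show ?thesis by (simp only: projection_cinner_self[OF p])
  qed
  ultimately have "is_spectral_measure_of E (graph_of p)"
    using E is_operator_graph_of[OF pb] by (auto simp: is_spectral_measure_of_def Domain_graph_of in_graph_of)
  then show ?thesis by blast
qed

lemma spectral_proj_projection:
  assumes p: "is_projection p" and s: "0 \<le> s"
  shows "spectral_proj (abs_op (graph_of p)) {s<..} = (if s < 1 then p else zero_op)"
  unfolding abs_op_projection[OF p] spectral_proj_def
proof (rule the_equality)
  obtain E where E: "is_spectral_measure_of E (graph_of p)"
    using spectral_measure_of_projection_exists[OF p] by blast
  show "\<exists>E. is_spectral_measure_of E (graph_of p) \<and> (if s < 1 then p else zero_op) = E {s<..}"
    using E spectral_measure_of_projection_unique[OF p E s] by metis
  show "q = (if s < 1 then p else zero_op)" if "\<exists>E. is_spectral_measure_of E (graph_of p) \<and> q = E {s<..}" for q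
    using that spectral_measure_of_projection_unique[OF p _ s] by metis
qed

section \<open>Projections as test operators\<close>

context vn_algebra
begin

lemma center_id: "id \<in> projections (center M)"
  by (auto simp: projections_def center_def commutant_def id_in_M is_projection_id bounded_ops_id)

lemma finite_zero_op: "finite_proj M zero_op"
  by (auto simp: finite_proj_def zero_projection proj_le_def)

text \<open>The spectral projection of p beyond 1 is 0, which is finite. So p is measurable, and the
  constant sequence 1 of central projections serves.\<close>

lemma projection_graph_in_LS:
  assumes p: "p \<in> projections M" shows "graph_of p \<in> LS M"
proof -
  have pp: "is_projection p" and pM: "p \<in> M" using p by (simp_all add: projections_iff)
  have pb: "p \<in> bounded_ops" by (rule projection_bounded[OF pp])
  have "closed {z. snd z = p (fst z)}"
    by (intro closed_Collect_eq continuous_intros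
        linear_continuous_on_compose[OF _ bounded_linear.linear])
       (auto intro: continuous_intros linear_continuous_on bounded_linear_compose[OF bounded_ops_bounded_linear[OF pb] bounded_linear_fst, unfolded o_def])
  moreover have "{z. snd z = p (fst z)} = graph_of p" by (auto simp: graph_of_def)
  ultimately have cl: "closed (graph_of p)" by simp
  have "map_prod u u ` graph_of p = graph_of p"
    if u: "u \<in> commutant M" "star u \<circ> u = id \<and> u \<circ> star u = id" for u
  proof (intro set_eqI iffI)
    fix z assume "z \<in> map_prod u u ` graph_of p"
    then show "z \<in> graph_of p" using M_commute[OF pM u(1)] by (auto simp: graph_of_def)
  next
    fix z assume "z \<in> graph_of p"
    then obtain x where z: "z = (x, p x)" by (auto simp: graph_of_def)
    have us: "u (star u x) = x" for x using u(2) by (metis comp_apply id_apply)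
    have "z = map_prod u u (star u x, p (star u x))"
      using M_commute[OF pM u(1), of "star u x"] by (simp add: z us)
    then show "z \<in> map_prod u u ` graph_of p" by (auto simp: graph_of_def)
  qed
  then have ca: "closed_affiliated M (graph_of p)"
    by (auto simp: closed_affiliated_def is_operator_graph_of[OF pb] cl densely_defined_def Domain_graph_of affiliated_def)
  have "measurable_op M (graph_of p)"
    unfolding measurable_op_def
    using ca spectral_proj_projection[OF pp, of 1] finite_zero_op by (intro conjI exI[of _ 1]) simp_all
  moreover have "graph_of id O graph_of p = graph_of p" by (simp add: graph_of_O)
  moreover have "is_proj_sup M {id} id"
    by (auto simp: is_proj_sup_def id_projection proj_le_def)
  ultimately show ?thesis
    unfolding LS_def using ca center_id
    by (intro CollectI conjI exI[of _ "\<lambda>n. id"]) (auto simp: proj_le_def)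
qed

end

section \<open>Halving projections\<close>

context vn_algebra
begin

text \<open>A partial isometry u from q \<le> p onto p lies in the corner pMp; if the corner is
  commutative, the initial and final projections of u coincide.\<close>

lemma finite_if_abelian:
  assumes p: "abelian_proj M p" shows "finite_proj M p"
  unfolding finite_proj_def
proof (intro conjI ballI impI)
  show pM: "p \<in> projections M" using p by (simp add: abelian_proj_def)
  then have pp: "is_projection p" by (simp add: projections_iff)
  fix q assume qM: "q \<in> projections M" and "proj_le q p \<and> mvn_equiv M q p"
  then have qp: "proj_le q p" and eq: "mvn_equiv M q p" by auto
  have qpr: "is_projection q" using qM by (simp add: projections_iff)
  obtain u where u: "u \<in> M" "star u \<circ> u = q" "u \<circ> star u = p"
    using eq by (auto simp: mvn_equiv_def)
  have ub: "u \<in> bounded_ops" by (rule M_bounded[OF u(1)])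
  have uu: "star u (u x) = q x" "u (star u x) = p x" for x using u by (metis comp_apply)+
  have "u (q x) = p (u x)" for x using uu(1)[of x] uu(2)[of "u x"] by simp
  have uq: "u (q x) = u x" for x
  proof -
    have "cinner (u (x - q x)) (u (x - q x)) = cinner (x - q x) (q (x - q x))"
      by (simp add: star_cinner[OF ub] uu)
    also have "\<dots> = 0"
      by (simp add: bounded_ops_diff[OF projection_bounded[OF qpr]] projection_idem[OF qpr])
    finally show ?thesis by (simp add: bounded_ops_diff[OF ub])
  qed
  then have pu: "p (u x) = u x" for x using \<open>\<And>x. u (q x) = p (u x)\<close> by simp
  have up: "u (p x) = u x" for x
    using uq[of "p x"] uq[of x] proj_leD'[OF qpr pp qp, of x] by simp
  have su: "star u (p x) = star u x" for x
    by (rule cinner_ext_left) (simp add: star_cinner_left[OF ub] projection_sym[OF pp] pu)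
  have ps: "p (star u x) = star u x" for x
    by (rule cinner_ext_left) (simp add: star_cinner_left[OF ub] projection_sym[OF pp] up)
  have "(p \<circ> u \<circ> p) \<circ> (p \<circ> star u \<circ> p) = (p \<circ> star u \<circ> p) \<circ> (p \<circ> u \<circ> p)"
    using p u(1) M_star unfolding abelian_proj_def by blast
  then have "p (u (p (p (star u (p x))))) = p (star u (p (p (u (p x)))))" for x
    by (metis comp_apply)
  then have "p x = q x" for x 
    by (simp add: pu up su ps uu projection_idem[OF pp] proj_leD[OF qp])
  then show "q = p" by auto
qed

text \<open>Type II excludes abelian projections by definition; in type III they vanish because they
  are finite.\<close>

lemma no_abelian_if_type_II_or_III:
  assumes "type_II M \<or> type_III M" "abelian_proj M p" shows "p = zero_op"
  using assms finite_if_abelian unfolding type_II_def type_III_def by blast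

end

section \<open>Dimension functions\<close>

locale dimension = vn_algebra M + prob_space \<mu>
  for M :: "('h::chilbert_space \<Rightarrow> 'h) set" and \<mu> :: "'w measure" +
  fixes \<phi> :: "('h \<Rightarrow> 'h) \<Rightarrow> 'w \<Rightarrow> complex" and D :: "('h \<Rightarrow> 'h) \<Rightarrow> 'w \<Rightarrow> ennreal"
  assumes center_iso: "center_isomorphism M \<mu> \<phi>"
    and dim: "dimension_function M \<mu> \<phi> D"
begin

lemmas dim_conjs = dim[unfolded dimension_function_def]

lemma dim_measurable [measurable]: "p \<in> projections M \<Longrightarrow> D p \<in> borel_measurable \<mu>"
  by (rule dim_conjs[THEN conjunct1, rule_format])

lemma dim_finite_iff: "p \<in> projections M \<Longrightarrow> (AE \<omega> in \<mu>. D p \<omega> < \<infinity>) \<longleftrightarrow> finite_proj M p"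
  by (rule dim_conjs[THEN conjunct2, THEN conjunct2, THEN conjunct1, rule_format])

lemma dim_eq_0D:
  assumes "p \<in> projections M" "AE \<omega> in \<mu>. D p \<omega> = 0" shows "p = zero_op"
  using dim_conjs[THEN conjunct2, THEN conjunct1, rule_format, OF assms(1)] assms(2) by argo

lemma dim_add:
  assumes "p \<in> projections M" "q \<in> projections M" "\<And>x. p (q x) = 0"
  shows "AE \<omega> in \<mu>. D (\<lambda>x. p x + q x) \<omega> = D p \<omega> + D q \<omega>"
proof -
  have "p \<circ> q = zero_op" using assms(3) by auto
  from dim_conjs[THEN conjunct2, THEN conjunct2, THEN conjunct2, THEN conjunct1, rule_format, OF assms(1,2) conjI[OF this is_proj_sup_add[OF assms]]]
  show ?thesis .
qed

lemma dim_equiv: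
  assumes "p \<in> projections M" "q \<in> projections M" "mvn_equiv M p q"
  shows "AE \<omega> in \<mu>. D p \<omega> = D q \<omega>"
  by (rule dim_conjs[THEN conjunct2, THEN conjunct2, THEN conjunct2, THEN conjunct2,
      THEN conjunct1, rule_format, OF assms])

lemma dim_central:
  assumes "z \<in> projections (center M)" "p \<in> projections M"
  shows "AE \<omega> in \<mu>. D (z \<circ> p) \<omega> = ennreal (Re (\<phi> z \<omega>)) * D p \<omega>"
  by (rule dim_conjs[THEN conjunct2, THEN conjunct2, THEN conjunct2, THEN conjunct2, THEN conjunct2,
      THEN conjunct1, rule_format, OF assms])

lemma dim_sup:
  assumes "S \<subseteq> projections M" "S \<noteq> {}" "\<And>q r. q \<in> S \<Longrightarrow> r \<in> S \<Longrightarrow> \<exists>s\<in>S. proj_le q s \<and> proj_le r s"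
    "is_proj_sup M S p"
  shows "is_Lplus_sup \<mu> (D ` S) (D p)"
  using dim_conjs[THEN conjunct2, THEN conjunct2, THEN conjunct2, THEN conjunct2, THEN conjunct2, THEN conjunct2] assms by blast

text \<open>Termwise equality makes each supremum an upper bound of the other family. The index set
  may be uncountable, so the argument stays in the lattice of classes.\<close>

lemma dim_sup_eq:
  assumes eq: "\<And>a. a \<in> C \<Longrightarrow> AE \<omega> in \<mu>. D (f a) \<omega> = D (g a) \<omega>"
    and f: "is_Lplus_sup \<mu> (D ` f ` C) (D e)" and g: "is_Lplus_sup \<mu> (D ` g ` C) (D e')"
  shows "AE \<omega> in \<mu>. D e \<omega> = D e' \<omega>"
proof -
  have 1: "AE \<omega> in \<mu>. D (f a) \<omega> \<le> D e' \<omega>" if "a \<in> C" for a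
  proof -
    have "AE \<omega> in \<mu>. D (g a) \<omega> \<le> D e' \<omega>" using g that unfolding is_Lplus_sup_def by blast
    then show ?thesis using eq[OF that] by eventually_elim simp
  qed
  have 2: "AE \<omega> in \<mu>. D (g a) \<omega> \<le> D e \<omega>" if "a \<in> C" for a
  proof -
    have "AE \<omega> in \<mu>. D (f a) \<omega> \<le> D e \<omega>" using f that unfolding is_Lplus_sup_def by blast
    then show ?thesis using eq[OF that] by eventually_elim simp
  qed
  have "AE \<omega> in \<mu>. D e \<omega> \<le> D e' \<omega>" using f g 1 unfolding is_Lplus_sup_def by blast
  moreover have "AE \<omega> in \<mu>. D e' \<omega> \<le> D e \<omega>" using f g 2 unfolding is_Lplus_sup_def by blast
  ultimately show ?thesis by eventually_elim simp
qed

text \<open>Zorn's lemma for pairs of orthogonal subprojections of \<open>p\<close> on which \<open>D\<close> and \<open>D'\<close> agree: the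
  remainder of a maximal pair contains no equivalent orthogonal projections, so it is abelian.\<close>

lemma dim_halving:
  assumes D': "dimension M \<mu> \<phi> D'" and nab: "\<And>r. abelian_proj M r \<Longrightarrow> r = zero_op"
    and p: "p \<in> projections M"
  shows "\<exists>e\<in>projections M. (AE \<omega> in \<mu>. D p \<omega> = 2 * D e \<omega>) \<and> (AE \<omega> in \<mu>. D' p \<omega> = 2 * D' e \<omega>)"
proof -
  interpret D': dimension M \<mu> \<phi> D' by (rule D')
  have pp: "is_projection p" using p by (simp add: projections_iff)
  have pb: "p \<in> bounded_ops" by (rule projection_bounded[OF pp])
  define A where "A = {(e, f). e \<in> projections M \<and> f \<in> projections M \<and> proj_le e p \<and> proj_le f p \<and>
    (\<forall>x. e (f x) = 0) \<and> (AE \<omega> in \<mu>. D e \<omega> = D f \<omega>) \<and> (AE \<omega> in \<mu>. D' e \<omega> = D' f \<omega>)}"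
  define P :: "('h \<Rightarrow> 'h) \<times> ('h \<Rightarrow> 'h) \<Rightarrow> ('h \<Rightarrow> 'h) \<times> ('h \<Rightarrow> 'h) \<Rightarrow> bool"
    where "P a b \<longleftrightarrow> proj_le (fst a) (fst b) \<and> proj_le (snd a) (snd b)" for a b
  have Aproj: "is_projection (fst a)" "is_projection (snd a)" if "a \<in> A" for a
    using that by (auto simp: A_def projections_iff)
  have "\<exists>m\<in>A. \<forall>a\<in>A. P m a \<longrightarrow> a = m"
  proof (rule predicate_Zorn)
    show "partial_order_on A (relation_of P A)"
    proof (rule partial_order_on_relation_ofI)
      show "P a a" if "a \<in> A" for a
        using Aproj[OF that] by (simp add: P_def proj_le_iff projection_idem)
      show "P a c" if "P a b" "P b c" for a b c
        using that unfolding P_def by (blast intro: proj_le_trans)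
      show "a = b" if "a \<in> A" "b \<in> A" "P a b" "P b a" for a b
        using that proj_le_antisym Aproj[OF that(1)] Aproj[OF that(2)] unfolding P_def
        by (auto intro!: prod_eqI)
    qed
    fix C assume C: "C \<in> Chains (relation_of P A)"
    then have CA: "C \<subseteq> A" by (rule Chains_relation_of)
    have chain: "P a b \<or> P b a" if "a \<in> C" "b \<in> C" for a b
      using C that unfolding Chains_def relation_of_def by blast
    show "\<exists>u\<in>A. \<forall>a\<in>C. P a u"
    proof (cases "C = {}")
      case True
      have "(zero_op, zero_op) \<in> A" by (auto simp: A_def zero_projection proj_le_iff bounded_ops_zero[OF pb])
      then show ?thesis using True by blast
    next
      case False
      have sub: "fst ` C \<subseteq> projections M" "snd ` C \<subseteq> projections M" using CA by (auto simp: A_def)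
      obtain e where e: "is_proj_sup M (fst ` C) e" using proj_sup_exists[OF sub(1)] by blast
      obtain f where f: "is_proj_sup M (snd ` C) f" using proj_sup_exists[OF sub(2)] by blast
      have eM: "e \<in> projections M" and fM: "f \<in> projections M" using e f by (simp_all add: is_proj_sup_def)
      then have ep: "is_projection e" and fp: "is_projection f" by (simp_all add: projections_iff)
      have ue: "proj_le (fst a) e" and uf: "proj_le (snd a) f" if "a \<in> C" for a
        using e f that by (auto simp: is_proj_sup_def)
      have le: "proj_le e r" if "r \<in> projections M" "\<And>a. a \<in> C \<Longrightarrow> proj_le (fst a) r" for r
        using e that by (auto simp: is_proj_sup_def)
      have lf: "proj_le f r" if "r \<in> projections M" "\<And>a. a \<in> C \<Longrightarrow> proj_le (snd a) r" for r
        using f that by (auto simp: is_proj_sup_def)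
      \<comment> \<open>The larger of the members a and b decides: its two components are orthogonal
        and dominate \<open>fst a\<close> and \<open>snd b\<close>.\<close>
      have orth: "fst a (snd b x) = 0" if a: "a \<in> C" and b: "b \<in> C" for a b x
      proof -
        have aA: "a \<in> A" and bA: "b \<in> A" using a b CA by auto
        have oa: "fst a (snd a y) = 0" and ob: "fst b (snd b y) = 0" for y
          using aA bA by (auto simp: A_def)
        from chain[OF a b] show ?thesis
        proof
          assume "P a b"
          then have "fst a (fst b (snd b x)) = fst a (snd b x)"
            using proj_leD'[OF Aproj(1)[OF aA] Aproj(1)[OF bA]] unfolding P_def by blast
          then show ?thesis by (simp add: ob bounded_ops_zero[OF projection_bounded[OF Aproj(1)[OF aA]]])
        next
          assume "P b a"
          then have "snd a (snd b x) = snd b x" unfolding P_def by (simp add: proj_leD)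
          then show ?thesis using oa[of "snd b x"] by simp
        qed
      qed
      \<comment> \<open>Orthogonality passes to the supremum, because 1 - \<open>snd b\<close> is an
        upper bound of all first components.\<close>
      have "e (snd b x) = 0" if b: "b \<in> C" for b x
      proof -
        have bp: "is_projection (snd b)" "snd b \<in> projections M"
          using Aproj(2)[OF subsetD[OF CA b]] sub b by auto
        have "snd b (fst a x) = 0" if "a \<in> C" for a x
          using orthogonal_projections_sym[OF _ bp(1)] orth[OF that b] Aproj(1) that CA by blast
        then have "proj_le e (\<lambda>x. x - snd b x)"
          by (intro le projections_complement[OF bp(2)]) (simp add: proj_le_iff)
        then have "snd b (e x) = 0" for x using proj_leD[of e "\<lambda>x. x - snd b x" x] by simp
        then show ?thesis by (rule orthogonal_projections_sym[OF bp(1) ep])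
      qed
      then have "proj_le f (\<lambda>x. x - e x)"
        by (intro lf projections_complement[OF eM]) (simp add: proj_le_iff)
      then have ef: "e (f x) = 0" for x using proj_leD[of f "\<lambda>x. x - e x" x] by simp
      have dir: "\<exists>s\<in>fst ` C. proj_le q s \<and> proj_le r s" if qr: "q \<in> fst ` C" "r \<in> fst ` C" for q r
      proof -
        obtain a b where ab: "a \<in> C" "b \<in> C" "q = fst a" "r = fst b" using qr by blast
        have "proj_le q q" "proj_le r r"
          using projection_idem[OF Aproj(1)[OF subsetD[OF CA ab(1)]]] projection_idem[OF Aproj(1)[OF subsetD[OF CA ab(2)]]]
          by (simp_all add: ab(3,4) proj_le_iff)
        then show ?thesis using chain[OF ab(1,2)] ab unfolding P_def by blast
      qed
      have dir': "\<exists>s\<in>snd ` C. proj_le q s \<and> proj_le r s" if qr: "q \<in> snd ` C" "r \<in> snd ` C" for q r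
      proof -
        obtain a b where ab: "a \<in> C" "b \<in> C" "q = snd a" "r = snd b" using qr by blast
        have "proj_le q q" "proj_le r r"
          using projection_idem[OF Aproj(2)[OF subsetD[OF CA ab(1)]]] projection_idem[OF Aproj(2)[OF subsetD[OF CA ab(2)]]]
          by (simp_all add: ab(3,4) proj_le_iff)
        then show ?thesis using chain[OF ab(1,2)] ab unfolding P_def by blast
      qed
      have eq: "AE \<omega> in \<mu>. D (fst a) \<omega> = D (snd a) \<omega>" "AE \<omega> in \<mu>. D' (fst a) \<omega> = D' (snd a) \<omega>"
        if "a \<in> C" for a
        using that CA by (auto simp: A_def)
      have ne: "fst ` C \<noteq> {}" "snd ` C \<noteq> {}" using False by simp_all
      have "AE \<omega> in \<mu>. D e \<omega> = D f \<omega>"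
        by (rule dim_sup_eq[OF eq(1) dim_sup[OF sub(1) ne(1) dir e] dim_sup[OF sub(2) ne(2) dir' f]])
      moreover have "AE \<omega> in \<mu>. D' e \<omega> = D' f \<omega>"
        by (rule D'.dim_sup_eq[OF eq(2) D'.dim_sup[OF sub(1) ne(1) dir e] D'.dim_sup[OF sub(2) ne(2) dir' f]])
      moreover have "proj_le e p" "proj_le f p"
        using CA by (auto intro!: le lf p simp: A_def)
      ultimately have "(e, f) \<in> A" using eM fM ef by (simp add: A_def)
      then show ?thesis using ue uf by (intro bexI[of _ "(e, f)"]) (simp_all add: P_def)
    qed
  qed
  then obtain e f where A: "(e, f) \<in> A" and max: "\<And>a. a \<in> A \<Longrightarrow> P (e, f) a \<Longrightarrow> a = (e, f)" by fastforce
  then have eM: "e \<in> projections M" and fM: "f \<in> projections M" and ple: "proj_le e p" "proj_le f p"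
    and ef: "\<And>x. e (f x) = 0" and Def: "AE \<omega> in \<mu>. D e \<omega> = D f \<omega>" "AE \<omega> in \<mu>. D' e \<omega> = D' f \<omega>"
    by (auto simp: A_def)
  have ep: "is_projection e" and fp: "is_projection f" using eM fM by (simp_all add: projections_iff)
  have eb: "e \<in> bounded_ops" and fb: "f \<in> bounded_ops" using ep fp by (simp_all add: projection_bounded)
  have fe: "f (e x) = 0" for x by (rule orthogonal_projections_sym[OF ep fp ef])
  define g where "g = (\<lambda>x. e x + f x)"
  have gs: "is_proj_sup M {e, f} g" unfolding g_def by (rule is_proj_sup_add[OF eM fM ef])
  then have gM: "g \<in> projections M" by (simp add: is_proj_sup_def)
  have gp: "proj_le g p" using gs p ple by (auto simp: is_proj_sup_def)
  define r where "r = (\<lambda>x. p x - g x)"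
  have rM: "r \<in> projections M" unfolding r_def by (rule projections_diff[OF gM p gp])
  have er: "e (r x) = 0" and fr: "f (r x) = 0" for x
    using proj_leD'[OF ep pp ple(1)] proj_leD'[OF fp pp ple(2)]
    by (simp_all add: r_def g_def bounded_ops_simps[OF eb] bounded_ops_simps[OF fb] projection_idem[OF ep]
        projection_idem[OF fp] ef fe)
  have rp: "proj_le r p" using proj_leD[OF gp] by (simp add: proj_le_iff r_def bounded_ops_diff[OF pb] projection_idem[OF pp])
  have "r = zero_op"
  proof (rule ccontr)
    assume "r \<noteq> zero_op"
    then have "\<not> abelian_proj M r" using nab by blast
    from nonabelian_equivalent_pair[OF rM this] obtain U V
      where UV: "U \<in> projections M" "V \<in> projections M" "U \<noteq> zero_op" "mvn_equiv M U V" "proj_le U r" "proj_le V r"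
        "\<And>x. U (V x) = 0" by blast
    have Up: "is_projection U" and Vp: "is_projection V" using UV by (simp_all add: projections_iff)
    have eU: "e (U x) = 0" and eV: "e (V x) = 0" and fU: "f (U x) = 0" and fV: "f (V x) = 0" for x
      using er[of "U x"] er[of "V x"] fr[of "U x"] fr[of "V x"] proj_leD[OF UV(5)] proj_leD[OF UV(6)] by simp_all
    have Uf: "U (f x) = 0" for x by (rule orthogonal_projections_sym[OF fp Up fU])
    have Ue: "U (e x) = 0" for x by (rule orthogonal_projections_sym[OF ep Up eU])
    have Vf: "V (f x) = 0" for x by (rule orthogonal_projections_sym[OF fp Vp fV])
    \<comment> \<open>Equivalent projections have the same D and the same D', so adding U and V to
      the two sides gives a strictly larger pair.\<close>
    define e' where "e' = (\<lambda>x. e x + U x)"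
    define f' where "f' = (\<lambda>x. f x + V x)"
    have se: "is_proj_sup M {e, U} e'" unfolding e'_def by (rule is_proj_sup_add[OF eM UV(1) eU])
    have sf: "is_proj_sup M {f, V} f'" unfolding f'_def by (rule is_proj_sup_add[OF fM UV(2) fV])
    have eq: "AE \<omega> in \<mu>. D e' \<omega> = D f' \<omega>"
      using dim_add[OF eM UV(1) eU] dim_add[OF fM UV(2) fV] Def(1) dim_equiv[OF UV(1,2,4)]
      by eventually_elim (simp add: e'_def f'_def)
    have eq': "AE \<omega> in \<mu>. D' e' \<omega> = D' f' \<omega>"
      using D'.dim_add[OF eM UV(1) eU] D'.dim_add[OF fM UV(2) fV] Def(2) D'.dim_equiv[OF UV(1,2,4)]
      by eventually_elim (simp add: e'_def f'_def)
    have "proj_le U p" "proj_le V p" using UV(5,6) rp proj_le_trans by blast+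
    then have "proj_le e' p" "proj_le f' p" using se sf p ple by (auto simp: is_proj_sup_def)
    moreover have "e' (f' x) = 0" for x
      by (simp add: e'_def f'_def bounded_ops_add[OF eb] bounded_ops_add[OF projection_bounded[OF Up]] ef eV Uf UV(7))
    moreover have "e' \<in> projections M" "f' \<in> projections M" using se sf by (simp_all add: is_proj_sup_def)
    ultimately have "(e', f') \<in> A" using eq eq' by (simp add: A_def)
    moreover have "P (e, f) (e', f')"
      using se sf by (simp add: P_def is_proj_sup_def)
    ultimately have "e' = e" using max by blast
    then have "U x = 0" for x unfolding e'_def by (metis add_cancel_left_right)
    then show False using UV(3) by auto
  qed
  then have "p x = e x + f x" for x unfolding r_def g_def by (metis eq_iff_diff_eq_0)
  then have pef: "p = (\<lambda>x. e x + f x)" by auto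
  have "AE \<omega> in \<mu>. D p \<omega> = 2 * D e \<omega>"
    using dim_add[OF eM fM ef] Def(1) unfolding pef[symmetric] by eventually_elim (simp add: mult_2)
  moreover have "AE \<omega> in \<mu>. D' p \<omega> = 2 * D' e \<omega>"
    using D'.dim_add[OF eM fM ef] Def(2) unfolding pef[symmetric] by eventually_elim (simp add: mult_2)
  ultimately show ?thesis using eM by blast
qed

lemma dim_dyadic_part:
  assumes D': "dimension M \<mu> \<phi> D'" and nab: "\<And>r. abelian_proj M r \<Longrightarrow> r = zero_op"
    and p: "p \<in> projections M"
  shows "\<exists>e\<in>projections M. (AE \<omega> in \<mu>. D p \<omega> = 2 ^ n * D e \<omega>) \<and> (AE \<omega> in \<mu>. D' p \<omega> = 2 ^ n * D' e \<omega>)"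
proof (induction n)
  case 0 then show ?case using p by auto
next
  case (Suc n)
  then obtain e where e: "e \<in> projections M" "AE \<omega> in \<mu>. D p \<omega> = 2 ^ n * D e \<omega>" "AE \<omega> in \<mu>. D' p \<omega> = 2 ^ n * D' e \<omega>"
    by blast
  obtain f where f: "f \<in> projections M" "AE \<omega> in \<mu>. D e \<omega> = 2 * D f \<omega>" "AE \<omega> in \<mu>. D' e \<omega> = 2 * D' f \<omega>"
    using dim_halving[OF D' nab e(1)] by blast
  have "AE \<omega> in \<mu>. D p \<omega> = 2 ^ Suc n * D f \<omega>" using e(2) f(2) by eventually_elim (simp add: ac_simps)
  moreover have "AE \<omega> in \<mu>. D' p \<omega> = 2 ^ Suc n * D' f \<omega>" using e(3) f(3) by eventually_elim (simp add: ac_simps)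
  ultimately show ?case using f(1) by blast
qed

end

section \<open>Uniqueness of the pair\<close>

context vn_algebra
begin

lemma center_in_M: "a \<in> center M \<Longrightarrow> a \<in> M"
  and center_commute: "a \<in> center M \<Longrightarrow> b \<in> M \<Longrightarrow> b (a x) = a (b x)"
  by (auto simp: center_def intro: commutant_commute)

lemma centerI: "a \<in> M \<Longrightarrow> (\<And>b x. b \<in> M \<Longrightarrow> b (a x) = a (b x)) \<Longrightarrow> a \<in> center M"
  by (simp add: center_def commutantI M_bounded)

lemma center_star: "a \<in> center M \<Longrightarrow> star a \<in> center M"
  by (simp add: center_def M_star star_commutant)

lemma center_comp: "a \<in> center M \<Longrightarrow> b \<in> center M \<Longrightarrow> a \<circ> b \<in> center M"
proof (rule centerI)
  assume ab: "a \<in> center M" "b \<in> center M"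
  then show "a \<circ> b \<in> M" by (simp add: M_comp center_in_M)
  show "c ((a \<circ> b) x) = (a \<circ> b) (c x)" if "c \<in> M" for c x
    using center_commute[OF ab(1) that] center_commute[OF ab(2) that] by simp
qed

lemma zero_in_center: "zero_op \<in> center M"
  by (rule centerI) (simp_all add: zero_in_M M_bounded bounded_ops_zero)

lemma id_in_center: "id \<in> center M"
  by (rule centerI) (simp_all add: id_in_M)

lemma central_projection: "z \<in> projections (center M) \<Longrightarrow> z \<in> projections M"
  by (simp add: projections_def center_in_M)

lemma central_comp_projection:
  assumes z: "z \<in> projections (center M)" and p: "p \<in> projections M"
  shows "z \<circ> p \<in> projections M"
proof -
  have "z \<in> center M" "is_projection z" "p \<in> M" "is_projection p"
    using z p by (simp_all add: projections_def)
  moreover from this have "z (p x) = p (z x)" for x using center_commute[of z p x] by simp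
  ultimately show ?thesis by (simp add: projections_iff M_comp center_in_M is_projection_comp)
qed

end

section \<open>Central projections of measurable sets\<close>

context dimension
begin

lemma center_iso_measurable: "a \<in> center M \<Longrightarrow> \<phi> a \<in> borel_measurable \<mu>"
  using center_iso by (simp add: center_isomorphism_def Linfty_def)

lemma center_iso_mult:
  assumes "a \<in> center M" "b \<in> center M"
  shows "AE \<omega> in \<mu>. \<phi> (\<lambda>x. a (b x)) \<omega> = \<phi> a \<omega> * \<phi> b \<omega>"
  using center_iso assms by (simp add: center_isomorphism_def o_def)

lemma center_iso_star: "a \<in> center M \<Longrightarrow> AE \<omega> in \<mu>. \<phi> (star a) \<omega> = cnj (\<phi> a \<omega>)"
  using center_iso by (simp add: center_isomorphism_def)

lemma center_iso_inj:
  "a \<in> center M \<Longrightarrow> b \<in> center M \<Longrightarrow> (AE \<omega> in \<mu>. \<phi> a \<omega> = \<phi> b \<omega>) \<Longrightarrow> a = b"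
  using center_iso by (simp add: center_isomorphism_def)

lemma center_iso_zero: "AE \<omega> in \<mu>. \<phi> zero_op \<omega> = 0"
proof -
  have "\<forall>c. \<forall>a\<in>center M. AE \<omega> in \<mu>. \<phi> (\<lambda>\<xi>. c *\<^sub>C a \<xi>) \<omega> = c * \<phi> a \<omega>"
    using center_iso by (simp add: center_isomorphism_def)
  from bspec[OF spec[OF this, of 0] zero_in_center] show ?thesis by simp
qed

text \<open>Surjectivity of \<phi> provides z. An indicator is idempotent and real, and injectivity
  carries these identities back to z.\<close>

lemma central_indicator:
  assumes A: "A \<in> sets \<mu>"
  obtains z where "z \<in> projections (center M)" "AE \<omega> in \<mu>. \<phi> z \<omega> = indicator A \<omega>"
proof -
  have "(indicator A :: 'w \<Rightarrow> complex) \<in> Linfty \<mu>"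
    using A by (auto simp: Linfty_def indicator_def intro!: exI[of _ 1])
  then obtain z where z: "z \<in> center M" "AE \<omega> in \<mu>. \<phi> z \<omega> = indicator A \<omega>"
    using center_iso unfolding center_isomorphism_def by fastforce
  have "AE \<omega> in \<mu>. \<phi> (z \<circ> z) \<omega> = \<phi> z \<omega>"
    using center_iso_mult[OF z(1) z(1)] z(2)
    unfolding o_def by eventually_elim (simp add: indicator_def)
  then have zz: "z \<circ> z = z" by (rule center_iso_inj[OF center_comp[OF z(1) z(1)] z(1)])
  have "AE \<omega> in \<mu>. \<phi> (star z) \<omega> = \<phi> z \<omega>"
    using center_iso_star[OF z(1)] z(2) by eventually_elim (simp add: indicator_def)
  then have "star z = z" by (rule center_iso_inj[OF center_star[OF z(1)] z(1)])
  then have "z \<in> projections (center M)"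
    using z(1) zz by (simp add: projections_def is_projection_def M_bounded center_in_M)
  then show thesis using z(2) by (rule that)
qed

lemma dim_central_indicator:
  assumes "z \<in> projections (center M)" "AE \<omega> in \<mu>. \<phi> z \<omega> = indicator A \<omega>" "p \<in> projections M"
  shows "AE \<omega> in \<mu>. D (z \<circ> p) \<omega> = indicator A \<omega> * D p \<omega>"
  using dim_central[OF assms(1,3)] assms(2) by eventually_elim (simp add: indicator_def)

lemma dim_central_indicator_id:
  assumes "z \<in> projections (center M)" "AE \<omega> in \<mu>. \<phi> z \<omega> = indicator A \<omega>"
  shows "AE \<omega> in \<mu>. D z \<omega> = indicator A \<omega> * D id \<omega>"
  using dim_central_indicator[OF assms id_projection] by simp

lemma null_if_central_zero:
  assumes "AE \<omega> in \<mu>. \<phi> zero_op \<omega> = indicator A \<omega>" shows "AE \<omega> in \<mu>. \<omega> \<notin> A"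
  using assms center_iso_zero by eventually_elim (auto simp: indicator_def)

text \<open>The central projection of the set where D(1) = 0 has dimension 0, hence is 0, so the set
  is null.\<close>

lemma dim_id_positive: "AE \<omega> in \<mu>. D id \<omega> > 0"
proof -
  define A where "A = {\<omega> \<in> space \<mu>. D id \<omega> = 0}"
  have "A \<in> sets \<mu>" unfolding A_def using dim_measurable[OF id_projection] by measurable
  then obtain z where z: "z \<in> projections (center M)" "AE \<omega> in \<mu>. \<phi> z \<omega> = indicator A \<omega>"
    by (rule central_indicator)
  have "AE \<omega> in \<mu>. D z \<omega> = 0"
    using dim_central_indicator_id[OF z] by eventually_elim (simp add: A_def indicator_def)
  then have "z = zero_op" by (rule dim_eq_0D[OF central_projection[OF z(1)]])
  then have "AE \<omega> in \<mu>. \<omega> \<notin> A" using z(2) by (intro null_if_central_zero) simp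
  then show ?thesis using AE_space by eventually_elim (simp add: A_def zero_less_iff_neq_zero)
qed

text \<open>The central projection of the set where D(1) is finite has finite dimension, hence is a
  finite projection. The hypothesis covers type II_infinity and type III together.\<close>

lemma dim_id_infinite:
  assumes inf: "\<And>z. z \<in> projections (center M) \<Longrightarrow> finite_proj M z \<Longrightarrow> z = zero_op"
  shows "AE \<omega> in \<mu>. D id \<omega> = \<infinity>"
proof -
  define A where "A = {\<omega> \<in> space \<mu>. D id \<omega> < \<infinity>}"
  have "A \<in> sets \<mu>" unfolding A_def using dim_measurable[OF id_projection] by measurable
  then obtain z where z: "z \<in> projections (center M)" "AE \<omega> in \<mu>. \<phi> z \<omega> = indicator A \<omega>"
    by (rule central_indicator)
  have "AE \<omega> in \<mu>. D z \<omega> < \<infinity>"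
    using dim_central_indicator_id[OF z] by eventually_elim (simp add: A_def indicator_def)
  then have "z = zero_op" using inf[OF z(1)] dim_finite_iff[OF central_projection[OF z(1)]] by blast
  then have "AE \<omega> in \<mu>. \<omega> \<notin> A" using z(2) by (intro null_if_central_zero) simp
  then show ?thesis using AE_space by eventually_elim (simp add: A_def not_less top.extremum_unique)
qed

section \<open>F-norms of projections and comparison of dimensions\<close>

lemma F_norm_projection_le:
  assumes p: "p \<in> projections M" and t: "0 < t" "t < 1"
  shows "F_norm \<mu> D (graph_of p) \<le> max t (prob {\<omega> \<in> space \<mu>. D p \<omega> > ennreal t})"
proof -
  have pp: "is_projection p" using p by (simp add: projections_iff)
  have "F_norm \<mu> D (graph_of p) \<le>
    max t (prob {\<omega> \<in> space \<mu>. D (spectral_proj (abs_op (graph_of p)) {t<..}) \<omega> > ennreal t})"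
    unfolding F_norm_def
  proof (rule cINF_lower)
    show "bdd_below ((\<lambda>t. max t (prob {\<omega> \<in> space \<mu>. ennreal t < D (spectral_proj (abs_op (graph_of p)) {t<..}) \<omega>})) ` {0<..})"
      by (rule bdd_belowI2[of _ 0]) (auto simp: le_max_iff_disj)
  qed (simp add: t)
  then show ?thesis using t by (simp add: spectral_proj_projection[OF pp])
qed

text \<open>Thresholds t \<ge> c contribute at least c by themselves. The bound c \<le> 1 keeps the
  others below 1, where the spectral projection is p itself.\<close>

lemma F_norm_projection_ge:
  assumes p: "p \<in> projections M" and c: "c \<le> 1"
    and le: "\<And>t. 0 < t \<Longrightarrow> t < c \<Longrightarrow> c \<le> prob {\<omega> \<in> space \<mu>. D p \<omega> > ennreal t}"
  shows "c \<le> F_norm \<mu> D (graph_of p)"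
  unfolding F_norm_def
proof (rule cINF_greatest)
  have pp: "is_projection p" using p by (simp add: projections_iff)
  fix t :: real assume "t \<in> {0<..}"
  then have t: "0 < t" by simp
  show "c \<le> max t (prob {\<omega> \<in> space \<mu>. D (spectral_proj (abs_op (graph_of p)) {t<..}) \<omega> > ennreal t})"
  proof (cases "t < c")
    case True
    then show ?thesis using le[OF t True] t c by (simp add: spectral_proj_projection[OF pp] le_max_iff_disj)
  qed (simp add: le_max_iff_disj)
qed (auto intro: exI[of _ 1])

text \<open>Up to a null set, [D(z) > t] is always inside A, and it is all of A for t < \<mu>(A)
  because D(1) is large there.\<close>

lemma F_norm_central:
  assumes A: "A \<in> sets \<mu>" and z: "z \<in> projections (center M)" "AE \<omega> in \<mu>. \<phi> z \<omega> = indicator A \<omega>"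
    and large: "AE \<omega> in \<mu>. \<omega> \<in> A \<longrightarrow> ennreal (prob A) \<le> D id \<omega>"
  shows "F_norm \<mu> D (graph_of z) = prob A"
proof (rule antisym)
  have zM: "z \<in> projections M" by (rule central_projection[OF z(1)])
  note Dz = dim_central_indicator_id[OF z]
  have m[measurable]: "D z \<in> borel_measurable \<mu>" by (rule dim_measurable[OF zM])
  show "prob A \<le> F_norm \<mu> D (graph_of z)"
  proof (rule F_norm_projection_ge[OF zM prob_le_1])
    fix t :: real assume t: "0 < t" "t < prob A"
    show "prob A \<le> prob {\<omega> \<in> space \<mu>. ennreal t < D z \<omega>}"
    proof (rule finite_measure_mono_AE)
      show "AE \<omega> in \<mu>. \<omega> \<in> A \<longrightarrow> \<omega> \<in> {\<omega> \<in> space \<mu>. ennreal t < D z \<omega>}"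
        using Dz large AE_space
      proof eventually_elim
        case (elim \<omega>)
        have "ennreal t < ennreal (prob A)" using t by (simp add: ennreal_less_iff)
        then show ?case using elim by (auto intro: less_le_trans)
      qed
    qed measurable
  qed
  have up: "F_norm \<mu> D (graph_of z) \<le> max t (prob A)" if "0 < t" "t < 1" for t
  proof -
    have "prob {\<omega> \<in> space \<mu>. ennreal t < D z \<omega>} \<le> prob A"
    proof (rule finite_measure_mono_AE[OF _ A])
      show "AE \<omega> in \<mu>. \<omega> \<in> {\<omega> \<in> space \<mu>. ennreal t < D z \<omega>} \<longrightarrow> \<omega> \<in> A"
        using Dz by eventually_elim (auto simp: indicator_def split: if_splits)
    qed
    then show ?thesis using F_norm_projection_le[OF zM that] by linarith
  qed
  show "F_norm \<mu> D (graph_of z) \<le> prob A"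
  proof (rule field_le_epsilon)
    fix e :: real assume "0 < e"
    \<comment> \<open>The minimum with 1/2 keeps the threshold below 1.\<close>
    then have "F_norm \<mu> D (graph_of z) \<le> max (min e (1/2)) (prob A)" by (intro up) auto
    also have "\<dots> \<le> prob A + e" 
      using measure_nonneg[of \<mu> A] min.cobounded1[of e "1/2"] \<open>0 < e\<close> by (intro max.boundedI) linarith+
    finally show "F_norm \<mu> D (graph_of z) \<le> prob A + e" .
  qed
qed

lemma dimension_le:
  assumes D': "dimension M \<mu> \<phi> D'" and nab: "\<And>r. abelian_proj M r \<Longrightarrow> r = zero_op"
    and eq: "\<And>q. q \<in> projections M \<Longrightarrow> F_norm \<mu> D (graph_of q) = F_norm \<mu> D' (graph_of q)"
    and p: "p \<in> projections M"
  shows "AE \<omega> in \<mu>. D p \<omega> \<le> D' p \<omega>"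
proof -
  interpret D': dimension M \<mu> \<phi> D' by (rule D')
  have m[measurable]: "D p \<in> borel_measurable \<mu>" "D' p \<in> borel_measurable \<mu>"
    using dim_measurable D'.dim_measurable p by blast+
  have "AE \<omega> in \<mu>. \<not> (D' p \<omega> < ennreal a \<and> ennreal b < D p \<omega>)" if ab: "0 < a" "a < b" for a b
  proof (rule ccontr)
    define A where "A = {\<omega> \<in> space \<mu>. D' p \<omega> < ennreal a \<and> ennreal b < D p \<omega>}"
    have A[measurable]: "A \<in> sets \<mu>" unfolding A_def by measurable
    assume "\<not> ?thesis"
    then have "prob A \<noteq> 0" using A prob_eq_0[OF A] AE_space
      by (auto simp: A_def elim!: eventually_mono)
    then have A0: "0 < prob A" by (simp add: zero_less_measure_iff)
    \<comment> \<open>Brings the level b down to c = b/2^n \<le> \<mu>(A), so that the norm for D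
      detects the level before the size of A limits it.\<close>
    obtain n where n: "b / prob A < 2 ^ n" using real_arch_pow[of 2 "b / prob A"] by auto
    define c where "c = b / 2 ^ n"
    have c: "0 < c" "c \<le> prob A" using n A0 ab by (simp_all add: c_def field_simps)
    have ac: "a / 2 ^ n < c" using ab by (simp add: c_def divide_strict_right_mono)
    obtain z where z: "z \<in> projections (center M)" "AE \<omega> in \<mu>. \<phi> z \<omega> = indicator A \<omega>"
      using A by (rule central_indicator)
    obtain e where e: "e \<in> projections M" "AE \<omega> in \<mu>. D p \<omega> = 2 ^ n * D e \<omega>"
      "AE \<omega> in \<mu>. D' p \<omega> = 2 ^ n * D' e \<omega>"
      using dim_dyadic_part[OF D' nab p, of n] by blast
    define q where "q = z \<circ> e"
    have qM: "q \<in> projections M" unfolding q_def by (rule central_comp_projection[OF z(1) e(1)])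
    have mq[measurable]: "D q \<in> borel_measurable \<mu>" "D' q \<in> borel_measurable \<mu>"
      using dim_measurable D'.dim_measurable qM by blast+
    \<comment> \<open>D may be infinite, so values on the part e are compared after multiplication
      by 2^n rather than obtained by division.\<close>
    have scale: "ennreal r = 2 ^ n * ennreal (r / 2 ^ n)" if "0 < r" for r
    proof -
      have "2 ^ n * ennreal (r / 2 ^ n) = ennreal (2 ^ n) * ennreal (r / 2 ^ n)"
        by (simp add: ennreal_power[symmetric])
      also have "\<dots> = ennreal r" using that by (simp add: ennreal_mult[symmetric])
      finally show ?thesis by simp
    qed
    have mono: "x < y" if "2 ^ n * x < 2 ^ n * (y::ennreal)" for x y
      using that by (meson mult_left_mono not_less zero_le)
    have "c \<le> F_norm \<mu> D (graph_of q)"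
    proof (rule F_norm_projection_ge[OF qM])
      show "c \<le> 1" using c(2) prob_le_1[of A] by linarith
      fix t assume t: "0 < t" "t < c"
      have "prob A \<le> prob {\<omega> \<in> space \<mu>. ennreal t < D q \<omega>}"
      proof (rule finite_measure_mono_AE)
        show "AE \<omega> in \<mu>. \<omega> \<in> A \<longrightarrow> \<omega> \<in> {\<omega> \<in> space \<mu>. ennreal t < D q \<omega>}"
          using dim_central_indicator[OF z e(1)] e(2) AE_space
        proof eventually_elim
          case (elim \<omega>)
          show ?case
          proof
            assume \<omega>: "\<omega> \<in> A"
            then have "2 ^ n * ennreal c < 2 ^ n * D e \<omega>"
              using elim(2) scale[of b] ab by (simp add: A_def c_def)
            then have "ennreal c < D e \<omega>" by (rule mono)
            moreover have "ennreal t < ennreal c" using t by (simp add: ennreal_less_iff)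
            ultimately show "\<omega> \<in> {\<omega> \<in> space \<mu>. ennreal t < D q \<omega>}"
              using elim \<omega> by (auto simp: q_def)
          qed
        qed
      qed measurable
      then show "c \<le> prob {\<omega> \<in> space \<mu>. ennreal t < D q \<omega>}" using c(2) by linarith
    qed
    moreover have "F_norm \<mu> D' (graph_of q) \<le> a / 2 ^ n"
    proof -
      have t: "0 < a / 2 ^ n" "a / 2 ^ n < 1" using ab ac c(2) prob_le_1[of A] by (simp, linarith)
      have "AE \<omega> in \<mu>. D' q \<omega> \<le> ennreal (a / 2 ^ n)"
        using D'.dim_central_indicator[OF z e(1)] e(3)
      proof eventually_elim
        case (elim \<omega>)
        show ?case
        proof (cases "\<omega> \<in> A")
          case True
          then have "2 ^ n * D' e \<omega> < 2 ^ n * ennreal (a / 2 ^ n)"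
            using elim(2) scale[of a] ab by (simp add: A_def)
          then have "D' e \<omega> < ennreal (a / 2 ^ n)" by (rule mono)
          then show ?thesis using elim True by (simp add: q_def)
        qed (use elim in \<open>simp add: q_def\<close>)
      qed
      then have "prob {\<omega> \<in> space \<mu>. ennreal (a / 2 ^ n) < D' q \<omega>} = 0"
        by (subst prob_eq_0) (auto simp: not_less elim!: eventually_mono)
      then show ?thesis using D'.F_norm_projection_le[OF qM t] t(1) by simp
    qed
    ultimately show False using eq[OF qM] ac by linarith
  qed
  \<comment> \<open>The conditions on a and b move inside the almost-everywhere statement, so that
    all pairs of rationals can be treated at once.\<close>
  then have "AE \<omega> in \<mu>. 0 < a \<and> a < b \<longrightarrow> \<not> (D' p \<omega> < ennreal a \<and> ennreal b < D p \<omega>)" for a b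
    by (cases "0 < a \<and> a < b") auto
  then have "AE \<omega> in \<mu>. \<forall>(r::rat) s::rat. 0 < real_of_rat r \<and> real_of_rat r < real_of_rat s \<longrightarrow>
    \<not> (D' p \<omega> < ennreal (real_of_rat r) \<and> ennreal (real_of_rat s) < D p \<omega>)"
    unfolding AE_all_countable by blast
  then show ?thesis
  proof eventually_elim
    case (elim \<omega>)
    show ?case
    proof (rule ccontr)
      assume "\<not> D p \<omega> \<le> D' p \<omega>"
      then have "D' p \<omega> < D p \<omega>" by simp
      from ennreal_rat_dense[OF this] obtain r :: rat
        where r: "D' p \<omega> < ennreal (real_of_rat r)" "ennreal (real_of_rat r) < D p \<omega>" by blast
      from ennreal_rat_dense[OF r(2)] obtain s :: rat
        where s: "ennreal (real_of_rat r) < ennreal (real_of_rat s)" "ennreal (real_of_rat s) < D p \<omega>" by blast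
      have "0 < ennreal (real_of_rat r)" using r(1) by (rule le_less_trans[OF zero_le])
      then have r0: "0 < real_of_rat r" by (simp only: ennreal_less_zero_iff)
      then have "real_of_rat r < real_of_rat s" using s(1) by (simp add: ennreal_less_iff del: of_rat_less)
      then show False using elim r0 r(1) s(2) by blast
    qed
  qed
qed

text \<open>Projections below z correspond to subsets of A: \<phi>(w) is idempotent and vanishes off
  A, hence is the indicator of the part B of A where it equals 1. Injectivity keeps B and A - B
  non-null.\<close>

lemma atomless_center_split:
  assumes al: "atomless (center M)" and A: "A \<in> sets \<mu>" and A0: "\<not> (AE \<omega> in \<mu>. \<omega> \<notin> A)"
  shows "\<exists>B\<in>sets \<mu>. B \<subseteq> A \<and> \<not> (AE \<omega> in \<mu>. \<omega> \<notin> B) \<and> \<not> (AE \<omega> in \<mu>. \<omega> \<notin> A - B)"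
proof -
  obtain z where z: "z \<in> projections (center M)" "AE \<omega> in \<mu>. \<phi> z \<omega> = indicator A \<omega>"
    using A by (rule central_indicator)
  have "z \<noteq> zero_op" using null_if_central_zero[of A] z(2) A0 by auto
  then obtain w where w: "w \<in> projections (center M)" "proj_le w z" "w \<noteq> zero_op" "w \<noteq> z"
    using al z(1) unfolding atomless_def by blast
  have wc: "w \<in> center M" and wp: "is_projection w" and zc: "z \<in> center M"
    using w(1) z(1) by (simp_all add: projections_def)
  have m[measurable]: "\<phi> w \<in> borel_measurable \<mu>" by (rule center_iso_measurable[OF wc])
  have ww: "AE \<omega> in \<mu>. \<phi> w \<omega> = \<phi> w \<omega> * \<phi> w \<omega>"
    using center_iso_mult[OF wc wc] by (simp add: projection_idem[OF wp])
  have zw: "AE \<omega> in \<mu>. \<phi> w \<omega> = \<phi> z \<omega> * \<phi> w \<omega>"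
    using center_iso_mult[OF zc wc] by (simp add: proj_leD[OF w(2)])
  define B where "B = {\<omega> \<in> space \<mu>. \<phi> w \<omega> = 1} \<inter> A"
  have BA: "B \<subseteq> A" by (auto simp: B_def)
  have w0: "AE \<omega> in \<mu>. \<phi> w \<omega> = indicator B \<omega>"
    using ww zw z(2) AE_space
    by eventually_elim (auto simp: B_def indicator_def split: if_splits)
  show ?thesis
  proof (intro bexI[of _ B] conjI notI)
    show "B \<in> sets \<mu>" unfolding B_def using A by measurable
    show "B \<subseteq> A" by (rule BA)
    assume "AE \<omega> in \<mu>. \<omega> \<notin> B"
    then have "AE \<omega> in \<mu>. \<phi> w \<omega> = \<phi> zero_op \<omega>" using w0 center_iso_zero by eventually_elim simp
    from center_iso_inj[OF wc zero_in_center this] w(3) show False by contradiction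
  next
    assume "AE \<omega> in \<mu>. \<omega> \<notin> A - B"
    then have "AE \<omega> in \<mu>. \<phi> w \<omega> = \<phi> z \<omega>"
      using w0 z(2)
    proof eventually_elim
      case (elim \<omega>)
      have "\<omega> \<in> B \<longleftrightarrow> \<omega> \<in> A" using elim(1) BA by blast
      then show ?case using elim(2,3) by (simp add: indicator_def)
    qed
    from center_iso_inj[OF wc zc this] w(4) show False by contradiction
  qed
qed

text \<open>Split repeatedly and keep the part with the smaller value of \<mu> + \<nu>; with the
  sum, one set becomes small for both measures.\<close>

lemma small_nonnull_subset:
  assumes al: "atomless (center M)" and N: "finite_measure \<nu>" "sets \<nu> = sets \<mu>"
    and A: "A \<in> sets \<mu>" and A0: "\<not> (AE \<omega> in \<mu>. \<omega> \<notin> A)"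
  shows "\<exists>B\<in>sets \<mu>. B \<subseteq> A \<and> \<not> (AE \<omega> in \<mu>. \<omega> \<notin> B) \<and>
    prob B + measure \<nu> B \<le> (prob A + measure \<nu> A) / 2 ^ n"
proof (induction n)
  case 0 then show ?case using A A0 by auto
next
  case (Suc n)
  interpret \<nu>: finite_measure \<nu> by (rule N(1))
  obtain B where B: "B \<in> sets \<mu>" "B \<subseteq> A" "\<not> (AE \<omega> in \<mu>. \<omega> \<notin> B)"
    "prob B + measure \<nu> B \<le> (prob A + measure \<nu> A) / 2 ^ n" using Suc by blast
  obtain C where C: "C \<in> sets \<mu>" "C \<subseteq> B" "\<not> (AE \<omega> in \<mu>. \<omega> \<notin> C)" "\<not> (AE \<omega> in \<mu>. \<omega> \<notin> B - C)"
    using atomless_center_split[OF al B(1,3)] by blast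
  have sum: "prob B + measure \<nu> B = (prob C + measure \<nu> C) + (prob (B - C) + measure \<nu> (B - C))"
    using finite_measure_Diff[OF B(1) C(1,2)] \<nu>.finite_measure_Diff[of B C] B(1) C(1,2) by (simp add: N(2))
  have half: "(prob B + measure \<nu> B) / 2 \<le> (prob A + measure \<nu> A) / 2 ^ Suc n"
    using divide_right_mono[OF B(4), of 2] by (simp add: field_simps)
  show ?case
  proof (cases "prob C + measure \<nu> C \<le> prob (B - C) + measure \<nu> (B - C)")
    case True
    then have "prob C + measure \<nu> C \<le> (prob B + measure \<nu> B) / 2" using sum by argo
    then have "prob C + measure \<nu> C \<le> (prob A + measure \<nu> A) / 2 ^ Suc n" using half by (rule order_trans)
    then show ?thesis using B C by blast
  next
    case False
    then have "prob (B - C) + measure \<nu> (B - C) \<le> (prob B + measure \<nu> B) / 2" using sum by argo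
    then have "prob (B - C) + measure \<nu> (B - C) \<le> (prob A + measure \<nu> A) / 2 ^ Suc n"
      using half by (rule order_trans)
    moreover have "B - C \<in> sets \<mu>" "B - C \<subseteq> A" using B C by auto
    ultimately show ?thesis using C by blast
  qed
qed

end

section \<open>Comparison of the two pairs\<close>

lemma ae_filter_cong:
  assumes "sets \<mu> = sets \<mu>'" "null_sets \<mu> = null_sets \<mu>'"
  shows "ae_filter \<mu> = ae_filter \<mu>'"
  using assms sets_eq_imp_space_eq[OF assms(1)] by (simp add: ae_filter_def)

locale pairs_with_equal_F_norm = P: dimension M \<mu> \<phi> D + P': dimension M \<mu>' \<phi> D'
  for M :: "('h::chilbert_space \<Rightarrow> 'h) set" and \<mu> \<mu>' :: "'w measure" and \<phi> D D' +
  assumes sets_eq: "sets \<mu> = sets \<mu>'" and null_eq: "null_sets \<mu> = null_sets \<mu>'"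
    and F_eq: "\<And>p. p \<in> projections M \<Longrightarrow> F_norm \<mu> D (graph_of p) = F_norm \<mu>' D' (graph_of p)"
begin

lemma ae_eq: "ae_filter \<mu>' = ae_filter \<mu>"
  using ae_filter_cong[OF sets_eq null_eq] by simp

lemma AE_eq: "(AE \<omega> in \<mu>'. Q \<omega>) \<longleftrightarrow> (AE \<omega> in \<mu>. Q \<omega>)"
  unfolding ae_eq ..

lemma space_eq: "space \<mu>' = space \<mu>"
  using sets_eq_imp_space_eq[OF sets_eq] by simp

lemma measure_eqI_prob:
  assumes "\<And>A. A \<in> sets \<mu> \<Longrightarrow> P.prob A = P'.prob A" shows "\<mu> = \<mu>'"
  using assms by (intro measure_eqI sets_eq) (simp add: P.emeasure_eq_measure P'.emeasure_eq_measure)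

text \<open>The axioms of a dimension function depend on the measure only through measurability and
  null sets, which \<mu> and \<mu>' share.\<close>

lemma dimension_transfer: "dimension M \<mu> \<phi> D'"
proof -
  have "borel_measurable \<mu>' = (borel_measurable \<mu> :: ('w \<Rightarrow> ennreal) set)"
    by (rule measurable_cong_sets[OF sets_eq[symmetric] refl])
  then have "dimension_function M \<mu> \<phi> D'"
    using P'.dim unfolding dimension_function_def is_Lplus_sup_def ae_eq by simp
  then show ?thesis using P.center_iso by unfold_locales
qed

lemma prob_eq_if_small:
  assumes A: "A \<in> sets \<mu>" and l: "AE \<omega> in \<mu>. \<omega> \<in> A \<longrightarrow> ennreal (P.prob A) \<le> D id \<omega>"
    and l': "AE \<omega> in \<mu>. \<omega> \<in> A \<longrightarrow> ennreal (P'.prob A) \<le> D' id \<omega>"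
  shows "P.prob A = P'.prob A"
proof -
  obtain z where z: "z \<in> projections (center M)" "AE \<omega> in \<mu>. \<phi> z \<omega> = indicator A \<omega>"
    using A by (rule P.central_indicator)
  have "P.prob A = F_norm \<mu> D (graph_of z)" by (rule P.F_norm_central[OF A z l, symmetric])
  also have "\<dots> = F_norm \<mu>' D' (graph_of z)" by (rule F_eq[OF P.central_projection[OF z(1)]])
  also have "\<dots> = P'.prob A"
    using A z l' by (intro P'.F_norm_central) (simp_all add: sets_eq AE_eq)
  finally show ?thesis .
qed

lemma measures_eq_if_infinite:
  assumes "\<And>z. z \<in> projections (center M) \<Longrightarrow> finite_proj M z \<Longrightarrow> z = zero_op"
  shows "\<mu> = \<mu>'"
proof (rule measure_eqI_prob, rule prob_eq_if_small)
  have i: "AE \<omega> in \<mu>. D id \<omega> = \<infinity>" by (rule P.dim_id_infinite) (rule assms)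
  have i': "AE \<omega> in \<mu>. D' id \<omega> = \<infinity>"
    unfolding AE_eq[symmetric] by (rule P'.dim_id_infinite) (rule assms)
  fix A
  show "AE \<omega> in \<mu>. \<omega> \<in> A \<longrightarrow> ennreal (P.prob A) \<le> D id \<omega>"
    using i by eventually_elim simp
  show "AE \<omega> in \<mu>. \<omega> \<in> A \<longrightarrow> ennreal (P'.prob A) \<le> D' id \<omega>"
    using i' by eventually_elim simp
qed

text \<open>The only central projections are 0 and 1, so every measurable set is null or conull, and
  on such sets measures with the same null sets agree.\<close>

lemma measures_eq_if_factor:
  assumes fac: "is_factor M" shows "\<mu> = \<mu>'"
proof (rule measure_eqI_prob)
  fix A assume A: "A \<in> sets \<mu>"
  then have A': "A \<in> sets \<mu>'" by (simp add: sets_eq)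
  obtain z where z: "z \<in> projections (center M)" "AE \<omega> in \<mu>. \<phi> z \<omega> = indicator A \<omega>"
    using A by (rule P.central_indicator)
  have zc: "z \<in> center M" and zp: "is_projection z" using z(1) by (simp_all add: projections_def)
  obtain c where c: "z = (\<lambda>\<xi>. c *\<^sub>C \<xi>)" using fac zc by (auto simp: is_factor_def)
  have "z = zero_op \<or> z = id"
  proof (cases "c = 0")
    case False
    have "z x = x" for x
    proof -
      have "c *\<^sub>C (z x - x) = 0"
        using projection_idem[OF zp, of x] by (simp add: c scaleC_diff_right)
      then have "norm (z x - x) = 0" using False norm_scaleC[of c "z x - x"] by simp
      then show ?thesis by simp
    qed
    then show ?thesis by auto
  qed (simp add: c)
  then show "P.prob A = P'.prob A"
  proof
    assume "z = zero_op"
    then have "AE \<omega> in \<mu>. \<omega> \<notin> A" using z(2) by (intro P.null_if_central_zero) simp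
    then show ?thesis using P.prob_eq_0[OF A] P'.prob_eq_0[OF A'] by (simp add: AE_eq)
  next
    assume zid: "z = id"
    \<comment> \<open>That \<phi>(1) = 1 is not among the clauses of
      \<open>center_isomorphism\<close>; it follows from \<phi>(w) = \<phi>(w) \<phi>(1) for some w
      with \<phi>(w) = 1.\<close>
    obtain w where w: "w \<in> projections (center M)" "AE \<omega> in \<mu>. \<phi> w \<omega> = indicator (space \<mu>) \<omega>"
      using P.central_indicator[OF sets.top] by blast
    have "w \<in> center M" using w(1) by (simp add: projections_def)
    from P.center_iso_mult[OF this P.id_in_center]
    have "AE \<omega> in \<mu>. \<phi> w \<omega> = \<phi> w \<omega> * \<phi> id \<omega>" by simp
    then have "AE \<omega> in \<mu>. \<omega> \<in> A"
      using w(2) z(2) AE_space unfolding zid by eventually_elim (auto simp: indicator_def split: if_splits)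
    then show ?thesis using P.prob_eq_1[OF A] P'.prob_eq_1[OF A'] by (simp add: AE_eq)
  qed
qed

text \<open>Let h be the density of \<mu>' with respect to \<mu>. If h > 1 on a non-null set, a
  small non-null part B of it satisfies \<mu>(B) = \<mu>'(B) by \<open>prob_eq_if_small\<close>, yet
  integrating h over B gives more. So \<mu>' \<le> \<mu>, and total mass 1 turns this into
  equality.\<close>

lemma measures_eq_if_atomless:
  assumes al: "atomless (center M)" shows "\<mu> = \<mu>'"
proof -
  have "absolutely_continuous \<mu> \<mu>'" by (simp add: absolutely_continuous_def null_eq)
  from P.Radon_Nikodym[OF this sets_eq[symmetric]] obtain h
    where h[measurable]: "h \<in> borel_measurable \<mu>" and hd: "density \<mu> h = \<mu>'" by blast
  have em: "emeasure \<mu>' A = (\<integral>\<^sup>+\<omega>. h \<omega> * indicator A \<omega> \<partial>\<mu>)" if "A \<in> sets \<mu>" for A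
    unfolding hd[symmetric] using that by (simp add: emeasure_density)
  have m[measurable]: "D id \<in> borel_measurable \<mu>" "D' id \<in> borel_measurable \<mu>"
    using P.dim_measurable[OF P.id_projection] dimension.dim_measurable[OF dimension_transfer P.id_projection] by auto
  have pos: "AE \<omega> in \<mu>. 0 < D id \<omega>" "AE \<omega> in \<mu>. 0 < D' id \<omega>"
    using P.dim_id_positive P'.dim_id_positive by (simp_all add: AE_eq)
  have "AE \<omega> in \<mu>. h \<omega> \<le> 1"
  proof (rule ccontr)
    assume not_le: "\<not> (AE \<omega> in \<mu>. h \<omega> \<le> 1)"
    \<comment> \<open>Both dimensions of 1 are positive almost everywhere, so up to a null set the
      \<open>C n\<close> exhaust the set where h > 1.\<close>
    define C where "C n = {\<omega> \<in> space \<mu>. 1 < h \<omega> \<and> ennreal (1 / Suc n) \<le> D id \<omega> \<and> ennreal (1 / Suc n) \<le> D' id \<omega>}"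
      for n
    have C[measurable]: "C n \<in> sets \<mu>" for n unfolding C_def by measurable
    have "\<exists>n. \<not> (AE \<omega> in \<mu>. \<omega> \<notin> C n)"
    proof (rule ccontr)
      assume "\<not> ?thesis"
      then have "AE \<omega> in \<mu>. \<forall>n. \<omega> \<notin> C n" by (simp add: AE_all_countable)
      then have "AE \<omega> in \<mu>. h \<omega> \<le> 1" using pos AE_space
      proof eventually_elim
        case (elim \<omega>)
        have "0 < min (D id \<omega>) (D' id \<omega>)" using elim by simp
        then obtain n where "ennreal (1 / Suc n) \<le> min (D id \<omega>) (D' id \<omega>)"
        proof (cases "min (D id \<omega>) (D' id \<omega>)")
          case (real r)
          then obtain n where "inverse (real (Suc n)) < r"
            using \<open>0 < min (D id \<omega>) (D' id \<omega>)\<close> reals_Archimedean[of r] by auto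
          then have "ennreal (1 / Suc n) \<le> ennreal r" by (intro ennreal_leI) (simp add: inverse_eq_divide)
          then show ?thesis using that real by simp
        qed (use that in simp)
        then show ?case using elim(1,4) by (auto simp: C_def not_less)
      qed
      then show False using not_le by blast
    qed
    then obtain n where n: "\<not> (AE \<omega> in \<mu>. \<omega> \<notin> C n)" by blast
    \<comment> \<open>Why \<open>Suc n\<close> halvings: the total mass is at most 2, and 2/2^(n+1)
      = 1/2^n \<le> 1/(n+1), the lower bound for D(1) and D'(1) on \<open>C n\<close>.\<close>
    obtain B where B: "B \<in> sets \<mu>" "B \<subseteq> C n" "\<not> (AE \<omega> in \<mu>. \<omega> \<notin> B)"
      "P.prob B + P'.prob B \<le> (P.prob (C n) + P'.prob (C n)) / 2 ^ Suc n"
      using P.small_nonnull_subset[OF al P'.finite_measure_axioms sets_eq[symmetric] C n, of "Suc n"] by blast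
    have "(P.prob (C n) + P'.prob (C n)) / 2 ^ Suc n \<le> 2 / 2 ^ Suc n"
      using add_mono[OF P.prob_le_1[of "C n"] P'.prob_le_1[of "C n"]] by (intro divide_right_mono) simp_all
    also have "\<dots> = 1 / 2 ^ n" by simp
    also have "\<dots> \<le> 1 / real (Suc n)"
    proof (rule divide_left_mono)
      have "Suc n \<le> 2 ^ n" by (simp add: Suc_leI)
      then show "real (Suc n) \<le> 2 ^ n" by (metis of_nat_le_iff of_nat_numeral of_nat_power)
    qed auto
    finally have "P.prob B + P'.prob B \<le> 1 / real (Suc n)" using B(4) by argo
    moreover have "0 \<le> P.prob B" "0 \<le> P'.prob B" by simp_all
    ultimately have "P.prob B \<le> 1 / Suc n" "P'.prob B \<le> 1 / Suc n" by argo+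
    then have sm: "ennreal (P.prob B) \<le> ennreal (1 / Suc n)" "ennreal (P'.prob B) \<le> ennreal (1 / Suc n)"
      by (auto intro: ennreal_leI)
    have "P.prob B = P'.prob B"
    proof (rule prob_eq_if_small[OF B(1)])
      show "AE \<omega> in \<mu>. \<omega> \<in> B \<longrightarrow> ennreal (P.prob B) \<le> D id \<omega>"
        using B(2) by (intro AE_I2 impI order_trans[OF sm(1)]) (auto simp: C_def)
      show "AE \<omega> in \<mu>. \<omega> \<in> B \<longrightarrow> ennreal (P'.prob B) \<le> D' id \<omega>"
        using B(2) by (intro AE_I2 impI order_trans[OF sm(2)]) (auto simp: C_def)
    qed
    moreover have "emeasure \<mu> B < emeasure \<mu>' B"
    proof -
      have "(\<integral>\<^sup>+\<omega>. indicator B \<omega> \<partial>\<mu>) < (\<integral>\<^sup>+\<omega>. h \<omega> * indicator B \<omega> \<partial>\<mu>)"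
      proof (rule nn_integral_less)
        show "(\<integral>\<^sup>+\<omega>. indicator B \<omega> \<partial>\<mu>) \<noteq> \<infinity>" using B(1) by simp
        show "AE \<omega> in \<mu>. indicator B \<omega> \<le> h \<omega> * indicator B \<omega>"
          using B(2) by (intro AE_I2) (auto simp: C_def indicator_def)
        show "\<not> (AE \<omega> in \<mu>. h \<omega> * indicator B \<omega> \<le> indicator B \<omega>)"
        proof
          assume "AE \<omega> in \<mu>. h \<omega> * indicator B \<omega> \<le> indicator B \<omega>"
          then have "AE \<omega> in \<mu>. \<omega> \<notin> B"
            by eventually_elim (use B(2) in \<open>auto simp: C_def indicator_def not_less[symmetric] split: if_splits\<close>)
          then show False using B(3) by blast
        qed
      qed (use B(1) in measurable)
      then show ?thesis using B(1) by (simp add: em)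
    qed
    ultimately show False by (simp add: P.emeasure_eq_measure P'.emeasure_eq_measure)
  qed
  then have le: "P'.prob A \<le> P.prob A" if "A \<in> sets \<mu>" for A
  proof -
    assume h1: "AE \<omega> in \<mu>. h \<omega> \<le> 1"
    have "emeasure \<mu>' A \<le> (\<integral>\<^sup>+\<omega>. indicator A \<omega> \<partial>\<mu>)"
      unfolding em[OF that]
      by (rule nn_integral_mono_AE) (use h1 in \<open>eventually_elim, auto simp: indicator_def\<close>)
    then show ?thesis using that by (simp add: P.emeasure_eq_measure P'.emeasure_eq_measure)
  qed
  show ?thesis
  proof (rule measure_eqI_prob)
    fix A assume A: "A \<in> sets \<mu>"
    \<comment> \<open>The inequality for the complement is the reverse inequality for A.\<close>
    have "1 - P'.prob A \<le> 1 - P.prob A"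
      using le[OF sets.compl_sets[OF A]] A P.prob_compl[of A] P'.prob_compl[of A]
      by (simp add: sets_eq space_eq)
    then show "P.prob A = P'.prob A" using le[OF A] by simp
  qed
qed

lemma dimensions_eq:
  assumes "\<And>r. abelian_proj M r \<Longrightarrow> r = zero_op" "\<mu> = \<mu>'" "p \<in> projections M"
  shows "AE \<omega> in \<mu>. D p \<omega> = D' p \<omega>"
proof -
  have F: "F_norm \<mu> D (graph_of q) = F_norm \<mu> D' (graph_of q)" if "q \<in> projections M" for q
    using F_eq[OF that] assms(2) by simp
  have "AE \<omega> in \<mu>. D p \<omega> \<le> D' p \<omega>"
    by (rule P.dimension_le[OF dimension_transfer assms(1) F assms(3)])
  moreover have "AE \<omega> in \<mu>. D' p \<omega> \<le> D p \<omega>"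
    by (rule dimension.dimension_le[OF dimension_transfer P.dimension_axioms assms(1) F[symmetric] assms(3)])
  ultimately show ?thesis by eventually_elim simp
qed

end

theorem theorem1p3:
  fixes M :: "('h::chilbert_space \<Rightarrow> 'h) set"
    and \<mu> \<mu>' :: "'w measure"
    and \<phi> :: "('h \<Rightarrow> 'h) \<Rightarrow> 'w \<Rightarrow> complex"
    and D D' :: "('h \<Rightarrow> 'h) \<Rightarrow> 'w \<Rightarrow> ennreal"
  assumes "von_neumann_algebra M"
    and "countably_decomposable (center M)"
    and "is_pair M \<phi> \<mu> D"
    and "is_pair M \<phi> \<mu>' D'"
    and "sets \<mu> = sets \<mu>'"
    and "null_sets \<mu> = null_sets \<mu>'"
    and "(type_II_inf M \<or> type_III M) \<or>
         (type_II_1 M \<and> atomless (center M) \<or> type_II_1 M \<and> is_factor M)"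
    and "equivalent_pairs M \<mu> D \<mu>' D'"
  shows "\<mu> = \<mu>' \<and> (\<forall>p\<in>projections M. AE \<omega> in \<mu>. D p \<omega> = D' p \<omega>)"
proof -
  interpret vn_algebra M by unfold_locales (rule assms(1))
  have "dimension M \<mu> \<phi> D" "dimension M \<mu>' \<phi> D'"
    using assms(3,4)
    by (auto simp: is_pair_def dimension_def dimension_axioms_def intro: vn_algebra_axioms)
  moreover have "F_norm \<mu> D (graph_of p) = F_norm \<mu>' D' (graph_of p)" if "p \<in> projections M" for p
    using assms(8) projection_graph_in_LS[OF that] by (simp add: equivalent_pairs_def)
  ultimately interpret pairs_with_equal_F_norm M \<mu> \<mu>' \<phi> D D'
    using assms(5,6) by (simp add: pairs_with_equal_F_norm_def pairs_with_equal_F_norm_axioms_def)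
  have "\<mu> = \<mu>'"
    using assms(7)
  proof (elim disjE conjE)
    assume "type_II_inf M"
    then show ?thesis by (intro measures_eq_if_infinite) (simp add: type_II_inf_def)
  next
    assume "type_III M"
    then show ?thesis by (intro measures_eq_if_infinite) (simp add: type_III_def)
  next
    assume "atomless (center M)" then show ?thesis by (rule measures_eq_if_atomless)
  next
    assume "is_factor M" then show ?thesis by (rule measures_eq_if_factor)
  qed
  moreover have "r = zero_op" if "abelian_proj M r" for r
    using assms(7) that by (intro no_abelian_if_type_II_or_III) (auto simp: type_II_inf_def type_II_1_def)
  ultimately show ?thesis using dimensions_eq by blast
qed

end
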